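(* Let $T$ be an Ammann--Beenker tiling, placed so that some side of some rhombus is parallel to the horizontal axis, and let $G$ be the associated planar graph. Then $\chi'(G)=8$, and an explicit proper edge colouring of $G$ with eight colours is given by the directional alternating colouring method for the vectors $\vec u_1=(1,0)$, $\vec u_2=(1,1)$, $\vec u_3=(0,1)$, $\vec u_4=(1,-1)$.
   Context: Ammann--Beenker substitution. Prototiles: a right isosceles triangle with sides $1,1,\sqrt2$ whose hypotenuse carries an arrow pointing from one of its endpoints (tail) to the other (head), and a rhombus of side $1$ with an angle of $45^\circ$. Let $\lambda=1+\sqrt2$, $h=\sqrt2/2$. The substitution $\omega$ expands by $\lambda$ and dissects as follows. (1) The triangle with vertices $(0,0),(\sqrt2,0),(h,h)$ and arrow from $(0,0)$ to $(\sqrt2,0)$: the expanded triangle with vertices $(0,0),(2+\sqrt2,0),(1+h,1+h)$ is dissected into the triangle $(0,0),(1,0),(1,1)$ with arrow from $(1,1)$ to $(0,0)$; the triangle $(1,0),(1+\sqrt2,0),(1+h,h)$ with arrow from $(1+\sqrt2,0)$ to $(1,0)$; the triangle $(1+h,h),(2+h,h),(1+h,1+h)$ with arrow from $(2+h,h)$ to $(1+h,1+h)$; the rhombus $(1,0),(1,1),(1+h,1+h),(1+h,h)$; and the rhombus $(1+\sqrt2,0),(2+\sqrt2,0),(2+h,h),(1+h,h)$. (2) The rhombus with vertices $(0,0),(1,0),(1+h,h),(h,h)$: the expanded rhombus with vertices $(0,0),(\lambda,0),(2+3h,1+h),(1+h,1+h)$ is dissected into the rhombus $(0,0),(1,0),(1+h,h),(h,h)$;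 the rhombus $(1+h,h),(\lambda,0),(\lambda,1),(1+h,1+h)$; the rhombus $(\lambda,1),(\lambda+1,1),(2+3h,1+h),(1+3h,1+h)$; the triangle $(h,h),(1+h,h),(1+h,1+h)$ with arrow from $(h,h)$ to $(1+h,1+h)$; the triangle $(1,0),(\lambda,0),(1+h,h)$ with arrow from $(1,0)$ to $(\lambda,0)$; the triangle $(\lambda,0),(\lambda,1),(\lambda+1,1)$ with arrow from $(\lambda+1,1)$ to $(\lambda,0)$; and the triangle $(\lambda,1),(1+h,1+h),(1+3h,1+h)$ with arrow from $(1+3h,1+h)$ to $(1+h,1+h)$. The rule is extended to all congruent copies (including reflections) of the prototiles, and to collections of tiles, covariantly. An Ammann--Beenker tiling is a tiling $T$ of $\mathbb{R}^2$ by congruent copies of the (arrowed) prototiles such that every finite set of tiles of $T$ is contained in a congruent copy of $\omega^n(p)$ for some $n\ge0$ and some prototile $p$. Graph: the vertices of $G$ are the corners of the tiles, and the edges are the sides of the tiles (including the hypotenuses of the triangles). $\chi'$ denotes the chromatic index (least number of colours in a proper edge colouring). Directional alternating colouring method for pairwise non-parallel vectors $\vec u_1,\dots,\vec u_n$ such that each edge is parallel to some $\vec u_j$, with colours $c_1,\dots,c_{2n}$: for each line $l$ containing at least one edge, let $j$ be the index with $l\parallel\vec u_j$, and colour the edges contained in $l$, in the order in which they occur along $l$ (whether or not consecutive ones are adjacent), alternately with $c_{2j-1}$ and $c_{2j}$. *)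

theory Defs
  imports "HOL-Analysis.Analysis"
begin

text \<open>The Euclidean plane is the type \<^typ>\<open>complex\<close>, with \<^term>\<open>Complex x y\<close> the point
  with coordinates \<open>(x, y)\<close>.\<close>

text \<open>A tile is given by its sides, each of them recorded by its two endpoints, together with
  the (tail, head) pair of its arrow, if it has one.  In this way tiles are unlabelled: the
  symmetries of a rhombus map it to the very same tile.\<close>

datatype tile = Tile (sides: "complex set set") (arrow: "(complex \<times> complex) option")

definition corners :: "tile \<Rightarrow> complex set" where
  "corners t = \<Union> (sides t)"

definition region :: "tile \<Rightarrow> complex set" where
  "region t = convex hull (corners t)"

definition map_tile :: "(complex \<Rightarrow> complex) \<Rightarrow> tile \<Rightarrow> tile" where
  "map_tile f t = Tile ((`) f ` sides t) (map_option (map_prod f f) (arrow t))"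

definition isometry :: "(complex \<Rightarrow> complex) \<Rightarrow> bool" where
  "isometry f \<longleftrightarrow> (\<forall>x y. dist (f x) (f y) = dist x y)"

definition congruent_copy :: "tile \<Rightarrow> tile \<Rightarrow> bool" where
  "congruent_copy p t \<longleftrightarrow> (\<exists>f. isometry f \<and> t = map_tile f p)"

text \<open>The triangle with hypotenuse from \<open>a\<close> to \<open>b\<close>, carrying the arrow with tail \<open>a\<close> and
  head \<open>b\<close>, and third corner \<open>c\<close>.\<close>

definition triangle :: "complex \<Rightarrow> complex \<Rightarrow> complex \<Rightarrow> tile" where
  "triangle a b c = Tile {{a, b}, {b, c}, {c, a}} (Some (a, b))"

definition rhombus :: "complex \<Rightarrow> complex \<Rightarrow> complex \<Rightarrow> complex \<Rightarrow> tile" where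
  "rhombus a b c d = Tile {{a, b}, {b, c}, {c, d}, {d, a}} None"

abbreviation lam :: real where
  "lam \<equiv> 1 + sqrt 2"

abbreviation hs :: real where
  "hs \<equiv> sqrt 2 / 2"

definition proto_triangle :: tile where
  "proto_triangle = triangle (Complex 0 0) (Complex (sqrt 2) 0) (Complex hs hs)"

definition proto_rhombus :: tile where
  "proto_rhombus =
     rhombus (Complex 0 0) (Complex 1 0) (Complex (1 + hs) hs) (Complex hs hs)"

definition triangle_dissection :: "tile set" where
  "triangle_dissection =
    {triangle (Complex 1 1) (Complex 0 0) (Complex 1 0),
     triangle (Complex (1 + sqrt 2) 0) (Complex 1 0) (Complex (1 + hs) hs),
     triangle (Complex (2 + hs) hs) (Complex (1 + hs) (1 + hs)) (Complex (1 + hs) hs),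
     rhombus (Complex 1 0) (Complex 1 1) (Complex (1 + hs) (1 + hs)) (Complex (1 + hs) hs),
     rhombus (Complex (1 + sqrt 2) 0) (Complex (2 + sqrt 2) 0)
       (Complex (2 + hs) hs) (Complex (1 + hs) hs)}"

definition rhombus_dissection :: "tile set" where
  "rhombus_dissection =
    {rhombus (Complex 0 0) (Complex 1 0) (Complex (1 + hs) hs) (Complex hs hs),
     rhombus (Complex (1 + hs) hs) (Complex lam 0) (Complex lam 1) (Complex (1 + hs) (1 + hs)),
     rhombus (Complex lam 1) (Complex (lam + 1) 1)
       (Complex (2 + 3 * hs) (1 + hs)) (Complex (1 + 3 * hs) (1 + hs)),
     triangle (Complex hs hs) (Complex (1 + hs) (1 + hs)) (Complex (1 + hs) hs),
     triangle (Complex 1 0) (Complex lam 0) (Complex (1 + hs) hs),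
     triangle (Complex (lam + 1) 1) (Complex lam 0) (Complex lam 1),
     triangle (Complex (1 + 3 * hs) (1 + hs)) (Complex (1 + hs) (1 + hs)) (Complex lam 1)}"

text \<open>Covariant extension to congruent copies: the expanded copy \<open>lam f(p)\<close> is the image of the
  expanded prototile \<open>lam p\<close> under the isometry \<open>x \<mapsto> lam f(x / lam)\<close>, and is dissected by
  moving the dissection of \<open>lam p\<close> along.  For the rhombus the isometry \<open>f\<close> is determined only
  up to the symmetries of the rhombus, but these preserve \<^const>\<open>rhombus_dissection\<close>.\<close>

definition expand :: "(complex \<Rightarrow> complex) \<Rightarrow> complex \<Rightarrow> complex" where
  "expand f x = lam *\<^sub>R f (x /\<^sub>R lam)"

definition substitute_tile :: "tile \<Rightarrow> tile set" where
  "substitute_tile t =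
     {map_tile (expand f) s | f s. isometry f \<and>
        (t = map_tile f proto_triangle \<and> s \<in> triangle_dissection \<or>
         t = map_tile f proto_rhombus \<and> s \<in> rhombus_dissection)}"

definition substitute :: "tile set \<Rightarrow> tile set" where
  "substitute P = (\<Union>t\<in>P. substitute_tile t)"

definition tiling :: "tile set \<Rightarrow> bool" where
  "tiling T \<longleftrightarrow>
     (\<forall>t\<in>T. congruent_copy proto_triangle t \<or> congruent_copy proto_rhombus t) \<and>
     (\<Union>t\<in>T. region t) = UNIV \<and>
     (\<forall>s\<in>T. \<forall>t\<in>T. s \<noteq> t \<longrightarrow> interior (region s) \<inter> interior (region t) = {})"

definition ammann_beenker_tiling :: "tile set \<Rightarrow> bool" where
  "ammann_beenker_tiling T \<longleftrightarrow> tiling T \<and>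
     (\<forall>F. finite F \<and> F \<subseteq> T \<longrightarrow>
       (\<exists>n. \<exists>p\<in>{proto_triangle, proto_rhombus}. \<exists>f. isometry f \<and>
          F \<subseteq> map_tile f ` (substitute ^^ n) {p}))"

text \<open>Graphs are pairs of a set of vertices and a set of edges, an edge being the set of its two
  end vertices.\<close>

type_synonym 'a graph = "'a set \<times> 'a set set"

definition tiling_graph :: "tile set \<Rightarrow> complex graph" where
  "tiling_graph T = ((\<Union>t\<in>T. corners t), (\<Union>t\<in>T. sides t))"

definition proper_edge_colouring :: "'a graph \<Rightarrow> nat \<Rightarrow> ('a set \<Rightarrow> nat) \<Rightarrow> bool" where
  "proper_edge_colouring G k c \<longleftrightarrow>
     (\<forall>e\<in>snd G. c e < k) \<and>
     (\<forall>e\<in>snd G. \<forall>e'\<in>snd G. e \<noteq> e' \<and> e \<inter> e' \<noteq> {} \<longrightarrow> c e \<noteq> c e')"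

text \<open>The value is \<open>\<infinity>\<close> if there is no proper edge colouring with finitely many colours.\<close>

definition chromatic_index :: "'a graph \<Rightarrow> enat" where
  "chromatic_index G = Inf {enat k | k. \<exists>c. proper_edge_colouring G k c}"

definition line :: "complex \<Rightarrow> complex \<Rightarrow> complex set" where
  "line p u = range (\<lambda>t::real. p + t *\<^sub>R u)"

definition parallel_to :: "complex set \<Rightarrow> complex \<Rightarrow> bool" where
  "parallel_to e u \<longleftrightarrow> (\<exists>p. e \<subseteq> line p u)"

definition edges_on :: "complex graph \<Rightarrow> complex set \<Rightarrow> complex set set" where
  "edges_on G l = {e \<in> snd G. e \<subseteq> l}"

definition precedes :: "complex \<Rightarrow> complex set \<Rightarrow> complex set \<Rightarrow> bool" where
  "precedes u e e' \<longleftrightarrow> e \<noteq> e' \<and> (\<forall>x\<in>e. \<forall>y\<in>e'. x \<bullet> u \<le> y \<bullet> u)"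

text \<open>Consecutive edges on the line \<open>l\<close> of direction \<open>u\<close>; they need not be adjacent.\<close>

definition consecutive_on ::
    "complex graph \<Rightarrow> complex set \<Rightarrow> complex \<Rightarrow> complex set \<Rightarrow> complex set \<Rightarrow> bool" where
  "consecutive_on G l u e e' \<longleftrightarrow>
     e \<in> edges_on G l \<and> e' \<in> edges_on G l \<and> precedes u e e' \<and>
     \<not> (\<exists>d\<in>edges_on G l. precedes u e d \<and> precedes u d e')"

text \<open>The colourings produced by the directional alternating colouring method for the vectors
  \<open>us\<close>; on each line either of the two colours may come first.  Counting from \<open>0\<close>, the two
  colours reserved for the direction \<open>us ! j\<close> are \<open>2 * j\<close> and \<open>2 * j + 1\<close>.\<close>

definition directional_alternating ::
    "complex list \<Rightarrow> complex graph \<Rightarrow> (complex set \<Rightarrow> nat) \<Rightarrow> bool" where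
  "directional_alternating us G c \<longleftrightarrow>
     0 \<notin> set us \<and>
     (\<forall>i<length us. \<forall>j<length us. i \<noteq> j \<longrightarrow> \<not> collinear {0, us ! i, us ! j}) \<and>
     (\<forall>e\<in>snd G. \<exists>u\<in>set us. parallel_to e u) \<and>
     (\<forall>j<length us. \<forall>p. let u = us ! j; l = line p u in
        (\<forall>e\<in>edges_on G l. c e \<in> {2 * j, 2 * j + 1}) \<and>
        (\<forall>e e'. consecutive_on G l u e e' \<longrightarrow> c e \<noteq> c e'))"

end

theory Submission
  imports Defs
begin

text \<open>Orient the legs of a triangle so that together with its arrow they form a cycle, and orient
  the sides of a rhombus away from its acute corners.  How the substitution cuts an expanded side
  then depends on the oriented side only, so by induction any two tiles of an iterated
  substitution, hence of the tiling, meet in the empty set, a common corner, or a common side on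
  which the orientations agree.  Consequently distinct edges on a line do not overlap, and two
  of them that share a vertex are consecutive, which makes every directional alternating colouring
  proper.  The lower bound comes from a vertex of degree eight: at a corner of an expanded tile all
  tiles have angle \<open>45\<close> degrees, so that edges leave it in all eight directions.\<close>

section \<open>Isometries of the plane\<close>

text \<open>An expanded unit side has length 1 + sqrt 2 and is cut into a unit side and a
  hypotenuse, in an order that neither the rhombi nor the legs of the triangles record. Two
  neighbours with opposite orders would produce different cut points on their common side, so
  edge-to-edge contact alone does not survive a substitution; agreement of orientations is the
  strengthening under which the induction closes. An expanded hypotenuse is cut symmetrically into
  lengths 1, sqrt 2, 1, but its arrow still matters, because the middle piece receives the reversed
  arrow. The orientations are read off from arrows and distances alone, so that every isometry
  carries them along, also a symmetry of the rhombus.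

  A patch sits in the tiling only up to an unknown isometry. Adding the tile with a horizontal side
  to each finite set of tiles pins that isometry down as far as directions are concerned.

  For the vertex of degree eight, the tiles around a large disc are placed in an iterated
  substitution with at least one step; the disc is large enough to contain a corner of an expanded
  tile.\<close>

lemma isometry_cases:
  assumes "isometry f"
  obtains a b where "cmod a = 1" "f = (\<lambda>z. a * z + b)"
  | a b where "cmod a = 1" "f = (\<lambda>z. a * cnj z + b)"
proof -
  define a where "a = f 1 - f 0"
  have d: "cmod (f x - f y) = cmod (x - y)" for x y
    using assms by (simp add: isometry_def dist_norm)
  have na: "cmod a = 1" using d[of 1 0] by (simp add: a_def)
  then have a0: "a \<noteq> 0" by auto
  \<comment> \<open>Normalised to fix 0 and 1. Distances to these two points give the real part and
    the modulus of the imaginary part; the distance to the image of i decides the sign, uniformly in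
    \<open>z\<close>.\<close>
  define g where "g z = (f z - f 0) / a" for z
  have f_eq: "f z = a * g z + f 0" for z using a0 by (simp add: g_def)
  have gd: "cmod (g x - g y) = cmod (x - y)" for x y
  proof -
    have "g x - g y = (f x - f y) / a" by (simp add: g_def diff_divide_distrib)
    then show ?thesis by (simp add: norm_divide na d)
  qed
  have g0: "g 0 = 0" by (simp add: g_def)
  have g1: "g 1 = 1" using a0 by (simp add: g_def a_def)
  have sq: "(Re (g x) - Re (g y))\<^sup>2 + (Im (g x) - Im (g y))\<^sup>2
      = (Re x - Re y)\<^sup>2 + (Im x - Im y)\<^sup>2" for x y
    using arg_cong[OF gd[of x y], of "\<lambda>r. r\<^sup>2"] by (simp add: cmod_power2)
  have re: "Re (g z) = Re z" for z
    using sq[of z 0] sq[of z 1] by (simp add: g0 g1 power2_eq_square algebra_simps)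
  have im: "(Im (g z))\<^sup>2 = (Im z)\<^sup>2" for z using sq[of z 0] re[of z] by (simp add: g0)
  have im1: "(Im (g z) - Im (g \<i>))\<^sup>2 = (Im z - 1)\<^sup>2" for z
    using sq[of z \<i>] re[of z] re[of \<i>] by simp
  have "(Im (g \<i>))\<^sup>2 = 1" using sq[of \<i> 0] re[of \<i>] by (simp add: g0)
  then consider "Im (g \<i>) = 1" | "Im (g \<i>) = -1" by (auto simp: power2_eq_1_iff)
  then show thesis
  proof cases
    case 1
    have "Im (g z) = Im z" for z
      using im[of z] im1[of z] unfolding 1 power2_diff by linarith
    then have "g z = z" for z using re by (simp add: complex_eq_iff)
    then have "f = (\<lambda>z. a * z + f 0)" using f_eq by metis
    then show ?thesis using that(1) na by blast
  next
    case 2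
    have "Im (g z) = - Im z" for z
      using im[of z] im1[of z] unfolding 2 power2_diff by simp
    then have "g z = cnj z" for z using re by (simp add: complex_eq_iff)
    then have "f = (\<lambda>z. a * cnj z + f 0)" using f_eq by metis
    then show ?thesis using that(2) na by blast
  qed
qed

lemma isometry_direct: "cmod a = 1 \<Longrightarrow> isometry (\<lambda>z. a * z + b)"
  by (auto simp: isometry_def dist_norm norm_mult simp flip: right_diff_distrib)

lemma isometry_opposite: "cmod a = 1 \<Longrightarrow> isometry (\<lambda>z. a * cnj z + b)"
  by (auto simp: isometry_def dist_norm norm_mult simp flip: right_diff_distrib complex_cnj_diff)

lemma isometry_comp: "isometry f \<Longrightarrow> isometry g \<Longrightarrow> isometry (f \<circ> g)"
  by (simp add: isometry_def)

lemma isometry_id: "isometry id"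
  by (simp add: isometry_def)

lemma isometry_dist: "isometry f \<Longrightarrow> dist (f x) (f y) = dist x y"
  by (simp add: isometry_def)

lemma isometry_inj: "isometry f \<Longrightarrow> inj f"
  by (metis dist_eq_0_iff injI isometry_def)

lemma isometry_surj:
  assumes "isometry f" shows "surj f"
proof -
  from assms show ?thesis
  proof (cases rule: isometry_cases)
    case (1 a b)
    then show ?thesis by (intro surjI[of _ "\<lambda>y. (y - b) / a"]) (use 1 in force)
  next
    case (2 a b)
    then show ?thesis by (intro surjI[of _ "\<lambda>y. cnj ((y - b) / a)"]) (use 2 in force)
  qed
qed

lemma isometry_inv:
  assumes "isometry f" shows "isometry (inv f)"
  using isometry_dist[OF assms, of "inv f x" "inv f y" for x y]
  by (simp add: isometry_def surj_f_inv_f[OF isometry_surj[OF assms]])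

lemma isometry_hull:
  assumes "isometry f" shows "f ` (convex hull S) = convex hull (f ` S)"
proof -
  from assms obtain g b where g: "linear g" "f = (\<lambda>z. b + g z)"
  proof (cases rule: isometry_cases)
    case (1 a b)
    then show ?thesis
      using that[of "\<lambda>z. a * z" b] bounded_linear.linear[OF bounded_linear_mult_right, of a]
      by (simp add: add.commute)
  next
    case (2 a b)
    have "linear (\<lambda>z. a * cnj z)"
      by (rule linearI) (auto simp: algebra_simps)
    then show ?thesis using that[of "\<lambda>z. a * cnj z" b] 2 by (simp add: add.commute)
  qed
  have *: "f ` X = (+) b ` g ` X" for X by (auto simp: g)
  show ?thesis unfolding *
    by (simp add: convex_hull_translation convex_hull_linear_image[OF g(1)])
qed

lemma expand_scaleR: "expand f (lam *\<^sub>R x) = lam *\<^sub>R f x"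
proof -
  have "lam > 0" by (simp add: add_pos_pos)
  then show ?thesis by (simp add: expand_def)
qed

text \<open>Conjugation by a scaling keeps the linear part and scales the translation, so
  \<open>expand f\<close> moves an expanded tile the way \<open>f\<close> moves the tile.\<close>

lemma expand_direct: "expand (\<lambda>z. a * z + b) = (\<lambda>z. a * z + lam *\<^sub>R b)"
proof -
  have "lam > 0" by (simp add: add_pos_pos)
  then show ?thesis by (simp add: expand_def fun_eq_iff scaleR_add_right)
qed

lemma expand_opposite: "expand (\<lambda>z. a * cnj z + b) = (\<lambda>z. a * cnj z + lam *\<^sub>R b)"
proof -
  have "lam > 0" by (simp add: add_pos_pos)
  then show ?thesis by (simp add: expand_def fun_eq_iff scaleR_add_right)
qed

lemma isometry_expand:
  assumes "isometry f" shows "isometry (expand f)"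
  using assms
  by (cases rule: isometry_cases)
     (auto simp: expand_direct expand_opposite isometry_direct isometry_opposite)

lemma expand_comp: "expand (f \<circ> g) = expand f \<circ> expand g"
  by (rule ext) (simp add: expand_def add_pos_pos[THEN less_imp_neq, symmetric])

lemma isometry_affine:
  assumes "isometry f"
  shows "f (x + r *\<^sub>R (y - x)) = f x + r *\<^sub>R (f y - f x)"
  using assms
  by (cases rule: isometry_cases)
     (auto simp: scaleR_conv_of_real algebra_simps)

section \<open>Oriented sides and acute corners\<close>

text \<open>The threshold 2 separates the squared diagonals 2 - sqrt 2 and 2 + sqrt 2 of the
  rhombus. A distance has to pick out the acute corners because the tile does not label its
  corners.\<close>

definition sharp :: "tile \<Rightarrow> complex set" where
  "sharp t = {x \<in> corners t. case arrow t of
      Some (a, b) \<Rightarrow> x = a \<or> x = b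
    | None \<Rightarrow> (\<exists>z\<in>corners t. 2 < (dist x z)\<^sup>2)}"

text \<open>For a triangle the three disjuncts spell out the cycle a, b, c without naming the third
  corner c, which the tile does not record separately.\<close>

definition flow :: "tile \<Rightarrow> (complex \<times> complex) set" where
  "flow t = {(x, y). {x, y} \<in> sides t \<and>
     (case arrow t of
        Some (a, b) \<Rightarrow> x = a \<and> y = b \<or> x = b \<and> y \<noteq> a \<or> y = a \<and> x \<noteq> b
      | None \<Rightarrow> x \<in> sharp t)}"

lemma sides_map [simp]: "sides (map_tile f t) = (`) f ` sides t"
  by (simp add: map_tile_def)

lemma arrow_map [simp]: "arrow (map_tile f t) = map_option (map_prod f f) (arrow t)"
  by (simp add: map_tile_def)

lemma corners_map [simp]: "corners (map_tile f t) = f ` corners t"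
  by (auto simp: corners_def)

lemma map_tile_comp: "map_tile f (map_tile g t) = map_tile (f \<circ> g) t"
  by (simp add: map_tile_def image_image option.map_comp comp_def prod.map_comp[unfolded comp_def])

lemma map_tile_id [simp]: "map_tile id t = t"
  by (cases t) (simp add: map_tile_def prod.map_id0 option.map_id0)

lemma map_tile_inv:
  assumes "isometry f" shows "map_tile (inv f) (map_tile f t) = t"
  using isometry_inj[OF assms] by (simp add: map_tile_comp)

lemma region_map: "isometry f \<Longrightarrow> region (map_tile f t) = f ` region t"
  by (simp add: region_def isometry_hull)

lemma sharp_map_subset:
  assumes "isometry f" shows "f ` sharp t \<subseteq> sharp (map_tile f t)"
  using isometry_dist[OF assms] by (auto simp: sharp_def split: option.splits)

lemma flow_map_subset:
  assumes f: "isometry f" and xy: "(x, y) \<in> flow t" shows "(f x, f y) \<in> flow (map_tile f t)"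
proof -
  have "{f x, f y} \<in> sides (map_tile f t)"
    using xy imageI[of "{x, y}" "sides t" "(`) f"] by (simp add: flow_def)
  moreover have "f x = f y \<longleftrightarrow> x = y" for x y
    using isometry_inj[OF f] by (auto simp: inj_eq)
  moreover have "f x \<in> sharp (map_tile f t)" if "x \<in> sharp t"
    using sharp_map_subset[OF f] that by auto
  ultimately show ?thesis
    using xy by (auto simp: flow_def simp del: sides_map split: option.splits)
qed

lemma sharp_map:
  assumes "isometry f" shows "sharp (map_tile f t) = f ` sharp t"
proof
  have "inv f ` sharp (map_tile f t) \<subseteq> sharp t"
    using sharp_map_subset[OF isometry_inv[OF assms], of "map_tile f t"]
    by (simp add: map_tile_inv[OF assms])
  then have "f ` inv f ` sharp (map_tile f t) \<subseteq> f ` sharp t" by blast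
  then show "sharp (map_tile f t) \<subseteq> f ` sharp t"
    by (simp add: image_f_inv_f isometry_surj[OF assms])
qed (rule sharp_map_subset[OF assms])

lemma flow_mapE:
  assumes f: "isometry f" and "(x, y) \<in> flow (map_tile f t)"
  obtains x' y' where "(x', y') \<in> flow t" "x = f x'" "y = f y'"
proof
  show "(inv f x, inv f y) \<in> flow t"
    using flow_map_subset[OF isometry_inv[OF f] assms(2)] by (simp add: map_tile_inv[OF f])
qed (simp_all add: surj_f_inv_f isometry_surj[OF f])

lemma flow_corners: "(x, y) \<in> flow t \<Longrightarrow> x \<in> corners t \<and> y \<in> corners t"
  by (auto simp: flow_def corners_def)

lemma sharp_corners: "sharp t \<subseteq> corners t"
  by (auto simp: sharp_def)

lemma flow_sides: "(x, y) \<in> flow t \<Longrightarrow> {x, y} \<in> sides t"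
  by (auto simp: flow_def)

lemma corners_region: "corners t \<subseteq> region t"
  by (simp add: region_def hull_subset)

lemma corners_triangle [simp]: "corners (triangle a b c) = {a, b, c}"
  by (auto simp: corners_def triangle_def)

lemma corners_rhombus [simp]: "corners (rhombus a b c d) = {a, b, c, d}"
  by (auto simp: corners_def rhombus_def)

text \<open>Brings an acute corner to the front, as \<open>flow_rhombus\<close> expects; some rhombi
  of the dissections are listed from an obtuse corner.\<close>

lemma rhombus_turn: "rhombus a b c d = rhombus b c d a"
  by (auto simp: rhombus_def)

lemma flow_triangle:
  assumes "a \<noteq> b" "b \<noteq> c" "c \<noteq> a"
  shows "flow (triangle a b c) = {(a, b), (b, c), (c, a)}"
  using assms by (auto simp: flow_def triangle_def doubleton_eq_iff)

lemma sharp_triangle: "sharp (triangle a b c) = {a, b}"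
  using corners_triangle[of a b c] by (auto simp: sharp_def triangle_def)

lemma sharp_rhombus:
  assumes "2 < (dist a c)\<^sup>2" "(dist b d)\<^sup>2 \<le> 2"
    "dist a b = 1" "dist b c = 1" "dist c d = 1" "dist d a = 1"
  shows "sharp (rhombus a b c d) = {a, c}"
proof -
  have "sharp (rhombus a b c d) = {x \<in> {a, b, c, d}. \<exists>z\<in>{a, b, c, d}. 2 < (dist x z)\<^sup>2}"
    using corners_rhombus[of a b c d] by (simp add: sharp_def rhombus_def)
  also have "\<dots> = {a, c}" using assms by (auto simp: dist_commute)
  finally show ?thesis .
qed

lemma flow_rhombus:
  assumes "2 < (dist a c)\<^sup>2" "(dist b d)\<^sup>2 \<le> 2"
    "dist a b = 1" "dist b c = 1" "dist c d = 1" "dist d a = 1"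
  shows "flow (rhombus a b c d) = {(a, b), (a, d), (c, b), (c, d)}"
proof -
  have n: "a \<noteq> b" "b \<noteq> c" "c \<noteq> d" "d \<noteq> a" using assms by auto
  have "flow (rhombus a b c d) = {(x, y). {x, y} \<in> sides (rhombus a b c d) \<and> x \<in> {a, c}}"
    using sharp_rhombus[OF assms] by (auto simp: flow_def rhombus_def)
  also have "\<dots> = {(a, b), (a, d), (c, b), (c, d)}"
    using n assms(1,2) by (auto simp: rhombus_def doubleton_eq_iff)
  finally show ?thesis .
qed

section \<open>Tiles meeting along common faces\<close>

text \<open>A common face is represented by its corners, so that a common side is the pair of its
  ends and one oriented pair in both flows expresses that the orientations agree.\<close>

definition joint :: "tile \<Rightarrow> tile \<Rightarrow> complex set \<Rightarrow> bool" where
  "joint s t E \<longleftrightarrow> E \<subseteq> corners s \<inter> corners t \<and>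
     (E = {} \<or> (\<exists>v. E = {v}) \<or> (\<exists>(x, y)\<in>flow s \<inter> flow t. E = {x, y}))"

text \<open>An inclusion is enough: \<open>E\<close> consists of common corners, so by convexity its
  hull lies in both regions anyway.\<close>

definition meets :: "tile \<Rightarrow> tile \<Rightarrow> bool" where
  "meets s t \<longleftrightarrow> (\<exists>E. joint s t E \<and> region s \<inter> region t \<subseteq> convex hull E)"

lemma meets_sym: "meets s t \<Longrightarrow> meets t s"
  by (auto simp: meets_def joint_def Int_commute)

lemma joint_map:
  assumes f: "isometry f" and "joint s t E"
  shows "joint (map_tile f s) (map_tile f t) (f ` E)"
proof -
  have "f ` E \<subseteq> corners (map_tile f s) \<inter> corners (map_tile f t)"
    using assms by (auto simp: joint_def)
  moreover have "f ` E = {} \<or> (\<exists>v. f ` E = {v}) \<or>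
      (\<exists>(x, y)\<in>flow (map_tile f s) \<inter> flow (map_tile f t). f ` E = {x, y})"
    using assms flow_map_subset[OF f] unfolding joint_def by fastforce
  ultimately show ?thesis by (simp add: joint_def)
qed

lemma meets_map:
  assumes f: "isometry f" and "meets s t"
  shows "meets (map_tile f s) (map_tile f t)"
proof -
  from assms obtain E where E: "joint s t E" "region s \<inter> region t \<subseteq> convex hull E"
    by (auto simp: meets_def)
  have "f ` region s \<inter> f ` region t = f ` (region s \<inter> region t)"
    using isometry_inj[OF f] by (simp add: image_Int)
  also have "\<dots> \<subseteq> convex hull (f ` E)"
    using E(2) by (simp flip: isometry_hull[OF f] add: image_mono)
  finally show ?thesis
    using joint_map[OF f E(1)] by (auto simp: meets_def region_map[OF f])
qed

text \<open>The right-hand side is convex, since a proper convex combination of points of a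
  halfplane reaches the boundary only if both points lie on it. Thus the hull touches the boundary
  only in the hull of the corners there.\<close>

lemma hull_halfplane_face:
  fixes w :: "'a::real_inner"
  assumes "\<And>z. z \<in> A \<Longrightarrow> w \<bullet> z \<le> k" "{z \<in> A. w \<bullet> z = k} \<subseteq> E"
  shows "convex hull A \<subseteq> {z. w \<bullet> z < k \<or> w \<bullet> z = k \<and> z \<in> convex hull E}"
proof (rule hull_minimal)
  show "A \<subseteq> {z. w \<bullet> z < k \<or> w \<bullet> z = k \<and> z \<in> convex hull E}"
    using assms hull_subset[of E convex] by force
  show "convex {z. w \<bullet> z < k \<or> w \<bullet> z = k \<and> z \<in> convex hull E}" (is "convex ?S")
  proof (rule convexI)
    fix x y and u v :: real
    assume x: "x \<in> ?S" and y: "y \<in> ?S" and uv: "0 \<le> u" "0 \<le> v" "u + v = 1"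
    have lin: "w \<bullet> (u *\<^sub>R x + v *\<^sub>R y) = u * (w \<bullet> x) + v * (w \<bullet> y)"
      by (simp add: inner_add_right)
    have k: "u * k + v * k = k" using uv by (simp flip: distrib_right)
    have le: "u * (w \<bullet> x) \<le> u * k" "v * (w \<bullet> y) \<le> v * k"
      using x y uv by (auto intro: mult_left_mono)
    consider "u = 0" | "v = 0" | "0 < u" "0 < v" using uv by linarith
    then show "u *\<^sub>R x + v *\<^sub>R y \<in> ?S"
    proof cases
      case 3
      show ?thesis
      proof (cases "w \<bullet> x = k \<and> w \<bullet> y = k")
        case True
        then show ?thesis using x y uv k convexD[OF convex_convex_hull, of x E y u v]
          by (simp add: lin)
      next
        case False
        then have "u * (w \<bullet> x) < u * k \<or> v * (w \<bullet> y) < v * k"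
          using x y 3 by auto
        then show ?thesis using le k by (auto simp: lin)
      qed
    qed (use x y uv in auto)
  qed
qed

lemma hull_separated:
  fixes w :: "'a::real_inner"
  assumes A: "\<And>z. z \<in> A \<Longrightarrow> w \<bullet> z \<le> k" "{z \<in> A. w \<bullet> z = k} \<subseteq> E"
    and B: "\<And>z. z \<in> B \<Longrightarrow> k \<le> w \<bullet> z"
  shows "convex hull A \<inter> convex hull B \<subseteq> convex hull E"
proof -
  have "convex hull B \<subseteq> {z. k \<le> w \<bullet> z}"
    using B convex_halfspace_ge[of k w] by (intro hull_minimal) (auto simp: inner_commute)
  then show ?thesis using hull_halfplane_face[OF A] by fastforce
qed

text \<open>Turns the contact of two tiles into finitely many linear inequalities between their
  corners.\<close>

lemma meetsI:
  assumes "\<forall>z\<in>corners s. w \<bullet> z \<le> k \<and> (w \<bullet> z = k \<longrightarrow> z \<in> E)" "\<forall>z\<in>corners t. k \<le> w \<bullet> z"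
    and "joint s t E"
  shows "meets s t"
  unfolding meets_def region_def
  using assms hull_separated[of "corners s" w k E "corners t"] by (intro exI[of _ E]) auto

section \<open>The tiles of the two dissections\<close>

text \<open>Coarse rational bounds that settle comparisons of corner coordinates, which are linear
  in \<open>sqrt 2\<close>.\<close>

lemma sqrt2_bounds: "1.4 < sqrt 2" "sqrt 2 < 1.5"
  by (rule real_less_rsqrt real_less_lsqrt; simp add: power2_eq_square)+

lemma dist_Complex: "dist (Complex a b) (Complex c d) = sqrt ((a - c)\<^sup>2 + (b - d)\<^sup>2)"
  by (simp add: dist_norm complex_norm minus_complex.ctr)

definition tri1 where
  "tri1 = triangle (Complex 1 1) (Complex 0 0) (Complex 1 0)"

definition tri2 where
  "tri2 = triangle (Complex (1 + sqrt 2) 0) (Complex 1 0) (Complex (1 + hs) hs)"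

definition tri3 where
  "tri3 = triangle (Complex (2 + hs) hs) (Complex (1 + hs) (1 + hs)) (Complex (1 + hs) hs)"

definition tri4 where
  "tri4 = rhombus (Complex 1 0) (Complex 1 1) (Complex (1 + hs) (1 + hs)) (Complex (1 + hs) hs)"

definition tri5 where
  "tri5 = rhombus (Complex (1 + sqrt 2) 0) (Complex (2 + sqrt 2) 0) (Complex (2 + hs) hs)
     (Complex (1 + hs) hs)"

definition rho1 where
  "rho1 = rhombus (Complex 0 0) (Complex 1 0) (Complex (1 + hs) hs) (Complex hs hs)"

definition rho2 where
  "rho2 = rhombus (Complex (1 + hs) hs) (Complex (1 + sqrt 2) 0) (Complex (1 + sqrt 2) 1)
     (Complex (1 + hs) (1 + hs))"

definition rho3 where
  "rho3 = rhombus (Complex (1 + sqrt 2) 1) (Complex (2 + sqrt 2) 1)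
     (Complex (2 + 3 * hs) (1 + hs)) (Complex (1 + 3 * hs) (1 + hs))"

definition rho4 where
  "rho4 = triangle (Complex hs hs) (Complex (1 + hs) (1 + hs)) (Complex (1 + hs) hs)"

definition rho5 where
  "rho5 = triangle (Complex 1 0) (Complex (1 + sqrt 2) 0) (Complex (1 + hs) hs)"

definition rho6 where
  "rho6 = triangle (Complex (2 + sqrt 2) 1) (Complex (1 + sqrt 2) 0) (Complex (1 + sqrt 2) 1)"

definition rho7 where
  "rho7 = triangle (Complex (1 + 3 * hs) (1 + hs)) (Complex (1 + hs) (1 + hs))
     (Complex (1 + sqrt 2) 1)"

lemmas child_defs = tri1_def tri2_def tri3_def tri4_def tri5_def
  rho1_def rho2_def rho3_def rho4_def rho5_def rho6_def rho7_def

lemma triangle_dissection_eq: "triangle_dissection = {tri1, tri2, tri3, tri4, tri5}"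
  by (simp add: triangle_dissection_def child_defs)

lemma rhombus_dissection_eq:
  "rhombus_dissection = {rho1, rho2, rho3, rho4, rho5, rho6, rho7}"
  by (simp add: rhombus_dissection_def child_defs)

lemma child_corners:
  "corners tri1 = {Complex 1 1, Complex 0 0, Complex 1 0}"
  "corners tri2 = {Complex (1 + sqrt 2) 0, Complex 1 0, Complex (1 + hs) hs}"
  "corners tri3 = {Complex (2 + hs) hs, Complex (1 + hs) (1 + hs), Complex (1 + hs) hs}"
  "corners tri4 = {Complex 1 0, Complex 1 1, Complex (1 + hs) (1 + hs), Complex (1 + hs) hs}"
  "corners tri5 = {Complex (1 + sqrt 2) 0, Complex (2 + sqrt 2) 0, Complex (2 + hs) hs,
     Complex (1 + hs) hs}"
  "corners rho1 = {Complex 0 0, Complex 1 0, Complex (1 + hs) hs, Complex hs hs}"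
  "corners rho2 = {Complex (1 + hs) hs, Complex (1 + sqrt 2) 0, Complex (1 + sqrt 2) 1,
     Complex (1 + hs) (1 + hs)}"
  "corners rho3 = {Complex (1 + sqrt 2) 1, Complex (2 + sqrt 2) 1,
     Complex (2 + 3 * hs) (1 + hs), Complex (1 + 3 * hs) (1 + hs)}"
  "corners rho4 = {Complex hs hs, Complex (1 + hs) (1 + hs), Complex (1 + hs) hs}"
  "corners rho5 = {Complex 1 0, Complex (1 + sqrt 2) 0, Complex (1 + hs) hs}"
  "corners rho6 = {Complex (2 + sqrt 2) 1, Complex (1 + sqrt 2) 0, Complex (1 + sqrt 2) 1}"
  "corners rho7 = {Complex (1 + 3 * hs) (1 + hs), Complex (1 + hs) (1 + hs),
     Complex (1 + sqrt 2) 1}"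
  by (simp_all add: child_defs)

lemma tri1_flow:
  "flow tri1 = {(Complex 1 1, Complex 0 0),
    (Complex 0 0, Complex 1 0),
    (Complex 1 0, Complex 1 1)}"
  "sharp tri1 = {Complex 1 1, Complex 0 0}"
  unfolding tri1_def by (subst flow_triangle; simp) (simp add: sharp_triangle)

lemma tri2_flow:
  "flow tri2 = {(Complex (1 + sqrt 2) 0, Complex 1 0),
    (Complex 1 0, Complex (1 + hs) hs),
    (Complex (1 + hs) hs, Complex (1 + sqrt 2) 0)}"
  "sharp tri2 = {Complex (1 + sqrt 2) 0, Complex 1 0}"
  unfolding tri2_def by (subst flow_triangle; simp) (simp add: sharp_triangle)

lemma tri3_flow:
  "flow tri3 = {(Complex (2 + hs) hs, Complex (1 + hs) (1 + hs)),
    (Complex (1 + hs) (1 + hs), Complex (1 + hs) hs),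
    (Complex (1 + hs) hs, Complex (2 + hs) hs)}"
  "sharp tri3 = {Complex (2 + hs) hs, Complex (1 + hs) (1 + hs)}"
  unfolding tri3_def by (subst flow_triangle; simp) (simp add: sharp_triangle)

lemma tri4_flow:
  "flow tri4 = {(Complex 1 0, Complex 1 1),
    (Complex 1 0, Complex (1 + hs) hs),
    (Complex (1 + hs) (1 + hs), Complex 1 1),
    (Complex (1 + hs) (1 + hs), Complex (1 + hs) hs)}"
  "sharp tri4 = {Complex 1 0, Complex (1 + hs) (1 + hs)}"
  unfolding tri4_def
  by (subst flow_rhombus sharp_rhombus, use sqrt2_bounds in
      \<open>simp_all add: dist_Complex power2_eq_square algebra_simps\<close>)+

lemma tri5_flow:
  "flow tri5 = {(Complex (2 + sqrt 2) 0, Complex (2 + hs) hs),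
    (Complex (2 + sqrt 2) 0, Complex (1 + sqrt 2) 0),
    (Complex (1 + hs) hs, Complex (2 + hs) hs),
    (Complex (1 + hs) hs, Complex (1 + sqrt 2) 0)}"
  "sharp tri5 = {Complex (2 + sqrt 2) 0, Complex (1 + hs) hs}"
  unfolding tri5_def
    rhombus_turn[of "Complex (1 + sqrt 2) 0"]
  by (subst flow_rhombus sharp_rhombus, use sqrt2_bounds in
      \<open>simp_all add: dist_Complex power2_eq_square algebra_simps\<close>)+

lemma rho1_flow:
  "flow rho1 = {(Complex 0 0, Complex 1 0),
    (Complex 0 0, Complex hs hs),
    (Complex (1 + hs) hs, Complex 1 0),
    (Complex (1 + hs) hs, Complex hs hs)}"
  "sharp rho1 = {Complex 0 0, Complex (1 + hs) hs}"
  unfolding rho1_def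
  by (subst flow_rhombus sharp_rhombus, use sqrt2_bounds in
      \<open>simp_all add: dist_Complex power2_eq_square algebra_simps\<close>)+

lemma rho2_flow:
  "flow rho2 = {(Complex (1 + sqrt 2) 0, Complex (1 + sqrt 2) 1),
    (Complex (1 + sqrt 2) 0, Complex (1 + hs) hs),
    (Complex (1 + hs) (1 + hs), Complex (1 + sqrt 2) 1),
    (Complex (1 + hs) (1 + hs), Complex (1 + hs) hs)}"
  "sharp rho2 = {Complex (1 + sqrt 2) 0, Complex (1 + hs) (1 + hs)}"
  unfolding rho2_def
    rhombus_turn[of "Complex (1 + hs) hs"]
  by (subst flow_rhombus sharp_rhombus, use sqrt2_bounds in
      \<open>simp_all add: dist_Complex power2_eq_square algebra_simps\<close>)+

lemma rho3_flow:
  "flow rho3 = {(Complex (1 + sqrt 2) 1, Complex (2 + sqrt 2) 1),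
    (Complex (1 + sqrt 2) 1, Complex (1 + 3 * hs) (1 + hs)),
    (Complex (2 + 3 * hs) (1 + hs), Complex (2 + sqrt 2) 1),
    (Complex (2 + 3 * hs) (1 + hs), Complex (1 + 3 * hs) (1 + hs))}"
  "sharp rho3 = {Complex (1 + sqrt 2) 1, Complex (2 + 3 * hs) (1 + hs)}"
  unfolding rho3_def
  by (subst flow_rhombus sharp_rhombus, use sqrt2_bounds in
      \<open>simp_all add: dist_Complex power2_eq_square algebra_simps\<close>)+

lemma rho4_flow:
  "flow rho4 = {(Complex hs hs, Complex (1 + hs) (1 + hs)),
    (Complex (1 + hs) (1 + hs), Complex (1 + hs) hs),
    (Complex (1 + hs) hs, Complex hs hs)}"
  "sharp rho4 = {Complex hs hs, Complex (1 + hs) (1 + hs)}"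
  unfolding rho4_def by (subst flow_triangle; simp) (simp add: sharp_triangle)

lemma rho5_flow:
  "flow rho5 = {(Complex 1 0, Complex (1 + sqrt 2) 0),
    (Complex (1 + sqrt 2) 0, Complex (1 + hs) hs),
    (Complex (1 + hs) hs, Complex 1 0)}"
  "sharp rho5 = {Complex 1 0, Complex (1 + sqrt 2) 0}"
  unfolding rho5_def by (subst flow_triangle; simp) (simp add: sharp_triangle)

lemma rho6_flow:
  "flow rho6 = {(Complex (2 + sqrt 2) 1, Complex (1 + sqrt 2) 0),
    (Complex (1 + sqrt 2) 0, Complex (1 + sqrt 2) 1),
    (Complex (1 + sqrt 2) 1, Complex (2 + sqrt 2) 1)}"
  "sharp rho6 = {Complex (2 + sqrt 2) 1, Complex (1 + sqrt 2) 0}"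
  unfolding rho6_def by (subst flow_triangle; simp) (simp add: sharp_triangle)

lemma rho7_flow:
  "flow rho7 = {(Complex (1 + 3 * hs) (1 + hs), Complex (1 + hs) (1 + hs)),
    (Complex (1 + hs) (1 + hs), Complex (1 + sqrt 2) 1),
    (Complex (1 + sqrt 2) 1, Complex (1 + 3 * hs) (1 + hs))}"
  "sharp rho7 = {Complex (1 + 3 * hs) (1 + hs), Complex (1 + hs) (1 + hs)}"
  unfolding rho7_def by (subst flow_triangle; simp) (simp add: sharp_triangle)

lemmas child_flow = tri1_flow tri2_flow tri3_flow tri4_flow tri5_flow
  rho1_flow rho2_flow rho3_flow rho4_flow rho5_flow rho6_flow rho7_flow

text \<open>Each pair of tiles of a dissection is separated by a line that contains precisely their
  common corners.\<close>

lemma triangle_children_meet: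
  assumes "s \<in> triangle_dissection" "t \<in> triangle_dissection" "s \<noteq> t"
  shows "meets s t"
proof -
  note rows = child_corners child_flow joint_def inner_complex_def
  have "meets tri1 tri2"
    by (rule meetsI[of _ "Complex 2 (- 1)" "2"
          "{Complex 1 0}"];
        use sqrt2_bounds in \<open>auto simp: rows\<close>)
  \<comment> \<open>For disjoint tiles \<open>k\<close> is a rational number strictly between the
    two ranges of the functional, so no corner attains it.\<close>
  moreover have "meets tri1 tri3"
    by (rule meetsI[of _ "Complex 2 0" "3"
          "{}"];
        use sqrt2_bounds in \<open>auto simp: rows\<close>)
  moreover have "meets tri1 tri4"
    by (rule meetsI[of _ "Complex 1 0" "1"
          "{Complex 1 1, Complex 1 0}"];
        use sqrt2_bounds in \<open>auto simp: rows\<close>)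
  moreover have "meets tri1 tri5"
    by (rule meetsI[of _ "Complex 2 0" "3"
          "{}"];
        use sqrt2_bounds in \<open>auto simp: rows\<close>)
  moreover have "meets tri2 tri3"
    by (rule meetsI[of _ "Complex 1 2" "1 + 3 * hs"
          "{Complex (1 + hs) hs}"];
        use sqrt2_bounds in \<open>auto simp: rows\<close>)
  moreover have "meets tri2 tri4"
    by (rule meetsI[of _ "Complex (- 1) 1" "- 1"
          "{Complex 1 0, Complex (1 + hs) hs}"];
        use sqrt2_bounds in \<open>auto simp: rows\<close>)
  moreover have "meets tri2 tri5"
    by (rule meetsI[of _ "Complex 1 1" "1 + sqrt 2"
          "{Complex (1 + sqrt 2) 0, Complex (1 + hs) hs}"];
        use sqrt2_bounds in \<open>auto simp: rows\<close>)
  moreover have "meets tri3 tri4"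
    by (rule meetsI[of _ "Complex (- 1) 0" "-1 - hs"
          "{Complex (1 + hs) (1 + hs), Complex (1 + hs) hs}"];
        use sqrt2_bounds in \<open>auto simp: rows\<close>)
  moreover have "meets tri3 tri5"
    by (rule meetsI[of _ "Complex 0 (- 1)" "- hs"
          "{Complex (2 + hs) hs, Complex (1 + hs) hs}"];
        use sqrt2_bounds in \<open>auto simp: rows\<close>)
  moreover have "meets tri4 tri5"
    by (rule meetsI[of _ "Complex 2 (- 1)" "2 + hs"
          "{Complex (1 + hs) hs}"];
        use sqrt2_bounds in \<open>auto simp: rows\<close>)
  ultimately show ?thesis
    using assms unfolding triangle_dissection_eq by (elim insertE emptyE) (auto intro: meets_sym)
qed

lemma rhombus_children_meet:
  assumes "s \<in> rhombus_dissection" "t \<in> rhombus_dissection" "s \<noteq> t"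
  shows "meets s t"
proof -
  note rows = child_corners child_flow joint_def inner_complex_def
  have "meets rho1 rho2"
    by (rule meetsI[of _ "Complex 2 1" "2 + 3 * hs"
          "{Complex (1 + hs) hs}"];
        use sqrt2_bounds in \<open>auto simp: rows\<close>)
  moreover have "meets rho1 rho3"
    by (rule meetsI[of _ "Complex 1 0" "2"
          "{}"];
        use sqrt2_bounds in \<open>auto simp: rows\<close>)
  moreover have "meets rho1 rho4"
    by (rule meetsI[of _ "Complex 0 1" "hs"
          "{Complex (1 + hs) hs, Complex hs hs}"];
        use sqrt2_bounds in \<open>auto simp: rows\<close>)
  moreover have "meets rho1 rho5"
    by (rule meetsI[of _ "Complex 1 (- 1)" "1"
          "{Complex 1 0, Complex (1 + hs) hs}"];
        use sqrt2_bounds in \<open>auto simp: rows\<close>)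
  moreover have "meets rho1 rho6"
    by (rule meetsI[of _ "Complex 1 0" "2"
          "{}"];
        use sqrt2_bounds in \<open>auto simp: rows\<close>)
  moreover have "meets rho1 rho7"
    by (rule meetsI[of _ "Complex 1 1" "3"
          "{}"];
        use sqrt2_bounds in \<open>auto simp: rows\<close>)
  moreover have "meets rho2 rho3"
    by (rule meetsI[of _ "Complex 2 1" "3 + 2 * sqrt 2"
          "{Complex (1 + sqrt 2) 1}"];
        use sqrt2_bounds in \<open>auto simp: rows\<close>)
  moreover have "meets rho2 rho4"
    by (rule meetsI[of _ "Complex (- 1) 0" "-1 - hs"
          "{Complex (1 + hs) hs, Complex (1 + hs) (1 + hs)}"];
        use sqrt2_bounds in \<open>auto simp: rows\<close>)
  moreover have "meets rho2 rho5"
    by (rule meetsI[of _ "Complex (- 1) (- 1)" "-1 - sqrt 2"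
          "{Complex (1 + hs) hs, Complex (1 + sqrt 2) 0}"];
        use sqrt2_bounds in \<open>auto simp: rows\<close>)
  moreover have "meets rho2 rho6"
    by (rule meetsI[of _ "Complex 1 0" "1 + sqrt 2"
          "{Complex (1 + sqrt 2) 0, Complex (1 + sqrt 2) 1}"];
        use sqrt2_bounds in \<open>auto simp: rows\<close>)
  moreover have "meets rho2 rho7"
    by (rule meetsI[of _ "Complex 1 1" "2 + sqrt 2"
          "{Complex (1 + sqrt 2) 1, Complex (1 + hs) (1 + hs)}"];
        use sqrt2_bounds in \<open>auto simp: rows\<close>)
  moreover have "meets rho3 rho4"
    by (rule meetsI[of _ "Complex (- 1) 0" "- 2"
          "{}"];
        use sqrt2_bounds in \<open>auto simp: rows\<close>)
  moreover have "meets rho3 rho5"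
    by (rule meetsI[of _ "Complex (- 1) (- 1)" "- 3"
          "{}"];
        use sqrt2_bounds in \<open>auto simp: rows\<close>)
  moreover have "meets rho3 rho6"
    by (rule meetsI[of _ "Complex 0 (- 1)" "- 1"
          "{Complex (1 + sqrt 2) 1, Complex (2 + sqrt 2) 1}"];
        use sqrt2_bounds in \<open>auto simp: rows\<close>)
  moreover have "meets rho3 rho7"
    by (rule meetsI[of _ "Complex (- 1) 1" "- sqrt 2"
          "{Complex (1 + sqrt 2) 1, Complex (1 + 3 * hs) (1 + hs)}"];
        use sqrt2_bounds in \<open>auto simp: rows\<close>)
  moreover have "meets rho4 rho5"
    by (rule meetsI[of _ "Complex 1 (- 2)" "1 - hs"
          "{Complex (1 + hs) hs}"];
        use sqrt2_bounds in \<open>auto simp: rows\<close>)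
  moreover have "meets rho4 rho6"
    by (rule meetsI[of _ "Complex 1 0" "2"
          "{}"];
        use sqrt2_bounds in \<open>auto simp: rows\<close>)
  moreover have "meets rho4 rho7"
    by (rule meetsI[of _ "Complex 2 1" "3 + 3 * hs"
          "{Complex (1 + hs) (1 + hs)}"];
        use sqrt2_bounds in \<open>auto simp: rows\<close>)
  moreover have "meets rho5 rho6"
    by (rule meetsI[of _ "Complex 2 1" "2 + 2 * sqrt 2"
          "{Complex (1 + sqrt 2) 0}"];
        use sqrt2_bounds in \<open>auto simp: rows\<close>)
  moreover have "meets rho5 rho7"
    by (rule meetsI[of _ "Complex 1 1" "3"
          "{}"];
        use sqrt2_bounds in \<open>auto simp: rows\<close>)
  moreover have "meets rho6 rho7"
    by (rule meetsI[of _ "Complex (- 1) 2" "1 - sqrt 2"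
          "{Complex (1 + sqrt 2) 1}"];
        use sqrt2_bounds in \<open>auto simp: rows\<close>)
  ultimately show ?thesis
    using assms unfolding rhombus_dissection_eq by (elim insertE emptyE) (auto intro: meets_sym)
qed

section \<open>Children along the sides of their parent\<close>

lemma proto_triangle_flow:
  "flow proto_triangle = {(Complex 0 0, Complex (sqrt 2) 0), (Complex (sqrt 2) 0, Complex hs hs),
    (Complex hs hs, Complex 0 0)}"
  "sharp proto_triangle = {Complex 0 0, Complex (sqrt 2) 0}"
  unfolding proto_triangle_def by (subst flow_triangle; simp) (simp add: sharp_triangle)

lemma proto_rhombus_flow:
  "flow proto_rhombus = {(Complex 0 0, Complex 1 0), (Complex 0 0, Complex hs hs),
    (Complex (1 + hs) hs, Complex 1 0), (Complex (1 + hs) hs, Complex hs hs)}"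
  "sharp proto_rhombus = {Complex 0 0, Complex (1 + hs) hs}"
  unfolding proto_rhombus_def
  by (subst flow_rhombus sharp_rhombus, use sqrt2_bounds in
      \<open>simp_all add: dist_Complex power2_eq_square algebra_simps\<close>)+

text \<open>The parameter runs from 0 to \<open>lam\<close> along the expanded side, in units of the
  side before expansion. It is arc length on a unit side, while on a hypotenuse a piece of length 1
  has parameter length \<open>hs\<close>.\<close>

definition mark :: "complex \<Rightarrow> complex \<Rightarrow> real \<Rightarrow> complex" where
  "mark x y r = lam *\<^sub>R x + r *\<^sub>R (y - x)"

text \<open>The expanded side from \<open>lam x\<close> to \<open>lam y\<close> is cut at points that depend on the orientation
  only; a pair \<open>(r, r')\<close> stands for a piece that is oriented from \<open>mark x y r\<close> to
  \<open>mark x y r'\<close>.\<close>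

definition cuts :: "complex \<Rightarrow> complex \<Rightarrow> (real \<times> real) set" where
  "cuts x y =
     (if dist x y = 1 then {(0, 1), (1, lam)} else {(0, hs), (1 + hs, hs), (lam, 1 + hs)})"

text \<open>The contact is recorded by parameters rather than points, so that tiles on the two sides
  of a common side can be compared as intervals of real numbers.\<close>

definition trace_on :: "tile \<Rightarrow> complex \<Rightarrow> complex \<Rightarrow> real set \<Rightarrow> bool" where
  "trace_on t x y R \<longleftrightarrow> mark x y ` R \<subseteq> corners t \<and>
     (R = {} \<or> (\<exists>(r, r')\<in>cuts x y. R = {r} \<or> R = {r'} \<or>
        R = {r, r'} \<and> (mark x y r, mark x y r') \<in> flow t))"

definition abuts :: "tile \<Rightarrow> complex \<Rightarrow> complex \<Rightarrow> bool" where
  "abuts t x y \<longleftrightarrow> (\<exists>R. trace_on t x y R \<and>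
     region t \<inter> convex hull {lam *\<^sub>R x, lam *\<^sub>R y} \<subseteq> convex hull (mark x y ` R))"

lemma mark_Complex: "mark (Complex a b) (Complex c d) r
    = Complex (lam * a + r * (c - a)) (lam * b + r * (d - b))"
  by (simp add: mark_def complex_eq_iff)

lemma abutsI:
  assumes "\<forall>z\<in>corners t. w \<bullet> z \<le> k \<and> (w \<bullet> z = k \<longrightarrow> z \<in> mark x y ` R)"
    and "lam * (w \<bullet> x) = k" "lam * (w \<bullet> y) = k" and "trace_on t x y R"
  shows "abuts t x y"
  unfolding abuts_def region_def
  using assms
  by (intro exI[of _ R] conjI hull_separated[of "corners t" w k]) (auto simp: inner_scaleR_right)

lemma abuts_none:
  assumes "\<forall>z\<in>corners t. w \<bullet> z < k" "lam * (w \<bullet> x) = k" "lam * (w \<bullet> y) = k"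
  shows "abuts t x y"
proof (rule abutsI)
  show "\<forall>z\<in>corners t. w \<bullet> z \<le> k \<and> (w \<bullet> z = k \<longrightarrow> z \<in> mark x y ` {})"
    using assms(1) by (simp add: less_imp_le less_imp_neq)
qed (use assms(2,3) in \<open>simp_all add: trace_on_def\<close>)

lemma abuts_point:
  assumes "\<forall>z\<in>corners t. w \<bullet> z \<le> k \<and> (w \<bullet> z = k \<longrightarrow> z = mark x y r)"
    and "lam * (w \<bullet> x) = k" "lam * (w \<bullet> y) = k"
    and "r \<in> fst ` cuts x y \<union> snd ` cuts x y" "mark x y r \<in> corners t"
  shows "abuts t x y"
proof (rule abutsI)
  show "\<forall>z\<in>corners t. w \<bullet> z \<le> k \<and> (w \<bullet> z = k \<longrightarrow> z \<in> mark x y ` {r})"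
    using assms(1) by blast
  obtain p q where "(p, q) \<in> cuts x y" "r = p \<or> r = q" using assms(4) by auto
  then show "trace_on t x y {r}" using assms(5) by (auto simp: trace_on_def)
qed (fact assms(2,3))+

lemma abuts_piece:
  assumes "\<forall>z\<in>corners t. w \<bullet> z \<le> k \<and> (w \<bullet> z = k \<longrightarrow> z = mark x y r \<or> z = mark x y r')"
    and "lam * (w \<bullet> x) = k" "lam * (w \<bullet> y) = k"
    and "(r, r') \<in> cuts x y" "(mark x y r, mark x y r') \<in> flow t"
  shows "abuts t x y"
proof (rule abutsI)
  show "\<forall>z\<in>corners t. w \<bullet> z \<le> k \<and> (w \<bullet> z = k \<longrightarrow> z \<in> mark x y ` {r, r'})"
    using assms(1) by blast
  show "trace_on t x y {r, r'}"
    using assms(4,5) flow_corners[OF assms(5)] unfolding trace_on_def by blast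
qed (fact assms(2,3))+

text \<open>A finite check of every child against every oriented side; \<open>w\<close> is an
  outward normal of the expanded side and \<open>k\<close> the value of the functional on
  it.\<close>

lemma triangle_children_abut:
  assumes "t \<in> triangle_dissection" "(x, y) \<in> flow proto_triangle"
  shows "abuts t x y"
proof -
  note rows = child_corners child_flow inner_complex_def mark_Complex cuts_def dist_Complex
    power2_eq_square algebra_simps add_divide_distrib
  have "abuts tri1 (Complex 0 0) (Complex (sqrt 2) 0)"
    by (rule abuts_piece[where w = "Complex 0 (- 1)" and k = "0" and r = "0" and r' = "hs"];
        use sqrt2_bounds in \<open>auto simp: rows\<close>)
  \<comment> \<open>The middle piece of an expanded hypotenuse runs against the arrow of the parent,
    hence the larger parameter comes first.\<close>
  moreover have "abuts tri2 (Complex 0 0) (Complex (sqrt 2) 0)"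
    by (rule abuts_piece[where w = "Complex 0 (- 1)" and k = "0" and r = "1 + hs" and r' = "hs"];
        use sqrt2_bounds in \<open>auto simp: rows\<close>)
  moreover have "abuts tri3 (Complex 0 0) (Complex (sqrt 2) 0)"
    by (rule abuts_none[where w = "Complex 0 (- 1)" and k = "0"];
        use sqrt2_bounds in \<open>auto simp: rows\<close>)
  moreover have "abuts tri4 (Complex 0 0) (Complex (sqrt 2) 0)"
    by (rule abuts_point[where w = "Complex 0 (- 1)" and k = "0" and r = "hs"];
        use sqrt2_bounds in \<open>auto simp: rows\<close>)
  moreover have "abuts tri5 (Complex 0 0) (Complex (sqrt 2) 0)"
    by (rule abuts_piece[where w = "Complex 0 (- 1)" and k = "0" and r = "lam" and r' = "1 + hs"];
        use sqrt2_bounds in \<open>auto simp: rows\<close>)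
  moreover have "abuts tri1 (Complex (sqrt 2) 0) (Complex hs hs)"
    by (rule abuts_none[where w = "Complex 1 1" and k = "2 + sqrt 2"];
        use sqrt2_bounds in \<open>auto simp: rows\<close>)
  moreover have "abuts tri2 (Complex (sqrt 2) 0) (Complex hs hs)"
    by (rule abuts_none[where w = "Complex 1 1" and k = "2 + sqrt 2"];
        use sqrt2_bounds in \<open>auto simp: rows\<close>)
  moreover have "abuts tri3 (Complex (sqrt 2) 0) (Complex hs hs)"
    by (rule abuts_piece[where w = "Complex 1 1" and k = "2 + sqrt 2" and r = "1" and r' = "lam"];
        use sqrt2_bounds in \<open>auto simp: rows\<close>)
  moreover have "abuts tri4 (Complex (sqrt 2) 0) (Complex hs hs)"
    by (rule abuts_point[where w = "Complex 1 1" and k = "2 + sqrt 2" and r = "lam"];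
        use sqrt2_bounds in \<open>auto simp: rows\<close>)
  moreover have "abuts tri5 (Complex (sqrt 2) 0) (Complex hs hs)"
    by (rule abuts_piece[where w = "Complex 1 1" and k = "2 + sqrt 2" and r = "0" and r' = "1"];
        use sqrt2_bounds in \<open>auto simp: rows\<close>)
  moreover have "abuts tri1 (Complex hs hs) (Complex 0 0)"
    by (rule abuts_piece[where w = "Complex (- 1) 1" and k = "0" and r = "1" and r' = "lam"];
        use sqrt2_bounds in \<open>auto simp: rows\<close>)
  moreover have "abuts tri2 (Complex hs hs) (Complex 0 0)"
    by (rule abuts_none[where w = "Complex (- 1) 1" and k = "0"];
        use sqrt2_bounds in \<open>auto simp: rows\<close>)
  moreover have "abuts tri3 (Complex hs hs) (Complex 0 0)"
    by (rule abuts_point[where w = "Complex (- 1) 1" and k = "0" and r = "0"];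
        use sqrt2_bounds in \<open>auto simp: rows\<close>)
  moreover have "abuts tri4 (Complex hs hs) (Complex 0 0)"
    by (rule abuts_piece[where w = "Complex (- 1) 1" and k = "0" and r = "0" and r' = "1"];
        use sqrt2_bounds in \<open>auto simp: rows\<close>)
  moreover have "abuts tri5 (Complex hs hs) (Complex 0 0)"
    by (rule abuts_none[where w = "Complex (- 1) 1" and k = "0"];
        use sqrt2_bounds in \<open>auto simp: rows\<close>)
  ultimately show ?thesis
    using assms unfolding triangle_dissection_eq proto_triangle_flow by (elim insertE emptyE) auto
qed

text \<open>Seen from the acute corners, each side of the rhombus is cut like a leg of the triangle:
  first a unit side, then a hypotenuse. The common rule \<open>cuts\<close> is what allows both
  kinds of tiles to be neighbours.\<close>

lemma rhombus_children_abut: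
  assumes "t \<in> rhombus_dissection" "(x, y) \<in> flow proto_rhombus"
  shows "abuts t x y"
proof -
  note rows = child_corners child_flow inner_complex_def mark_Complex cuts_def dist_Complex
    power2_eq_square algebra_simps add_divide_distrib
  have "abuts rho1 (Complex 0 0) (Complex 1 0)"
    by (rule abuts_piece[where w = "Complex 0 (- 1)" and k = "0" and r = "0" and r' = "1"];
        use sqrt2_bounds in \<open>auto simp: rows\<close>)
  moreover have "abuts rho2 (Complex 0 0) (Complex 1 0)"
    by (rule abuts_point[where w = "Complex 0 (- 1)" and k = "0" and r = "lam"];
        use sqrt2_bounds in \<open>auto simp: rows\<close>)
  moreover have "abuts rho3 (Complex 0 0) (Complex 1 0)"
    by (rule abuts_none[where w = "Complex 0 (- 1)" and k = "0"];
        use sqrt2_bounds in \<open>auto simp: rows\<close>)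
  moreover have "abuts rho4 (Complex 0 0) (Complex 1 0)"
    by (rule abuts_none[where w = "Complex 0 (- 1)" and k = "0"];
        use sqrt2_bounds in \<open>auto simp: rows\<close>)
  moreover have "abuts rho5 (Complex 0 0) (Complex 1 0)"
    by (rule abuts_piece[where w = "Complex 0 (- 1)" and k = "0" and r = "1" and r' = "lam"];
        use sqrt2_bounds in \<open>auto simp: rows\<close>)
  moreover have "abuts rho6 (Complex 0 0) (Complex 1 0)"
    by (rule abuts_point[where w = "Complex 0 (- 1)" and k = "0" and r = "lam"];
        use sqrt2_bounds in \<open>auto simp: rows\<close>)
  moreover have "abuts rho7 (Complex 0 0) (Complex 1 0)"
    by (rule abuts_none[where w = "Complex 0 (- 1)" and k = "0"];
        use sqrt2_bounds in \<open>auto simp: rows\<close>)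
  moreover have "abuts rho1 (Complex 0 0) (Complex hs hs)"
    by (rule abuts_piece[where w = "Complex (- 1) 1" and k = "0" and r = "0" and r' = "1"];
        use sqrt2_bounds in \<open>auto simp: rows\<close>)
  moreover have "abuts rho2 (Complex 0 0) (Complex hs hs)"
    by (rule abuts_point[where w = "Complex (- 1) 1" and k = "0" and r = "lam"];
        use sqrt2_bounds in \<open>auto simp: rows\<close>)
  moreover have "abuts rho3 (Complex 0 0) (Complex hs hs)"
    by (rule abuts_none[where w = "Complex (- 1) 1" and k = "0"];
        use sqrt2_bounds in \<open>auto simp: rows\<close>)
  moreover have "abuts rho4 (Complex 0 0) (Complex hs hs)"
    by (rule abuts_piece[where w = "Complex (- 1) 1" and k = "0" and r = "1" and r' = "lam"];
        use sqrt2_bounds in \<open>auto simp: rows\<close>)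
  moreover have "abuts rho5 (Complex 0 0) (Complex hs hs)"
    by (rule abuts_none[where w = "Complex (- 1) 1" and k = "0"];
        use sqrt2_bounds in \<open>auto simp: rows\<close>)
  moreover have "abuts rho6 (Complex 0 0) (Complex hs hs)"
    by (rule abuts_none[where w = "Complex (- 1) 1" and k = "0"];
        use sqrt2_bounds in \<open>auto simp: rows\<close>)
  moreover have "abuts rho7 (Complex 0 0) (Complex hs hs)"
    by (rule abuts_point[where w = "Complex (- 1) 1" and k = "0" and r = "lam"];
        use sqrt2_bounds in \<open>auto simp: rows\<close>)
  moreover have "abuts rho1 (Complex (1 + hs) hs) (Complex 1 0)"
    by (rule abuts_none[where w = "Complex 1 (- 1)" and k = "1 + sqrt 2"];
        use sqrt2_bounds in \<open>auto simp: rows\<close>)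
  moreover have "abuts rho2 (Complex (1 + hs) hs) (Complex 1 0)"
    by (rule abuts_point[where w = "Complex 1 (- 1)" and k = "1 + sqrt 2" and r = "lam"];
        use sqrt2_bounds in \<open>auto simp: rows\<close>)
  moreover have "abuts rho3 (Complex (1 + hs) hs) (Complex 1 0)"
    by (rule abuts_piece[where w = "Complex 1 (- 1)" and k = "1 + sqrt 2" and r = "0" and r' = "1"];
        use sqrt2_bounds in \<open>auto simp: rows\<close>)
  moreover have "abuts rho4 (Complex (1 + hs) hs) (Complex 1 0)"
    by (rule abuts_none[where w = "Complex 1 (- 1)" and k = "1 + sqrt 2"];
        use sqrt2_bounds in \<open>auto simp: rows\<close>)
  moreover have "abuts rho5 (Complex (1 + hs) hs) (Complex 1 0)"
    by (rule abuts_point[where w = "Complex 1 (- 1)" and k = "1 + sqrt 2" and r = "lam"];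
        use sqrt2_bounds in \<open>auto simp: rows\<close>)
  moreover have "abuts rho6 (Complex (1 + hs) hs) (Complex 1 0)"
    by (rule abuts_piece[where w = "Complex 1 (- 1)" and k = "1 + sqrt 2" and r = "1" and r' = "lam"];
        use sqrt2_bounds in \<open>auto simp: rows\<close>)
  moreover have "abuts rho7 (Complex (1 + hs) hs) (Complex 1 0)"
    by (rule abuts_none[where w = "Complex 1 (- 1)" and k = "1 + sqrt 2"];
        use sqrt2_bounds in \<open>auto simp: rows\<close>)
  moreover have "abuts rho1 (Complex (1 + hs) hs) (Complex hs hs)"
    by (rule abuts_none[where w = "Complex 0 1" and k = "1 + hs"];
        use sqrt2_bounds in \<open>auto simp: rows\<close>)
  moreover have "abuts rho2 (Complex (1 + hs) hs) (Complex hs hs)"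
    by (rule abuts_point[where w = "Complex 0 1" and k = "1 + hs" and r = "lam"];
        use sqrt2_bounds in \<open>auto simp: rows\<close>)
  moreover have "abuts rho3 (Complex (1 + hs) hs) (Complex hs hs)"
    by (rule abuts_piece[where w = "Complex 0 1" and k = "1 + hs" and r = "0" and r' = "1"];
        use sqrt2_bounds in \<open>auto simp: rows\<close>)
  moreover have "abuts rho4 (Complex (1 + hs) hs) (Complex hs hs)"
    by (rule abuts_point[where w = "Complex 0 1" and k = "1 + hs" and r = "lam"];
        use sqrt2_bounds in \<open>auto simp: rows\<close>)
  moreover have "abuts rho5 (Complex (1 + hs) hs) (Complex hs hs)"
    by (rule abuts_none[where w = "Complex 0 1" and k = "1 + hs"];
        use sqrt2_bounds in \<open>auto simp: rows\<close>)
  moreover have "abuts rho6 (Complex (1 + hs) hs) (Complex hs hs)"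
    by (rule abuts_none[where w = "Complex 0 1" and k = "1 + hs"];
        use sqrt2_bounds in \<open>auto simp: rows\<close>)
  moreover have "abuts rho7 (Complex (1 + hs) hs) (Complex hs hs)"
    by (rule abuts_piece[where w = "Complex 0 1" and k = "1 + hs" and r = "1" and r' = "lam"];
        use sqrt2_bounds in \<open>auto simp: rows\<close>)
  ultimately show ?thesis
    using assms unfolding rhombus_dissection_eq proto_rhombus_flow by (elim insertE emptyE) auto
qed

section \<open>Properties of the children\<close>

definition child :: "tile \<Rightarrow> tile \<Rightarrow> bool" where
  "child p c \<longleftrightarrow> p = proto_triangle \<and> c \<in> triangle_dissection \<or>
     p = proto_rhombus \<and> c \<in> rhombus_dissection"

lemma child_cases:
  assumes "child p c"
  obtains "p = proto_triangle" "c \<in> {tri1, tri2, tri3, tri4, tri5}"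
  | "p = proto_rhombus" "c \<in> {rho1, rho2, rho3, rho4, rho5, rho6, rho7}"
  using assms by (auto simp: child_def triangle_dissection_eq rhombus_dissection_eq)

lemma substitute_tile_iff:
  "s \<in> substitute_tile t \<longleftrightarrow>
     (\<exists>f p c. isometry f \<and> t = map_tile f p \<and> child p c \<and> s = map_tile (expand f) c)"
  by (auto simp: substitute_tile_def child_def)

lemma children_meet: "child p c \<Longrightarrow> child p d \<Longrightarrow> c \<noteq> d \<Longrightarrow> meets c d"
proof -
  have "proto_triangle \<noteq> proto_rhombus"
    by (simp add: proto_triangle_def proto_rhombus_def triangle_def rhombus_def)
  then show "child p c \<Longrightarrow> child p d \<Longrightarrow> c \<noteq> d \<Longrightarrow> meets c d"
    by (auto simp: child_def triangle_children_meet rhombus_children_meet)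
qed

lemma child_abuts: "child p c \<Longrightarrow> (x, y) \<in> flow p \<Longrightarrow> abuts c x y"
  by (auto simp: child_def triangle_children_abut rhombus_children_abut)

section \<open>Congruence of the children with the prototiles\<close>

definition tile_copy :: "tile \<Rightarrow> bool" where
  "tile_copy t \<longleftrightarrow> congruent_copy proto_triangle t \<or> congruent_copy proto_rhombus t"

lemma tile_copy_map: "tile_copy t \<Longrightarrow> isometry f \<Longrightarrow> tile_copy (map_tile f t)"
  unfolding tile_copy_def congruent_copy_def by (metis isometry_comp map_tile_comp)

lemma map_tile_triangle: "map_tile f (triangle a b c) = triangle (f a) (f b) (f c)"
  by (simp add: map_tile_def triangle_def)

lemma map_tile_rhombus: "map_tile f (rhombus a b c d) = rhombus (f a) (f b) (f c) (f d)"
  by (simp add: map_tile_def rhombus_def)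

text \<open>With the hypotenuse moved to the segment from 0 to sqrt 2, the lengths leave two
  conjugate positions for the third corner, reached by a direct and by an opposite isometry.\<close>

lemma triangle_copy:
  assumes "dist a b = sqrt 2" "dist b c = 1" "dist c a = 1"
  shows "tile_copy (triangle a b c)"
proof -
  define e where "e = (b - a) / of_real (sqrt 2)"
  have ne: "cmod e = 1"
    using assms(1) by (simp add: e_def norm_divide dist_norm norm_minus_commute)
  then have e0: "e \<noteq> 0" by auto
  define w where "w = (c - a) / e"
  have b: "b = e * of_real (sqrt 2) + a" by (simp add: e_def)
  have c: "c = e * w + a" using e0 by (simp add: w_def)
  have "cmod (e * w) = 1" using assms(3) by (simp add: c dist_norm)
  then have "(cmod w)\<^sup>2 = 1" by (simp add: norm_mult ne)
  then have 1: "(Re w)\<^sup>2 + (Im w)\<^sup>2 = 1" by (simp only: cmod_power2)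
  have "b - c = e * (of_real (sqrt 2) - w)" by (simp add: b c algebra_simps)
  then have "cmod (e * (of_real (sqrt 2) - w)) = 1" using assms(2) by (simp add: dist_norm)
  then have "(cmod (of_real (sqrt 2) - w))\<^sup>2 = 1" by (simp add: norm_mult ne)
  then have "(sqrt 2 - Re w)\<^sup>2 + (Im w)\<^sup>2 = 1" by (simp add: cmod_power2)
  then have "sqrt 2 * Re w = 1" using 1 by (simp add: cmod_power2 power2_diff)
  then have "sqrt 2 * (sqrt 2 * Re w) = sqrt 2" by simp
  then have re: "Re w = hs" by (simp flip: mult.assoc)
  have "(Re w)\<^sup>2 = 1 / 2" unfolding re by (simp add: power_divide)
  then have "(Im w)\<^sup>2 = hs\<^sup>2" using 1 by (simp add: power_divide)
  then have "Im w = hs \<or> Im w = - hs" by (simp only: power2_eq_iff)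
  then have "w = Complex hs hs \<or> w = cnj (Complex hs hs)" using re by (auto simp: complex_eq_iff)
  then have "\<exists>f. isometry f \<and> f 0 = a \<and> f (of_real (sqrt 2)) = b \<and> f (Complex hs hs) = c"
  proof
    assume "w = Complex hs hs"
    then show ?thesis
      using isometry_direct[OF ne, of a] by (intro exI[of _ "\<lambda>z. e * z + a"]) (simp add: b c)
  next
    assume "w = cnj (Complex hs hs)"
    then show ?thesis
      using isometry_opposite[OF ne, of a]
      by (intro exI[of _ "\<lambda>z. e * cnj z + a"]) (simp add: b c)
  qed
  then show ?thesis
    unfolding tile_copy_def congruent_copy_def proto_triangle_def map_tile_triangle
    by (metis complex_of_real_def zero_complex.code)
qed

text \<open>The length of the diagonal at \<open>a\<close> stands for the angle: it forces the
  quotient of the two unit sides at \<open>a\<close> to have real part \<open>hs\<close>, which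
  leaves 45 degrees in either orientation.\<close>

lemma rhombus_copy:
  assumes "c = b + d - a" "dist a b = 1" "dist a d = 1" "(dist a c)\<^sup>2 = 2 + sqrt 2"
  shows "tile_copy (rhombus a b c d)"
proof -
  define e where "e = b - a"
  have ne: "cmod e = 1" using assms(2) by (simp add: e_def dist_norm norm_minus_commute)
  then have e0: "e \<noteq> 0" by auto
  define w where "w = (d - a) / e"
  have b: "b = e * 1 + a" by (simp add: e_def)
  have d: "d = e * w + a" using e0 by (simp add: w_def)
  have c: "c = e * (1 + w) + a" by (simp add: assms(1) b d algebra_simps)
  have "cmod (e * w) = 1" using assms(3) by (simp add: d dist_norm)
  then have 1: "(Re w)\<^sup>2 + (Im w)\<^sup>2 = 1" by (simp add: norm_mult ne flip: cmod_power2)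
  have "(cmod (e * (1 + w)))\<^sup>2 = 2 + sqrt 2" using assms(4) by (simp add: c dist_norm)
  then have "(1 + Re w)\<^sup>2 + (Im w)\<^sup>2 = 2 + sqrt 2" by (simp add: norm_mult ne cmod_power2)
  then have re: "Re w = hs" using 1 by (simp add: power2_sum)
  have "(Re w)\<^sup>2 = 1 / 2" unfolding re by (simp add: power_divide)
  then have "(Im w)\<^sup>2 = hs\<^sup>2" using 1 by (simp add: power_divide)
  then have "Im w = hs \<or> Im w = - hs" by (simp only: power2_eq_iff)
  then have "w = Complex hs hs \<or> w = cnj (Complex hs hs)" using re by (auto simp: complex_eq_iff)
  then have "\<exists>f. isometry f \<and> f 0 = a \<and> f 1 = b \<and> f (1 + Complex hs hs) = c \<and> f (Complex hs hs) = d"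
  proof
    assume "w = Complex hs hs"
    then show ?thesis
      using isometry_direct[OF ne, of a] by (intro exI[of _ "\<lambda>z. e * z + a"]) (simp add: b c d)
  next
    assume "w = cnj (Complex hs hs)"
    then show ?thesis
      using isometry_opposite[OF ne, of a]
      by (intro exI[of _ "\<lambda>z. e * cnj z + a"]) (simp add: b c d)
  qed
  moreover have "proto_rhombus = rhombus 0 1 (1 + Complex hs hs) (Complex hs hs)"
    by (simp add: proto_rhombus_def complex_eq_iff zero_complex.code one_complex.code
        plus_complex.code)
  ultimately show ?thesis
    unfolding tile_copy_def congruent_copy_def by (metis map_tile_rhombus)
qed

lemma child_copy:
  assumes "child p c" shows "tile_copy c"
  using assms
proof (cases rule: child_cases)
  case 1
  then show ?thesis
    using sqrt2_bounds
    apply (elim insertE emptyE; simp only: tri1_def tri2_def tri3_def tri4_def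
        rhombus_turn[of "Complex (1 + sqrt 2) 0"] tri5_def)
    by (rule triangle_copy rhombus_copy;
        simp add: dist_Complex power2_eq_square algebra_simps complex_eq_iff)+
next
  case 2
  then show ?thesis
    using sqrt2_bounds
    apply (elim insertE emptyE; simp only: rho1_def rho2_def rho3_def rho4_def rho5_def
        rho6_def rho7_def rhombus_turn[of "Complex (1 + hs) hs"])
    by (rule triangle_copy rhombus_copy;
        simp add: dist_Complex power2_eq_square algebra_simps complex_eq_iff)+
qed

text \<open>The right corner of an expanded triangle is shared by two children and the obtuse corner
  of an expanded rhombus by three, each with an angle of 45 degrees. This is the source of the
  vertex of degree eight.\<close>

lemma child_corner_sharp:
  assumes "child p c" "v \<in> corners p" "lam *\<^sub>R v \<in> corners c"
  shows "lam *\<^sub>R v \<in> sharp c"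
  using assms(1)
proof (cases rule: child_cases)
  case 1
  then show ?thesis
    using assms(2,3) sqrt2_bounds unfolding proto_triangle_def
    by (elim insertE emptyE; auto simp: child_corners child_flow complex_scaleR distrib_right
        add_divide_distrib)
next
  case 2
  then show ?thesis
    using assms(2,3) sqrt2_bounds unfolding proto_rhombus_def
    by (elim insertE emptyE; auto simp: child_corners child_flow complex_scaleR distrib_right
        add_divide_distrib)
qed

lemma proto_triangle_region:
  assumes "0 \<le> y" "y \<le> x" "x + y \<le> sqrt 2"
  shows "Complex x y \<in> region proto_triangle"
proof -
  define u v where "u = (x - y) / sqrt 2" and "v = sqrt 2 * y"
  have "u + v = (x + y) / sqrt 2" by (simp add: u_def v_def field_simps)
  then have "0 \<le> u" "0 \<le> v" "u + v \<le> 1" using assms by (simp_all add: u_def v_def)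
  moreover have "Complex x y = (1 - u - v) *\<^sub>R Complex 0 0 + u *\<^sub>R Complex (sqrt 2) 0
      + v *\<^sub>R Complex hs hs"
    by (simp add: complex_eq_iff u_def v_def)
  ultimately show ?thesis
    unfolding region_def proto_triangle_def corners_triangle convex_hull_3
    by (intro CollectI exI[of _ "1 - u - v"] exI[of _ u] exI[of _ v]) simp
qed

lemma proto_rhombus_region:
  assumes "0 \<le> y" "y \<le> hs" "y \<le> x" "x \<le> y + 1"
  shows "Complex x y \<in> region proto_rhombus"
proof -
  define u v where "u = x - y" and "v = sqrt 2 * y"
  let ?R = "convex hull {Complex 0 0, Complex 1 0, Complex (1 + hs) hs, Complex hs hs}"
  have "sqrt 2 * y \<le> sqrt 2 * hs" using assms by (intro mult_left_mono) auto
  then have uv: "0 \<le> u" "u \<le> 1" "0 \<le> v" "v \<le> 1" using assms by (simp_all add: u_def v_def)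
  have seg: "(1 - r) *\<^sub>R z + r *\<^sub>R w \<in> ?R" if "z \<in> ?R" "w \<in> ?R" "0 \<le> r" "r \<le> 1" for r z w
    using that by (intro convexD[OF convex_convex_hull]) auto
  have "Complex x y = (1 - v) *\<^sub>R ((1 - u) *\<^sub>R Complex 0 0 + u *\<^sub>R Complex 1 0)
     + v *\<^sub>R ((1 - u) *\<^sub>R Complex hs hs + u *\<^sub>R Complex (1 + hs) hs)"
    by (simp add: complex_eq_iff u_def v_def algebra_simps)
  also have "\<dots> \<in> ?R" using uv by (intro seg hull_inc) auto
  finally show ?thesis by (simp add: region_def proto_rhombus_def)
qed

text \<open>By convexity only the corners of the child have to be located in the expanded parent,
  and the inequalities describing the two prototile regions do this.\<close>

lemma child_inside:
  assumes "child p c" "isometry f"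
  shows "region (map_tile (expand f) c) \<subseteq> (*\<^sub>R) lam ` region (map_tile f p)"
proof -
  have lam: "0 < lam" by (simp add: add_pos_pos)
  have c: "Complex x y = lam *\<^sub>R Complex (x / lam) (y / lam)" for x y
    using lam by (simp add: complex_eq_iff)
  have tri: "Complex x y \<in> (*\<^sub>R) lam ` region proto_triangle"
    if "0 \<le> y" "y \<le> x" "x + y \<le> 2 + sqrt 2" for x y
  proof -
    have "(x + y) / lam \<le> sqrt 2" using that lam by (simp add: pos_divide_le_eq algebra_simps)
    then show ?thesis unfolding c[of x y] using that lam
      by (intro imageI proto_triangle_region)
        (simp_all add: divide_right_mono add_divide_distrib)
  qed
  have rho: "Complex x y \<in> (*\<^sub>R) lam ` region proto_rhombus"
    if "0 \<le> y" "y \<le> 1 + hs" "y \<le> x" "x \<le> y + lam" for x y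
  proof -
    have "y / lam \<le> hs" using that lam by (simp add: pos_divide_le_eq algebra_simps)
    moreover have "x / lam \<le> (y + lam) / lam" using that lam by (intro divide_right_mono) auto
    then have "x / lam \<le> y / lam + 1" using lam by (simp add: add_divide_distrib)
    ultimately show ?thesis unfolding c[of x y] using that lam
      by (intro imageI proto_rhombus_region) (simp_all add: divide_right_mono)
  qed
  have "corners c \<subseteq> (*\<^sub>R) lam ` region p"
    using assms(1)
  proof (cases rule: child_cases)
    case 1
    then show ?thesis using sqrt2_bounds
      by (elim insertE emptyE; simp add: child_corners tri)
  next
    case 2
    then show ?thesis using sqrt2_bounds
      by (elim insertE emptyE; simp add: child_corners rho)
  qed
  then have "region c \<subseteq> (*\<^sub>R) lam ` region p"
    unfolding region_def[of c] by (rule hull_minimal) (simp add: region_def convex_scaling)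
  then have "expand f ` region c \<subseteq> expand f ` ((*\<^sub>R) lam ` region p)" by (rule image_mono)
  also have "\<dots> = (*\<^sub>R) lam ` f ` region p" by (simp add: image_image expand_scaleR)
  finally show ?thesis using assms(2) by (simp add: region_map isometry_expand)
qed

text \<open>A direction makes an angle with the horizontal axis that is a multiple of \<open>45\<close> degrees
  iff its fourth power is real.\<close>

definition octal :: "tile \<Rightarrow> bool" where
  "octal t \<longleftrightarrow> (\<forall>x y. {x, y} \<in> sides t \<longrightarrow> (y - x) ^ 4 \<in> \<real>)"

lemma pow4_real:
  "(Complex x y) ^ 4 \<in> \<real> \<longleftrightarrow> x = 0 \<or> y = 0 \<or> x = y \<or> x = - y"
proof -
  have "Im ((Complex x y) ^ 4) = 4 * (x * y * ((x - y) * (x + y)))"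
    by (simp add: eval_nat_numeral algebra_simps)
  then show ?thesis by (auto simp: complex_is_Real_iff)
qed

lemma pow4_minus_commute: "(x - y) ^ 4 = (y - x :: complex) ^ 4"
  by (metis minus_diff_eq power_minus_even even_numeral)

lemma octal_triangle:
  assumes "(b - a) ^ 4 \<in> \<real>" "(c - b) ^ 4 \<in> \<real>" "(a - c) ^ 4 \<in> \<real>"
  shows "octal (triangle a b c)"
  using assms pow4_minus_commute[of a b] pow4_minus_commute[of b c] pow4_minus_commute[of c a]
  unfolding octal_def triangle_def by (auto simp: doubleton_eq_iff)

lemma octal_rhombus:
  assumes "(b - a) ^ 4 \<in> \<real>" "(c - b) ^ 4 \<in> \<real>" "(d - c) ^ 4 \<in> \<real>" "(a - d) ^ 4 \<in> \<real>"
  shows "octal (rhombus a b c d)"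
  using assms pow4_minus_commute[of a b] pow4_minus_commute[of b c] pow4_minus_commute[of c d]
    pow4_minus_commute[of d a]
  unfolding octal_def rhombus_def by (auto simp: doubleton_eq_iff)

lemma proto_octal: "octal proto_triangle" "octal proto_rhombus"
  unfolding proto_triangle_def proto_rhombus_def
  by (rule octal_triangle octal_rhombus; simp add: minus_complex.ctr pow4_real)+

lemma child_octal:
  assumes "child p c" shows "octal c"
  using assms
  by (cases rule: child_cases; elim insertE emptyE; simp only: child_defs;
      intro octal_triangle octal_rhombus)
    (simp_all add: minus_complex.ctr pow4_real)

section \<open>Symmetries of the prototiles\<close>

text \<open>The reflection in the long diagonal, which makes an angle of 22.5 degrees with the axis.
  The summand 0 keeps the shape required by \<open>expand_opposite\<close>.\<close>

abbreviation mirror :: "complex \<Rightarrow> complex" where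
  "mirror \<equiv> (\<lambda>z. Complex hs hs * cnj z + 0)"

abbreviation half_turn :: "complex \<Rightarrow> complex" where
  "half_turn \<equiv> (\<lambda>z. (- 1) * z + Complex (1 + hs) hs)"

lemma rhombus_flip: "rhombus a b c d = rhombus a d c b"
  by (auto simp: rhombus_def insert_commute)

lemma half_turn_dissection:
  assumes "c \<in> rhombus_dissection" shows "map_tile (expand half_turn) c \<in> rhombus_dissection"
proof -
  note turn2 = rhombus_turn[THEN trans, OF rhombus_turn]
  have e: "expand half_turn (Complex x y) = Complex (2 + 3 * hs - x) (1 + hs - y)" for x y
    unfolding expand_direct by (simp add: complex_eq_iff algebra_simps)
  have "map_tile (expand half_turn) rho1 = rho3"
    unfolding rho1_def rho3_def map_tile_rhombus e by (subst turn2) (simp add: algebra_simps)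
  moreover have "map_tile (expand half_turn) rho2 = rho2"
    unfolding rho2_def map_tile_rhombus e by (subst turn2) (simp add: algebra_simps)
  moreover have "map_tile (expand half_turn) rho3 = rho1"
    unfolding rho1_def rho3_def map_tile_rhombus e by (subst turn2) (simp add: algebra_simps)
  moreover have "map_tile (expand half_turn) rho4 = rho6" "map_tile (expand half_turn) rho6 = rho4"
    "map_tile (expand half_turn) rho5 = rho7" "map_tile (expand half_turn) rho7 = rho5"
    unfolding rho4_def rho5_def rho6_def rho7_def map_tile_triangle e
    by (simp_all add: algebra_simps)
  ultimately show ?thesis using assms by (auto simp: rhombus_dissection_eq)
qed

lemma mirror_dissection:
  assumes "c \<in> rhombus_dissection" shows "map_tile (expand mirror) c \<in> rhombus_dissection"
proof -
  have e: "expand mirror (Complex x y) = Complex (hs * (x + y)) (hs * (x - y))" for x y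
    unfolding expand_opposite by (simp add: complex_eq_iff algebra_simps)
  have "map_tile (expand mirror) rho1 = rho1" "map_tile (expand mirror) rho2 = rho2"
    "map_tile (expand mirror) rho3 = rho3"
    unfolding rho1_def rho2_def rho3_def map_tile_rhombus e
    by (subst (3) rhombus_flip | subst rhombus_flip; simp add: algebra_simps add_divide_distrib)+
  moreover have "map_tile (expand mirror) rho4 = rho5" "map_tile (expand mirror) rho5 = rho4"
    "map_tile (expand mirror) rho6 = rho7" "map_tile (expand mirror) rho7 = rho6"
    unfolding rho4_def rho5_def rho6_def rho7_def map_tile_triangle e
    by (simp_all add: algebra_simps add_divide_distrib)
  ultimately show ?thesis using assms by (auto simp: rhombus_dissection_eq)
qed

text \<open>The arrow fixes both ends of the hypotenuse, and the reflection in the hypotenuse would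
  move the third corner off the triangle.\<close>

lemma triangle_symmetry:
  assumes k: "isometry k" "map_tile k proto_triangle = proto_triangle"
  shows "k = id"
proof -
  have fixed: "k (Complex 0 0) = Complex 0 0" "k (Complex (sqrt 2) 0) = Complex (sqrt 2) 0"
    using arg_cong[OF k(2), of arrow]
    by (simp_all add: proto_triangle_def triangle_def map_tile_def)
  have c: "k (Complex hs hs) \<in> {Complex 0 0, Complex (sqrt 2) 0, Complex hs hs}"
    using arg_cong[OF k(2), of corners] by (simp add: proto_triangle_def) blast
  have s: "Complex (sqrt 2) 0 \<noteq> 0" by (simp add: complex_eq_iff)
  from k(1) show ?thesis
  proof (cases rule: isometry_cases)
    case (1 a b)
    then show ?thesis using fixed s by (auto simp: fun_eq_iff simp flip: zero_complex.code)
  next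
    case (2 a b)
    have b: "b = 0" using fixed(1) 2 by (simp flip: zero_complex.code)
    have "cnj (Complex (sqrt 2) 0) = Complex (sqrt 2) 0" by (simp add: complex_eq_iff)
    then have "a = 1" using fixed(2) 2 b s by simp
    then show ?thesis using c 2 b by (auto simp: complex_eq_iff)
  qed
qed

text \<open>A symmetry fixes or exchanges the two acute corners. The images of two points determine
  a direct isometry, and likewise an opposite one, so four candidates remain.\<close>

lemma rhombus_symmetry:
  assumes k: "isometry k" "map_tile k proto_rhombus = proto_rhombus"
  shows "k \<in> {id, half_turn, mirror, half_turn \<circ> mirror}"
proof -
  let ?c = "Complex (1 + hs) hs"
  have "sharp proto_rhombus = k ` sharp proto_rhombus"
    using sharp_map[OF k(1), of proto_rhombus] by (simp only: k(2))
  then have "{0, ?c} = {k 0, k ?c}"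
    by (simp only: proto_rhombus_flow zero_complex.code[symmetric] image_insert image_empty)
  then have ends: "k 0 = 0 \<and> k ?c = ?c \<or> k 0 = ?c \<and> k ?c = 0"
    by (metis doubleton_eq_iff)
  have c0: "?c \<noteq> 0" using sqrt2_bounds by (simp add: complex_eq_iff)
  have m: "Complex hs hs * cnj ?c = ?c" by (simp add: complex_eq_iff algebra_simps)
  from k(1) show ?thesis
  proof (cases rule: isometry_cases)
    case (1 a b)
    from ends show ?thesis
    proof
      assume *: "k 0 = 0 \<and> k ?c = ?c"
      then have "b = 0" using 1 by simp
      moreover from this have "a * ?c = 1 * ?c" using * 1 by simp
      then have "a = 1" using c0 by (metis mult_right_cancel)
      ultimately have "k = id" using 1 by (simp add: fun_eq_iff)
      then show ?thesis by blast
    next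
      assume *: "k 0 = ?c \<and> k ?c = 0"
      then have b: "b = ?c" using 1 by simp
      have "a * ?c = (- 1) * ?c" using * 1 b by (simp add: eq_neg_iff_add_eq_0)
      then have "a = - 1" using c0 by (metis mult_right_cancel)
      then have "k = half_turn" using 1 b by simp
      then show ?thesis by blast
    qed
  next
    case (2 a b)
    have c1: "cnj ?c \<noteq> 0" using c0 by simp
    from ends show ?thesis
    proof
      assume *: "k 0 = 0 \<and> k ?c = ?c"
      then have b: "b = 0" using 2 by simp
      then have "a * cnj ?c = Complex hs hs * cnj ?c" using * 2 m by simp
      then have "a = Complex hs hs" using c1 by (metis mult_right_cancel)
      then have "k = mirror" using 2 b by simp
      then show ?thesis by blast
    next
      assume *: "k 0 = ?c \<and> k ?c = 0"
      then have b: "b = ?c" using 2 by simp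
      have "a * cnj ?c = - (Complex hs hs * cnj ?c)"
        using * 2 b unfolding m by (simp add: eq_neg_iff_add_eq_0)
      then have "a * cnj ?c = (- Complex hs hs) * cnj ?c" by simp
      then have "a = - Complex hs hs" using c1 by (metis mult_right_cancel)
      then have "k = half_turn \<circ> mirror" using 2 b by (simp add: fun_eq_iff)
      then show ?thesis by blast
    qed
  qed
qed

lemma child_symmetry:
  assumes "isometry k" "map_tile k p = p" "child p c"
  shows "child p (map_tile (expand k) c)"
proof -
  have id: "expand id = id" using expand_direct[of 1 0] by (simp add: id_def)
  from assms(3) consider "p = proto_triangle" | "p = proto_rhombus" "c \<in> rhombus_dissection"
    by (auto simp: child_def)
  then show ?thesis
  proof cases
    case 1
    then show ?thesis using triangle_symmetry[of k] assms id by simp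
  next
    case 2
    then have "k \<in> {id, half_turn, mirror, half_turn \<circ> mirror}"
      using rhombus_symmetry[of k] assms by simp
    then have "map_tile (expand k) c \<in> rhombus_dissection"
      using 2(2) half_turn_dissection mirror_dissection
      by (elim insertE emptyE; simp only: id map_tile_id expand_comp flip: map_tile_comp)
    then show ?thesis using 2(1) by (simp add: child_def)
  qed
qed

text \<open>\<open>substitute_tile\<close> collects children over all isometries that produce the
  tile. Two of these differ by a symmetry of the prototile, which permutes its dissection; hence one
  fixed \<open>f\<close> yields every child. The child \<open>c0\<close> only says that
  \<open>p\<close> is a prototile.\<close>

lemma substitute_tileE:
  assumes "s \<in> substitute_tile (map_tile f p)" "isometry f" "child p c0"
  obtains c where "child p c" "s = map_tile (expand f) c"
proof -
  from assms(1) obtain g q c where g: "isometry g" "map_tile f p = map_tile g q" "child q c"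
    "s = map_tile (expand g) c" by (auto simp: substitute_tile_iff)
  have "arrow p = None \<longleftrightarrow> arrow q = None"
    using arg_cong[OF g(2), of arrow] by (metis arrow_map option.map_disc_iff)
  moreover have "arrow proto_triangle \<noteq> None" "arrow proto_rhombus = None"
    by (simp_all add: proto_triangle_def proto_rhombus_def triangle_def rhombus_def)
  ultimately have q: "q = p" using g(3) assms(3) unfolding child_def by metis
  define k where "k = inv f \<circ> g"
  have k: "isometry k" using assms(2) g(1) by (simp add: k_def isometry_comp isometry_inv)
  have "f \<circ> k = g" using isometry_surj[OF assms(2)]
    by (simp add: k_def fun_eq_iff surj_f_inv_f)
  then have "expand g = expand f \<circ> expand k" by (simp flip: expand_comp)
  then have "s = map_tile (expand f) (map_tile (expand k) c)" by (simp add: g(4) map_tile_comp)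
  moreover have "map_tile k p = p"
    using g(2) q map_tile_inv[OF assms(2), of p] by (simp add: k_def flip: map_tile_comp)
  ultimately show thesis using that child_symmetry[OF k] g(3) q by blast
qed

section \<open>Patches\<close>

lemma mark_hull: "convex hull (mark x y ` R) = mark x y ` (convex hull R)"
proof -
  have "mark x y ` S = (+) (lam *\<^sub>R x) ` (\<lambda>r. r *\<^sub>R (y - x)) ` S" for S
    by (simp add: mark_def image_image)
  then show ?thesis
    by (simp add: convex_hull_translation
        convex_hull_linear_image[OF bounded_linear.linear[OF bounded_linear_scaleR_left]])
qed

lemma mark_inj: "x \<noteq> y \<Longrightarrow> inj (mark x y)"
  by (auto simp: inj_def mark_def)

lemma mark_expand:
  assumes "isometry f" shows "mark (f x) (f y) r = expand f (mark x y r)"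
proof -
  have lam: "lam \<noteq> 0" using sqrt2_bounds by simp
  have "mark x y r = lam *\<^sub>R x + (r / lam) *\<^sub>R (lam *\<^sub>R y - lam *\<^sub>R x)"
    using lam by (simp add: mark_def flip: scaleR_diff_right)
  then have "expand f (mark x y r) = lam *\<^sub>R f x + (r / lam) *\<^sub>R (lam *\<^sub>R f y - lam *\<^sub>R f x)"
    using isometry_affine[OF isometry_expand[OF assms]] by (simp only: expand_scaleR)
  then show ?thesis using lam by (simp add: mark_def flip: scaleR_diff_right)
qed

lemma abuts_map:
  assumes f: "isometry f" and "abuts t x y"
  shows "abuts (map_tile (expand f) t) (f x) (f y)"
proof -
  let ?g = "expand f"
  have g: "isometry ?g" by (rule isometry_expand[OF f])
  from assms(2) obtain R where R: "trace_on t x y R"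
    "region t \<inter> convex hull {lam *\<^sub>R x, lam *\<^sub>R y} \<subseteq> convex hull (mark x y ` R)"
    by (auto simp: abuts_def)
  have m: "mark (f x) (f y) ` R = ?g ` mark x y ` R"
    by (simp add: image_image mark_expand[OF f])
  have c: "cuts (f x) (f y) = cuts x y" by (simp add: cuts_def isometry_dist[OF f])
  have "trace_on (map_tile ?g t) (f x) (f y) R"
    using R(1) flow_map_subset[OF g] unfolding trace_on_def m c mark_expand[OF f]
    by (fastforce simp: image_mono)
  moreover have "region (map_tile ?g t) \<inter> convex hull {lam *\<^sub>R f x, lam *\<^sub>R f y}
      \<subseteq> convex hull (mark (f x) (f y) ` R)"
  proof -
    have "{lam *\<^sub>R f x, lam *\<^sub>R f y} = ?g ` {lam *\<^sub>R x, lam *\<^sub>R y}" by (simp add: expand_scaleR)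
    then have "region (map_tile ?g t) \<inter> convex hull {lam *\<^sub>R f x, lam *\<^sub>R f y}
       = ?g ` (region t \<inter> convex hull {lam *\<^sub>R x, lam *\<^sub>R y})"
      using isometry_inj[OF g] by (simp only: region_map[OF g] isometry_hull[OF g, symmetric] image_Int)
    also have "\<dots> \<subseteq> ?g ` (convex hull (mark x y ` R))" by (rule image_mono[OF R(2)])
    finally show ?thesis by (simp only: m isometry_hull[OF g])
  qed
  ultimately show ?thesis by (auto simp: abuts_def)
qed

section \<open>Cut points and pieces of one expanded side\<close>

definition piece :: "complex \<Rightarrow> complex \<Rightarrow> real set \<Rightarrow> bool" where
  "piece x y R \<longleftrightarrow> R = {} \<or> (\<exists>(r, r')\<in>cuts x y. R \<in> {{r}, {r'}, {r, r'}})"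

lemma chain_hulls:
  fixes p q r s :: real
  assumes "p < q" "q < r" "r < s"
    and R: "R \<in> {{}, {p}, {q}, {r}, {s}, {p, q}, {q, r}, {r, s}}"
    and R': "R' \<in> {{}, {p}, {q}, {r}, {s}, {p, q}, {q, r}, {r, s}}" and "R \<noteq> R'"
  shows "convex hull R \<inter> convex hull R' \<subseteq> R \<inter> R'" "\<exists>v. R \<inter> R' \<subseteq> {v}"
proof -
  have hull: "convex hull {a, b} = {a..b}" if "a < b" for a b :: real
    using that by (simp add: closed_segment_eq_real_ivl flip: segment_convex_hull)
  have hulls: "convex hull {p, q} = {p..q}" "convex hull {q, r} = {q..r}"
      "convex hull {r, s} = {r..s}"
    using hull assms(1-3) by simp_all
  show "convex hull R \<inter> convex hull R' \<subseteq> R \<inter> R'"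
    using R
    by (elim insertE emptyE; use R' in \<open>elim insertE emptyE\<close>;
        use assms(1-3,6) in \<open>simp add: hulls; fastforce?\<close>)
  show "\<exists>v. R \<inter> R' \<subseteq> {v}"
  proof (rule ccontr)
    assume "\<nexists>v. R \<inter> R' \<subseteq> {v}"
    then obtain v w where vw: "v \<in> R \<inter> R'" "w \<in> R \<inter> R'" "v \<noteq> w" by blast
    have "S = {v, w}" if "S \<subseteq> {a, b}" "v \<in> S" "w \<in> S" for S a b
      using that vw(3) by blast
    moreover have "\<exists>a b. R \<subseteq> {a, b}" "\<exists>a b. R' \<subseteq> {a, b}" using R R' by blast+
    ultimately have "R = {v, w}" "R' = {v, w}" using vw by blast+
    then show False using assms(6) by simp
  qed
qed

lemma piece_chain:
  obtains p q r s where "p < q" "q < r" "r < s"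
    "\<forall>R. piece x y R \<longrightarrow> R \<in> {{}, {p}, {q}, {r}, {s}, {p, q}, {q, r}, {r, s}}"
proof (cases "dist x y = 1")
  case True
  \<comment> \<open>A unit side has only three cut points; \<open>lam + 1\<close> is a dummy, so
    that both lengths fit a chain of four points.\<close>
  have R: "R \<in> {{}, {0}, {1}, {lam}, {lam + 1}, {0, 1}, {1, lam}, {lam, lam + 1}}"
    if "piece x y R" for R
  proof -
    have c: "cuts x y = {(0, 1), (1, lam)}" using True by (simp add: cuts_def)
    show ?thesis using that unfolding piece_def c bex_simps case_prod_conv insert_iff empty_iff by argo
  qed
  show thesis
    by (rule that[OF _ _ _ allI[OF impI[OF R]]]) (use sqrt2_bounds in simp_all)
next
  case False
  have R: "R \<in> {{}, {0}, {hs}, {1 + hs}, {lam}, {0, hs}, {hs, 1 + hs}, {1 + hs, lam}}"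
    if "piece x y R" for R
  proof -
    have c: "cuts x y = {(0, hs), (1 + hs, hs), (lam, 1 + hs)}" using False by (simp add: cuts_def)
    show ?thesis
      using that unfolding piece_def c bex_simps case_prod_conv
        insert_commute[of "1 + hs" hs] insert_commute[of lam "1 + hs"] insert_iff empty_iff
      by argo
  qed
  show thesis
    by (rule that[OF _ _ _ allI[OF impI[OF R]]]) (use sqrt2_bounds in simp_all)
qed

lemma piece_hulls:
  assumes "piece x y R" "piece x y R'" "R \<noteq> R'"
  shows "convex hull R \<inter> convex hull R' \<subseteq> R \<inter> R'" "\<exists>v. R \<inter> R' \<subseteq> {v}"
proof -
  obtain p q r s where pqrs: "p < q" "q < r" "r < s"
    "\<forall>R. piece x y R \<longrightarrow> R \<in> {{}, {p}, {q}, {r}, {s}, {p, q}, {q, r}, {r, s}}"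
    by (rule piece_chain[of x y])
  note * = chain_hulls[OF pqrs(1-3) pqrs(4)[rule_format, OF assms(1)]
      pqrs(4)[rule_format, OF assms(2)] assms(3)]
  show "convex hull R \<inter> convex hull R' \<subseteq> R \<inter> R'" by (rule *(1))
  show "\<exists>v. R \<inter> R' \<subseteq> {v}" by (rule *(2))
qed

lemma trace_piece: "trace_on t x y R \<Longrightarrow> piece x y R"
  unfolding trace_on_def piece_def by blast

lemma cuts_antisym:
  assumes "(r, r') \<in> cuts x y" shows "r \<noteq> r'" "(r', r) \<notin> cuts x y"
proof -
  have "r \<noteq> r' \<and> (r', r) \<notin> cuts x y"
  proof (cases "dist x y = 1")
    case True
    have "a < b" if "(a, b) \<in> cuts x y" for a b
    proof -
      have "(a, b) = (0, 1) \<or> (a, b) = (1, lam)" using that True by (simp add: cuts_def)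
      then show ?thesis by auto
    qed
    from this[of r r'] this[of r' r] assms show ?thesis by auto
  next
    case False
    \<comment> \<open>On a hypotenuse every piece ends at a positive parameter, and a forward piece
      starts at 0; its reverse would end at 0.\<close>
    have "0 < b \<and> a \<noteq> b \<and> (a < b \<longrightarrow> a = 0)" if "(a, b) \<in> cuts x y" for a b
    proof -
      have "(a, b) = (0, hs) \<or> (a, b) = (1 + hs, hs) \<or> (a, b) = (lam, 1 + hs)"
        using that False by (simp add: cuts_def)
      then show ?thesis using sqrt2_bounds by (elim disjE) simp_all
    qed
    from this[of r r'] this[of r' r] assms show ?thesis by auto
  qed
  then show "r \<noteq> r'" "(r', r) \<notin> cuts x y" by simp_all
qed

text \<open>Both tiles touch the side in sets of cut parameters. Equal two-point sets give a common
  piece, on which \<open>cuts\<close> prescribes the same orientation to both tiles; different sets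
  overlap in at most one cut point.\<close>

lemma abuts_meet:
  assumes "abuts s x y" "abuts t x y" "x \<noteq> y"
    and sub: "region s \<inter> region t \<subseteq> convex hull {lam *\<^sub>R x, lam *\<^sub>R y}"
  shows "meets s t"
proof -
  from assms(1,2) obtain R R' where
    R: "trace_on s x y R" "region s \<inter> convex hull {lam *\<^sub>R x, lam *\<^sub>R y} \<subseteq> convex hull (mark x y ` R)" and
    R': "trace_on t x y R'" "region t \<inter> convex hull {lam *\<^sub>R x, lam *\<^sub>R y} \<subseteq> convex hull (mark x y ` R')"
    unfolding abuts_def by blast
  have st: "region s \<inter> region t \<subseteq> mark x y ` (convex hull R \<inter> convex hull R')"
    using R(2) R'(2) sub unfolding mark_hull image_Int[OF mark_inj[OF assms(3)]] by blast
  show ?thesis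
  proof (cases "R = R'")
    case True
    have "joint s t (mark x y ` R)"
    proof -
      have sub: "mark x y ` R \<subseteq> corners s \<inter> corners t"
        using R(1) R'(1) True by (simp add: trace_on_def)
      consider "R = {}" | r where "R = {r}"
        | r r' where "(r, r') \<in> cuts x y" "R = {r, r'}" "(mark x y r, mark x y r') \<in> flow s"
        using R(1) unfolding trace_on_def by blast
      then show ?thesis
      proof cases
        case (3 r r')
        obtain q q' where q: "(q, q') \<in> cuts x y"
          "R = {q} \<or> R = {q'} \<or> R = {q, q'} \<and> (mark x y q, mark x y q') \<in> flow t"
          using R'(1) True 3(2) unfolding trace_on_def by blast
        have "r \<noteq> r'" by (rule cuts_antisym(1)[OF 3(1)])
        then have "{r, r'} = {q, q'} \<and> (mark x y q, mark x y q') \<in> flow t"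
          using q(2) 3(2) by auto
        \<comment> \<open>Only here could the second tile traverse the piece backwards; no piece
          occurs in \<open>cuts\<close> with both orientations.\<close>
        moreover have "(r, r') \<noteq> (q', q)" using cuts_antisym(2)[OF 3(1)] q(1) by blast
        ultimately have "(mark x y r, mark x y r') \<in> flow t"
          by (auto simp: doubleton_eq_iff)
        then show ?thesis using sub 3 unfolding joint_def by auto
      qed (use sub in \<open>auto simp: joint_def\<close>)
    qed
    moreover have "region s \<inter> region t \<subseteq> convex hull (mark x y ` R)"
      using st True by (simp add: mark_hull)
    ultimately show ?thesis by (auto simp: meets_def)
  next
    case False
    note * = piece_hulls[OF trace_piece[OF R(1)] trace_piece[OF R'(1)] False]
    define E where "E = mark x y ` (R \<inter> R')"
    obtain v where "R \<inter> R' \<subseteq> {v}" using *(2) by blast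
    then have "E \<subseteq> {mark x y v}" by (auto simp: E_def)
    then have "E = {} \<or> (\<exists>v. E = {v})" by blast
    moreover have "E \<subseteq> corners s \<inter> corners t"
      using R(1) R'(1) unfolding trace_on_def E_def by blast
    moreover have "region s \<inter> region t \<subseteq> E" using st *(1) unfolding E_def by blast
    then have "region s \<inter> region t \<subseteq> convex hull E" using hull_subset[of E convex] by blast
    ultimately show ?thesis unfolding meets_def joint_def by blast
  qed
qed

section \<open>Corners of expanded tiles\<close>

lemma corner_on_flow:
  assumes "child p c" "v \<in> corners p"
  shows "\<exists>(x, y)\<in>flow p. x \<noteq> y \<and> (v = x \<or> v = y)"
proof -
  from assms(1) consider "p = proto_triangle" | "p = proto_rhombus" by (auto simp: child_def)
  then show ?thesis
  proof cases
    case 1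
    then show ?thesis using assms(2) unfolding 1 proto_triangle_flow by (auto simp: proto_triangle_def)
  next
    case 2
    then show ?thesis using assms(2) unfolding 2 proto_rhombus_flow by (auto simp: proto_rhombus_def)
  qed
qed

text \<open>An expanded corner ends an expanded side and is therefore a cut point. A piece contains
  a cut point only as one of its ends, so the expanded corner is a corner of the child.\<close>

lemma child_at_corner:
  assumes "child p c" "v \<in> corners p" "lam *\<^sub>R v \<in> region c"
  shows "lam *\<^sub>R v \<in> sharp c"
proof -
  obtain x y where xy: "(x, y) \<in> flow p" "x \<noteq> y" "v = x \<or> v = y"
    using corner_on_flow[OF assms(1,2)] by blast
  obtain R where R: "trace_on c x y R"
    "region c \<inter> convex hull {lam *\<^sub>R x, lam *\<^sub>R y} \<subseteq> convex hull (mark x y ` R)"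
    using child_abuts[OF assms(1) xy(1)] by (auto simp: abuts_def)
  have ends: "mark x y 0 = lam *\<^sub>R x" "mark x y lam = lam *\<^sub>R y"
    by (simp_all add: mark_def flip: scaleR_add_right)
  define r where "r = (if v = x then 0 else lam)"
  have r: "lam *\<^sub>R v = mark x y r" using xy(3) ends by (auto simp: r_def)
  have "0 \<in> fst ` cuts x y \<union> snd ` cuts x y" "lam \<in> fst ` cuts x y \<union> snd ` cuts x y"
    by (auto simp: cuts_def)
  then have "r \<in> fst ` cuts x y \<union> snd ` cuts x y" by (simp add: r_def)
  then have pr: "piece x y {r}" unfolding piece_def by force
  have "lam *\<^sub>R v \<in> convex hull {lam *\<^sub>R x, lam *\<^sub>R y}" using xy(3) by (auto intro: hull_inc)
  then have "mark x y r \<in> mark x y ` (convex hull R)"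
    using R(2) assms(3) r by (auto simp: mark_hull)
  then have "r \<in> convex hull R" using mark_inj[OF xy(2)] by (simp add: inj_image_mem_iff)
  then have "r \<in> R" using piece_hulls(1)[OF trace_piece[OF R(1)] pr] by (cases "R = {r}") auto
  then have "lam *\<^sub>R v \<in> corners c" using R(1) r by (auto simp: trace_on_def)
  then show ?thesis by (rule child_corner_sharp[OF assms(1,2)])
qed

lemma substitute_at_corner:
  assumes "s \<in> substitute_tile t" "v \<in> corners t" "lam *\<^sub>R v \<in> region s"
  shows "lam *\<^sub>R v \<in> sharp s"
proof -
  from assms(1) obtain f p c where f: "isometry f" "t = map_tile f p" "child p c"
    "s = map_tile (expand f) c" by (auto simp: substitute_tile_iff)
  note g = isometry_expand[OF f(1)]
  obtain v' where v': "v' \<in> corners p" "v = f v'" using assms(2) f(2) by auto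
  have v: "lam *\<^sub>R v = expand f (lam *\<^sub>R v')" by (simp only: v'(2) expand_scaleR)
  have "lam *\<^sub>R v' \<in> region c"
    using assms(3) isometry_inj[OF g] by (simp only: v f(4) region_map[OF g] inj_image_mem_iff)
  from child_at_corner[OF f(3) v'(1) this] show ?thesis by (simp only: v f(4) sharp_map[OF g] imageI)
qed

lemma substitute_abuts:
  assumes "s \<in> substitute_tile t" "(x, y) \<in> flow t"
  shows "abuts s x y"
proof -
  from assms(1) obtain f p c where f: "isometry f" "t = map_tile f p" "child p c"
    "s = map_tile (expand f) c" by (auto simp: substitute_tile_iff)
  obtain x' y' where "(x', y') \<in> flow p" "x = f x'" "y = f y'"
    using flow_mapE[OF f(1)] assms(2) f(2) by metis
  then show ?thesis using abuts_map[OF f(1) child_abuts[OF f(3)]] f(4) by simp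
qed

lemma substitute_inside:
  assumes "s \<in> substitute_tile t" shows "region s \<subseteq> (*\<^sub>R) lam ` region t"
  using assms child_inside unfolding substitute_tile_iff by blast

text \<open>One nonzero vector with real fourth power before and after the map forces the fourth
  power of the rotation factor \<open>a\<close> to be real; then the property is preserved for all
  vectors.\<close>

lemma isometry_octal:
  assumes f: "isometry f" and "x \<noteq> y" "(y - x) ^ 4 \<in> \<real>" "(f y - f x) ^ 4 \<in> \<real>"
    and v: "(v - u) ^ 4 \<in> \<real>"
  shows "(f v - f u) ^ 4 \<in> \<real>"
proof -
  have conv: "a ^ 4 \<in> \<real>" if "(a * d) ^ 4 \<in> \<real>" "d ^ 4 \<in> \<real>" "d \<noteq> 0" for a d :: complex
    using Reals_divide[OF that(1,2)] that(3) by (simp add: power_mult_distrib)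
  from f show ?thesis
  proof (cases rule: isometry_cases)
    case (1 a b)
    have d: "f q - f p = a * (q - p)" for p q unfolding 1 by (simp add: algebra_simps)
    have "a ^ 4 \<in> \<real>" using assms(2-4) unfolding d by (intro conv[of a "y - x"]) auto
    then show ?thesis using v unfolding d by (simp add: power_mult_distrib Reals_mult)
  next
    case (2 a b)
    have d: "f q - f p = a * cnj (q - p)" for p q unfolding 2 by (simp add: algebra_simps)
    have "cnj z ^ 4 \<in> \<real>" if "z ^ 4 \<in> \<real>" for z :: complex
      using that by (simp add: complex_is_Real_iff flip: complex_cnj_power)
    note c = this[of "q - p" for q p]
    have "cnj (y - x) \<noteq> 0" using assms(2) by simp
    then have "a ^ 4 \<in> \<real>" using assms(4) c[OF assms(3)] unfolding d
      by (intro conv[of a "cnj (y - x)"])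
    then show ?thesis using c[OF v] unfolding d power_mult_distrib by (rule Reals_mult)
  qed
qed

lemma octal_map:
  assumes f: "isometry f" "x \<noteq> y" "(y - x) ^ 4 \<in> \<real>" "(f y - f x) ^ 4 \<in> \<real>"
    and t: "octal t"
  shows "octal (map_tile f t)"
  unfolding octal_def
proof (intro allI impI)
  fix u v assume "{u, v} \<in> sides (map_tile f t)"
  then obtain e where e: "e \<in> sides t" "{u, v} = f ` e" by auto
  then obtain u' v' where uv: "u' \<in> e" "v' \<in> e" "u = f u'" "v = f v'"
    by (metis image_iff insertCI)
  have "e = {u', v'}"
  proof -
    have "f ` e = f ` {u', v'}" using e(2) uv by simp
    then show ?thesis using isometry_inj[OF f(1)] by (simp only: inj_image_eq_iff)
  qed
  then show "(v - u) ^ 4 \<in> \<real>"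
    using t e(1) isometry_octal[OF f] by (simp add: octal_def uv(3,4))
qed

lemma substitute_octal:
  assumes "s \<in> substitute_tile t" "octal t" shows "octal s"
proof -
  from assms(1) obtain f p c where f: "isometry f" "t = map_tile f p" "child p c"
    "s = map_tile (expand f) c" by (auto simp: substitute_tile_iff)
  have p: "p = proto_triangle \<or> p = proto_rhombus" using f(3) by (auto simp: child_def)
  then have "corners p \<noteq> {}" by (auto simp: proto_triangle_def proto_rhombus_def)
  \<comment> \<open>A single side of the parent serves as the test vector: its expansion has the
    same direction and is moved by \<open>expand f\<close>.\<close>
  then obtain x y where xy: "{x, y} \<in> sides p" "x \<noteq> y" "octal p"
    using corner_on_flow[OF f(3)] p proto_octal flow_sides by blast
  have p: "(y - x) ^ 4 \<in> \<real>" using xy by (simp add: octal_def)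
  have "{f x, f y} \<in> sides t" using imageI[OF xy(1), of "(`) f"] by (simp add: f(2))
  then have q: "(f y - f x) ^ 4 \<in> \<real>" using assms(2) by (simp add: octal_def)
  have lam: "lam \<noteq> 0" using sqrt2_bounds by simp
  have scale: "(lam *\<^sub>R v - lam *\<^sub>R u) ^ 4 \<in> \<real>" if "(v - u) ^ 4 \<in> \<real>" for u v :: complex
  proof -
    have "(lam *\<^sub>R v - lam *\<^sub>R u) ^ 4 = of_real (lam ^ 4) * (v - u) ^ 4"
      by (simp only: scaleR_conv_of_real right_diff_distrib[symmetric] power_mult_distrib of_real_power)
    then show ?thesis by (simp only: Reals_mult[OF Reals_of_real that])
  qed
  have "octal (map_tile (expand f) c)"
  proof (rule octal_map[OF isometry_expand[OF f(1)]])
    show "lam *\<^sub>R x \<noteq> lam *\<^sub>R y" using lam xy(2) by simp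
    show "(lam *\<^sub>R y - lam *\<^sub>R x) ^ 4 \<in> \<real>" by (rule scale[OF p])
    show "(expand f (lam *\<^sub>R y) - expand f (lam *\<^sub>R x)) ^ 4 \<in> \<real>"
      unfolding expand_scaleR by (rule scale[OF q])
  qed (rule child_octal[OF f(3)])
  then show ?thesis by (simp add: f(4))
qed

text \<open>The invariant of the induction. The directions are included because iterated
  substitutions start from prototiles in standard position.\<close>

definition patch :: "tile set \<Rightarrow> bool" where
  "patch P \<longleftrightarrow>
     (\<forall>t\<in>P. tile_copy t \<and> octal t) \<and> (\<forall>s\<in>P. \<forall>t\<in>P. s \<noteq> t \<longrightarrow> meets s t)"

text \<open>Siblings are covered by the dissection of one prototile. Children of different parents
  intersect only in the expanded common face of the parents, so the three kinds of faces are treated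
  separately: for a corner all children there have it as a corner, for a side the agreeing
  orientations give equal cuts.\<close>

lemma substitute_meet:
  assumes "s \<in> substitute_tile s0" "t \<in> substitute_tile t0" "s \<noteq> t" "s0 = t0 \<or> meets s0 t0"
  shows "meets s t"
  using assms(4)
proof
  assume "s0 = t0"
  from assms(1) obtain f p c where f: "isometry f" "s0 = map_tile f p" "child p c"
    "s = map_tile (expand f) c" by (auto simp: substitute_tile_iff)
  obtain d where d: "child p d" "t = map_tile (expand f) d"
    using substitute_tileE[OF _ f(1,3)] assms(2) f(2) \<open>s0 = t0\<close> by metis
  have "meets c d" using f(3,4) d assms(3) children_meet by blast
  then show ?thesis using meets_map[OF isometry_expand[OF f(1)]] f(4) d(2) by simp
next
  assume "meets s0 t0"
  then obtain E where E: "joint s0 t0 E" "region s0 \<inter> region t0 \<subseteq> convex hull E"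
    by (auto simp: meets_def)
  have "inj ((*\<^sub>R) lam :: complex \<Rightarrow> complex)"
    using sqrt2_bounds by (intro injI) simp
  then have "region s \<inter> region t \<subseteq> (*\<^sub>R) lam ` (region s0 \<inter> region t0)"
    using substitute_inside[OF assms(1)] substitute_inside[OF assms(2)] by (simp add: image_Int) blast
  also have "\<dots> \<subseteq> (*\<^sub>R) lam ` (convex hull E)" using E(2) by (rule image_mono)
  also have "\<dots> = convex hull ((*\<^sub>R) lam ` E)" by (rule convex_hull_scaling[symmetric])
  finally have sub: "region s \<inter> region t \<subseteq> convex hull ((*\<^sub>R) lam ` E)" .
  consider "E = {}" | v where "E = {v}" | x y where "E = {x, y}" "x \<noteq> y" "(x, y) \<in> flow s0 \<inter> flow t0"
    using E(1) unfolding joint_def by blast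
  then show ?thesis
  proof cases
    case 1
    then show ?thesis using sub by (auto simp: meets_def joint_def)
  next
    case (2 v)
    have v: "v \<in> corners s0" "v \<in> corners t0" using E(1) 2 by (auto simp: joint_def)
    show ?thesis
    proof (cases "region s \<inter> region t = {}")
      case True
      then show ?thesis by (auto simp: meets_def joint_def)
    next
      case False
      then have "lam *\<^sub>R v \<in> region s" "lam *\<^sub>R v \<in> region t" using sub 2 by auto
      then have "lam *\<^sub>R v \<in> corners s \<inter> corners t"
        using substitute_at_corner[OF assms(1) v(1)] substitute_at_corner[OF assms(2) v(2)]
          sharp_corners by blast
      then have "joint s t {lam *\<^sub>R v}" by (simp add: joint_def)
      then show ?thesis using sub 2 unfolding meets_def by (intro exI[of _ "{lam *\<^sub>R v}"]) simp
    qed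
  next
    case (3 x y)
    then show ?thesis
      using substitute_abuts[OF assms(1)] substitute_abuts[OF assms(2)] sub
      by (intro abuts_meet[of s x y t]) auto
  qed
qed

lemma patch_substitute:
  assumes "patch P" shows "patch (substitute P)"
proof -
  have "tile_copy s \<and> octal s" if "s \<in> substitute_tile t" "t \<in> P" for s t
  proof
    from that(1) obtain f p c where "isometry f" "child p c" "s = map_tile (expand f) c"
      by (auto simp: substitute_tile_iff)
    then show "tile_copy s" by (simp add: tile_copy_map child_copy isometry_expand)
    show "octal s" using that assms by (auto simp: patch_def intro: substitute_octal[OF that(1)])
  qed
  moreover have "meets s t"
    if "s \<in> substitute_tile s0" "t \<in> substitute_tile t0" "s0 \<in> P" "t0 \<in> P" "s \<noteq> t" for s t s0 t0
    using that assms by (intro substitute_meet[of s s0 t t0]) (auto simp: patch_def)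
  ultimately show ?thesis unfolding patch_def substitute_def by blast
qed

lemma patch_iterate:
  assumes "p \<in> {proto_triangle, proto_rhombus}"
  shows "patch ((substitute ^^ n) {p})"
proof (induction n)
  case 0
  have "tile_copy p"
    using assms isometry_id unfolding tile_copy_def congruent_copy_def
    by (metis insertE map_tile_id singletonD)
  then show ?case using assms proto_octal by (auto simp: patch_def)
next
  case (Suc n)
  then show ?case by (simp add: patch_substitute)
qed

section \<open>Sides of a patch\<close>

lemma proto_sides_cross:
  assumes "p \<in> {proto_triangle, proto_rhombus}" "e \<in> sides p" "e' \<in> sides p" "e \<noteq> e'"
  shows "\<exists>v. convex hull e \<inter> convex hull e' \<subseteq> {v}"
proof -
  let ?c = "\<lambda>e e' :: complex set. \<exists>v. convex hull e \<inter> convex hull e' \<subseteq> {v}"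
  have sym: "?c e e'" if "?c e' e" for e e' using that by (simp add: Int_commute)
  have sep: "?c e e'" if "\<forall>z\<in>e. w \<bullet> z \<le> k \<and> (w \<bullet> z = k \<longrightarrow> z = v)" "\<forall>z\<in>e'. k \<le> w \<bullet> z" for e e' w k v
    using hull_separated[of e w k "{v}" e'] that by (intro exI[of _ v]) auto
  let ?A = "Complex 0 0" and ?B = "Complex (sqrt 2) 0" and ?C = "Complex hs hs"
    and ?D = "Complex 1 0" and ?E = "Complex (1 + hs) hs"
  have t: "?c {?A, ?B} {?B, ?C}" "?c {?B, ?C} {?C, ?A}" "?c {?A, ?B} {?C, ?A}"
  proof -
  have "?c {?A, ?B} {?B, ?C}"
    by (rule sep[where w = "Complex 1 3" and k = "sqrt 2" and v = ?B];
        use sqrt2_bounds in \<open>force simp: inner_complex_def\<close>)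
  moreover have "?c {?B, ?C} {?C, ?A}"
    by (rule sep[where w = "Complex (- 1) 0" and k = "- hs" and v = ?C];
        use sqrt2_bounds in \<open>force simp: inner_complex_def\<close>)
  moreover have "?c {?A, ?B} {?C, ?A}"
    by (rule sep[where w = "Complex (- 1) 2" and k = "0" and v = ?A];
        use sqrt2_bounds in \<open>force simp: inner_complex_def\<close>)
  ultimately show "?c {?A, ?B} {?B, ?C}" "?c {?B, ?C} {?C, ?A}" "?c {?A, ?B} {?C, ?A}" .
  qed
  have r: "?c {?A, ?D} {?D, ?E}" "?c {?A, ?D} {?C, ?A}" "?c {?A, ?D} {?E, ?C}"
    "?c {?D, ?E} {?E, ?C}" "?c {?D, ?E} {?C, ?A}" "?c {?E, ?C} {?C, ?A}"
  proof -
  have "?c {?A, ?D} {?D, ?E}"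
    by (rule sep[where w = "Complex 1 0" and k = "1" and v = ?D];
        use sqrt2_bounds in \<open>force simp: inner_complex_def\<close>)
  moreover have "?c {?A, ?D} {?C, ?A}"
    by (rule sep[where w = "Complex (- 1) 2" and k = "0" and v = ?A];
        use sqrt2_bounds in \<open>force simp: inner_complex_def\<close>)
  \<comment> \<open>Opposite sides are disjoint: the value \<open>k\<close> is not attained on the
    first one, and \<open>v\<close> is only a placeholder.\<close>
  moreover have "?c {?A, ?D} {?E, ?C}"
    by (rule sep[where w = "Complex 0 1" and k = "1 / 2" and v = ?A];
        use sqrt2_bounds in \<open>force simp: inner_complex_def\<close>)
  moreover have "?c {?D, ?E} {?E, ?C}"
    by (rule sep[where w = "Complex (- 1) 2" and k = "- 1 + hs" and v = ?E];
        use sqrt2_bounds in \<open>force simp: inner_complex_def\<close>)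
  moreover have "?c {?D, ?E} {?C, ?A}"
    by (rule sep[where w = "Complex (- 1) 1" and k = "- 1 / 2" and v = ?A];
        use sqrt2_bounds in \<open>force simp: inner_complex_def\<close>)
  moreover have "?c {?E, ?C} {?C, ?A}"
    by (rule sep[where w = "Complex (- 1) 0" and k = "- hs" and v = ?C];
        use sqrt2_bounds in \<open>force simp: inner_complex_def\<close>)
  ultimately show "?c {?A, ?D} {?D, ?E}" "?c {?A, ?D} {?C, ?A}" "?c {?A, ?D} {?E, ?C}"
    "?c {?D, ?E} {?E, ?C}" "?c {?D, ?E} {?C, ?A}" "?c {?E, ?C} {?C, ?A}" .
  qed
  from assms(1) consider "p = proto_triangle" | "p = proto_rhombus" by blast
  then show ?thesis
  proof cases
    case 1
    then have "e \<in> {{?A, ?B}, {?B, ?C}, {?C, ?A}}" "e' \<in> {{?A, ?B}, {?B, ?C}, {?C, ?A}}"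
      using assms(2,3) by (simp_all add: proto_triangle_def triangle_def)
    then show ?thesis using t t[THEN sym] assms(4) by (elim insertE emptyE) (simp only:; fail)+
  next
    case 2
    then have "e \<in> {{?A, ?D}, {?D, ?E}, {?E, ?C}, {?C, ?A}}"
        "e' \<in> {{?A, ?D}, {?D, ?E}, {?E, ?C}, {?C, ?A}}"
      using assms(2,3) by (simp_all add: proto_rhombus_def rhombus_def)
    then show ?thesis using r r[THEN sym] assms(4) by (elim insertE emptyE) (simp only:; fail)+
  qed
qed

lemma tile_copyE:
  assumes "tile_copy t"
  obtains f p where "isometry f" "p \<in> {proto_triangle, proto_rhombus}" "t = map_tile f p"
  using assms unfolding tile_copy_def congruent_copy_def by blast

lemma tile_sides_cross:
  assumes "tile_copy t" "e \<in> sides t" "e' \<in> sides t" "e \<noteq> e'"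
  shows "\<exists>v. convex hull e \<inter> convex hull e' \<subseteq> {v}"
proof -
  obtain f p where f: "isometry f" "p \<in> {proto_triangle, proto_rhombus}" "t = map_tile f p"
    using assms(1) by (rule tile_copyE)
  obtain d d' where d: "d \<in> sides p" "d' \<in> sides p" "e = f ` d" "e' = f ` d'"
    using assms(2,3) f(3) by auto
  obtain v where "convex hull d \<inter> convex hull d' \<subseteq> {v}"
    using proto_sides_cross[OF f(2) d(1,2)] d(3,4) assms(4) by blast
  then have "f ` (convex hull d \<inter> convex hull d') \<subseteq> {f v}" by blast
  then have "convex hull e \<inter> convex hull e' \<subseteq> {f v}"
    by (simp only: d(3,4) isometry_hull[OF f(1), symmetric] image_Int[OF isometry_inj[OF f(1)]])
  then show ?thesis by blast
qed

lemma tile_side_ends: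
  assumes "tile_copy t" "e \<in> sides t"
  obtains x y where "e = {x, y}" "x \<noteq> y"
proof -
  obtain f p where f: "isometry f" "p \<in> {proto_triangle, proto_rhombus}" "t = map_tile f p"
    using assms(1) by (rule tile_copyE)
  obtain d where d: "d \<in> sides p" "e = f ` d" using assms(2) f(3) by auto
  have "\<exists>x y. d = {x, y} \<and> x \<noteq> y"
  proof -
    have ends: "\<exists>x y. {a, b} = {x, y} \<and> x \<noteq> y" if "a \<noteq> b" for a b :: complex
      using that by blast
    show ?thesis
      using d(1) f(2) unfolding proto_triangle_def proto_rhombus_def triangle_def rhombus_def
      by (elim insertE emptyE; simp; elim disjE; simp only:; intro ends; simp)
  qed
  then show thesis using that d(2) isometry_inj[OF f(1)] by (force simp: inj_eq)
qed

lemma side_region: "e \<in> sides t \<Longrightarrow> convex hull e \<subseteq> region t"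
  unfolding region_def corners_def by (intro hull_mono) blast

text \<open>The overlap lies in the common face of the two tiles. If that face is a side, it differs
  from \<open>e\<close> or from \<open>e'\<close>, and the comparison takes place inside a single
  tile.\<close>

lemma patch_sides_cross:
  assumes "patch P" "s \<in> P" "t \<in> P" "e \<in> sides s" "e' \<in> sides t" "e \<noteq> e'"
  shows "\<exists>v. convex hull e \<inter> convex hull e' \<subseteq> {v}"
proof (cases "s = t")
  case True
  then show ?thesis using assms by (intro tile_sides_cross[of s]) (auto simp: patch_def)
next
  case False
  then have "meets s t" using assms by (auto simp: patch_def)
  then obtain E where E: "joint s t E" "region s \<inter> region t \<subseteq> convex hull E"
    by (auto simp: meets_def)
  have sub: "convex hull e \<inter> convex hull e' \<subseteq> convex hull E"
    using E(2) side_region[OF assms(4)] side_region[OF assms(5)] by blast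
  consider "E = {}" | v where "E = {v}"
    | x y where "E = {x, y}" "(x, y) \<in> flow s" "(x, y) \<in> flow t"
    using E(1) unfolding joint_def by blast
  then show ?thesis
  proof cases
    case (3 x y)
    then have E: "E \<in> sides s" "E \<in> sides t" by (auto dest: flow_sides)
    show ?thesis
    proof (cases "e = E")
      case True
      then show ?thesis
        using tile_sides_cross[of t E e'] assms E(2) by (auto simp: patch_def)
    next
      case False
      then have "\<exists>v. convex hull e \<inter> convex hull E \<subseteq> {v}"
        using tile_sides_cross[of s e E] assms E(1) by (auto simp: patch_def)
      then show ?thesis using sub by blast
    qed
  qed (use sub in auto)
qed

lemma parallel_1_real:
  assumes "parallel_to {x, y} (Complex 1 0)" shows "(y - x) ^ 4 \<in> \<real>"
proof -
  from assms obtain p r s where "x = p + r *\<^sub>R Complex 1 0" "y = p + s *\<^sub>R Complex 1 0"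
    by (auto simp: parallel_to_def line_def)
  then have "y - x = of_real (s - r)" by (simp add: complex_eq_iff)
  then show ?thesis by (simp only: Reals_power Reals_of_real)
qed

text \<open>Contact concerns two tiles at a time and can be read off in a finite patch. For the
  direction of one tile, the finite set also contains \<open>t0\<close>, whose horizontal side turns
  into the test vector of \<open>octal_map\<close>.\<close>

lemma ammann_beenker_patch:
  assumes T: "ammann_beenker_tiling T" and "t0 \<in> T" "s \<in> sides t0" "parallel_to s (Complex 1 0)"
  shows "patch T"
proof -
  have patches: "\<exists>f P. isometry f \<and> patch P \<and> F \<subseteq> map_tile f ` P"
    if "finite F" "F \<subseteq> T" for F
    using T that patch_iterate unfolding ammann_beenker_tiling_def by meson
  have "tile_copy t" if "t \<in> T" for t
    using T that by (auto simp: ammann_beenker_tiling_def tiling_def tile_copy_def)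
  moreover have "octal t" if t: "t \<in> T" for t
  proof -
    obtain f P where f: "isometry f" "patch P" "{t0, t} \<subseteq> map_tile f ` P"
      using patches[of "{t0, t}"] t assms(2) by blast
    then obtain t0' t' where t': "t0 = map_tile f t0'" "t = map_tile f t'" "t0' \<in> P" "t' \<in> P"
      by auto
    then have oct: "octal t0'" "octal t'" "tile_copy t0'" using f(2) by (auto simp: patch_def)
    obtain e where e: "e \<in> sides t0'" "s = f ` e" using assms(3) t'(1) by auto
    obtain x y where xy: "e = {x, y}" "x \<noteq> y" using tile_side_ends[OF oct(3) e(1)] .
    have "(y - x) ^ 4 \<in> \<real>" using oct(1) e(1) xy(1) by (simp add: octal_def)
    moreover have "(f y - f x) ^ 4 \<in> \<real>" using assms(4) e(2) xy(1) parallel_1_real by simp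
    ultimately show ?thesis using octal_map[OF f(1) xy(2)] oct(2) t'(2) by simp
  qed
  moreover have "meets s t" if st: "s \<in> T" "t \<in> T" "s \<noteq> t" for s t
  proof -
    obtain f P where f: "isometry f" "patch P" "{s, t} \<subseteq> map_tile f ` P"
      using patches[of "{s, t}"] st by blast
    then obtain s' t' where "s = map_tile f s'" "t = map_tile f t'" "s' \<in> P" "t' \<in> P" by auto
    moreover from this have "meets s' t'" using f(2) st(3) unfolding patch_def by metis
    ultimately show ?thesis using meets_map[OF f(1), of s' t'] by simp
  qed
  ultimately show ?thesis by (simp add: patch_def)
qed

section \<open>Local finiteness\<close>

lemma tile_disc:
  assumes "tile_copy t"
  shows "\<exists>z. ball z (1 / 10) \<subseteq> region t \<and> region t \<subseteq> cball z 2"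
proof -
  obtain f p where f: "isometry f" "p \<in> {proto_triangle, proto_rhombus}" "t = map_tile f p"
    using assms by (rule tile_copyE)
  \<comment> \<open>The square of half-width 1/10 around this point lies in both prototiles, and
    their corners have distance at most 2 from it.\<close>
  let ?z = "Complex (7 / 10) (2 / 10)"
  have in_p: "ball ?z (1 / 10) \<subseteq> region p"
  proof
    fix w assume "w \<in> ball ?z (1 / 10)"
    then have "cmod (?z - w) < 1 / 10" by (simp add: dist_norm)
    then have "\<bar>Re (?z - w)\<bar> < 1 / 10" "\<bar>Im (?z - w)\<bar> < 1 / 10"
      using abs_Re_le_cmod[of "?z - w"] abs_Im_le_cmod[of "?z - w"] by linarith+
    then have "6 / 10 < Re w" "Re w < 8 / 10" "1 / 10 < Im w" "Im w < 3 / 10"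
      unfolding abs_less_iff by simp_all
    then have "Complex (Re w) (Im w) \<in> region proto_triangle"
      "Complex (Re w) (Im w) \<in> region proto_rhombus"
      using sqrt2_bounds by (intro proto_triangle_region proto_rhombus_region; simp)+
    then show "w \<in> region p" using f(2) by auto
  qed
  have "Complex x y \<in> cball ?z 2" if "0 \<le> x" "x \<le> 7 / 4" "0 \<le> y" "y \<le> 1" for x y
  proof -
    have "cmod (?z - Complex x y) \<le> \<bar>7 / 10 - x\<bar> + \<bar>2 / 10 - y\<bar>"
      using cmod_le[of "?z - Complex x y"] by simp
    also have "\<dots> \<le> 2" using that by linarith
    finally show ?thesis by (simp add: dist_norm)
  qed
  then have "corners p \<subseteq> cball ?z 2"
    using f(2) sqrt2_bounds by (auto simp: proto_triangle_def proto_rhombus_def simp del: mem_cball)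
  then have out_p: "region p \<subseteq> cball ?z 2"
    unfolding region_def by (rule hull_minimal) simp
  have im: "f ` ball ?z r = ball (f ?z) r" "f ` cball ?z r = cball (f ?z) r" for r
  proof -
    have "w \<in> f ` ball ?z r \<longleftrightarrow> w \<in> ball (f ?z) r" "w \<in> f ` cball ?z r \<longleftrightarrow> w \<in> cball (f ?z) r" for w
    proof -
      obtain u where "w = f u" using isometry_surj[OF f(1)] by (metis surjD)
      then show "w \<in> f ` ball ?z r \<longleftrightarrow> w \<in> ball (f ?z) r" "w \<in> f ` cball ?z r \<longleftrightarrow> w \<in> cball (f ?z) r"
        using isometry_inj[OF f(1)] isometry_dist[OF f(1)] by (simp_all add: inj_image_mem_iff)
    qed
    then show "f ` ball ?z r = ball (f ?z) r" "f ` cball ?z r = cball (f ?z) r" by blast+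
  qed
  show ?thesis
    using image_mono[OF in_p, of f] image_mono[OF out_p, of f] unfolding im
    by (intro exI[of _ "f ?z"]) (simp add: f(3) region_map[OF f(1)])
qed

text \<open>Inscribed discs of fixed radius are disjoint, which keeps the chosen centres apart; a
  bounded, uniformly discrete set is finite.\<close>

lemma tiling_locally_finite:
  assumes "tiling T" shows "finite {t \<in> T. region t \<inter> cball 0 R \<noteq> {}}" (is "finite ?F")
proof -
  have "\<forall>t\<in>T. \<exists>z. ball z (1 / 10) \<subseteq> region t \<and> region t \<subseteq> cball z 2"
    using assms tile_disc by (auto simp: tiling_def tile_copy_def)
  then obtain z where z: "\<And>t. t \<in> T \<Longrightarrow> ball (z t) (1 / 10) \<subseteq> region t"
      "\<And>t. t \<in> T \<Longrightarrow> region t \<subseteq> cball (z t) 2" by metis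
  have sep: "1 / 10 \<le> dist (z s) (z t)" if "s \<in> T" "t \<in> T" "s \<noteq> t" for s t
  proof (rule ccontr)
    assume "\<not> 1 / 10 \<le> dist (z s) (z t)"
    then have "z t \<in> ball (z s) (1 / 10) \<inter> ball (z t) (1 / 10)" by simp
    moreover have "ball (z s) (1 / 10) \<subseteq> interior (region s)"
      "ball (z t) (1 / 10) \<subseteq> interior (region t)"
      using z(1) that by (intro interior_maximal; simp)+
    ultimately show False using assms that unfolding tiling_def by blast
  qed
  have "uniform_discrete (z ` ?F)"
    using sep by (intro uniformI2[of "1 / 10"]) auto
  moreover have "bounded (z ` ?F)"
  proof (rule boundedI)
    fix y assume "y \<in> z ` ?F"
    then obtain t where "t \<in> ?F" "y = z t" by blast
    then obtain x where t: "t \<in> T" "y = z t" "x \<in> region t" "norm x \<le> R" by auto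
    then have "dist y x \<le> 2" using z(2)[OF t(1)] by auto
    then show "norm y \<le> R + 2" using t(4) norm_triangle_sub[of y x] by (simp add: dist_norm)
  qed
  ultimately have "finite (z ` ?F)" by (simp flip: uniform_discrete_finite_iff)
  moreover have "inj_on z ?F" using sep by (fastforce intro: inj_onI)
  ultimately show ?thesis by (rule finite_imageD)
qed

section \<open>Segments on a line\<close>

lemma line_inj:
  assumes "x \<in> line p u" "y \<in> line p u" "u \<noteq> 0" "x \<bullet> u = y \<bullet> u"
  shows "x = y"
  using assms by (auto simp: line_def inner_add_left)

lemma line_shift:
  assumes "x \<in> line p u" shows "line x u = line p u"
proof -
  obtain r where x: "x = p + r *\<^sub>R u" using assms by (auto simp: line_def)
  have sub: "line (q + r *\<^sub>R u) u \<subseteq> line q u" for q r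
  proof
    fix z assume "z \<in> line (q + r *\<^sub>R u) u"
    then obtain s where "z = q + r *\<^sub>R u + s *\<^sub>R u" by (auto simp: line_def)
    then have "z = q + (r + s) *\<^sub>R u" by (simp add: scaleR_add_left)
    then show "z \<in> line q u" unfolding line_def by blast
  qed
  have "p = x + (- r) *\<^sub>R u" by (simp add: x)
  then show ?thesis using sub[of p r] sub[of x "- r"] x by auto
qed

lemma line_between:
  assumes "a \<in> line p u" "b \<in> line p u" "z \<in> line p u"
    and "a \<bullet> u \<le> z \<bullet> u" "z \<bullet> u \<le> b \<bullet> u" and u: "u \<noteq> 0"
  shows "z \<in> convex hull {a, b}"
proof -
  obtain ra rb rz where r: "a = p + ra *\<^sub>R u" "b = p + rb *\<^sub>R u" "z = p + rz *\<^sub>R u"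
    using assms(1-3) by (auto simp: line_def)
  have le: "ra \<le> rz" "rz \<le> rb" using assms(4,5) u by (simp_all add: r inner_add_left)
  show ?thesis
  proof (cases "ra = rb")
    case True
    then have "z = a" using le r by simp
    then show ?thesis by (simp add: hull_inc)
  next
    case False
    define s where "s = (rz - ra) / (rb - ra)"
    have "0 \<le> s" "s \<le> 1" using le False by (simp_all add: s_def)
    moreover have "rz = ra + s * (rb - ra)" using False by (simp add: s_def)
    then have "z = p + (ra + s * (rb - ra)) *\<^sub>R u" by (simp only: r(3))
    then have "z = (1 - s) *\<^sub>R a + s *\<^sub>R b" by (simp add: r(1,2) algebra_simps)
    ultimately show ?thesis unfolding segment_convex_hull[symmetric] closed_segment_def by blast
  qed
qed

lemma line_slab_bounded:
  assumes "u \<noteq> 0" shows "bounded {x \<in> line p u. a \<le> x \<bullet> u \<and> x \<bullet> u \<le> b}"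
proof -
  define q where "q t = p + ((t - p \<bullet> u) / (u \<bullet> u)) *\<^sub>R u" for t
  have q: "q t \<in> line p u" "q t \<bullet> u = t" for t
    using assms by (auto simp: q_def line_def inner_add_left)
  have "{x \<in> line p u. a \<le> x \<bullet> u \<and> x \<bullet> u \<le> b} \<subseteq> convex hull {q a, q b}"
    using line_between[OF q(1) q(1)] q(2) assms by auto
  then show ?thesis
    by (rule bounded_subset[rotated]) (simp add: finite_imp_bounded bounded_convex_hull)
qed

lemma parallel_toD:
  assumes "parallel_to {x, y} u" obtains r where "y - x = r *\<^sub>R u"
proof -
  from assms obtain p r s where "x = p + r *\<^sub>R u" "y = p + s *\<^sub>R u"
    by (auto simp: parallel_to_def line_def)
  then have "y - x = (s - r) *\<^sub>R u" by (simp add: algebra_simps)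
  then show thesis by (rule that)
qed

text \<open>A real key for the order of edges on a line; alternation then becomes parity of a count
  in a set of reals.\<close>

definition lower_end :: "complex \<Rightarrow> complex set \<Rightarrow> real" where
  "lower_end u e = Min ((\<lambda>x. x \<bullet> u) ` e)"

text \<open>Counting from \<open>0\<close> in both directions, with half-open intervals that make the parity
  alternate across \<open>0\<close> as well.\<close>

definition slab :: "real set \<Rightarrow> real \<Rightarrow> nat" where
  "slab M x = card (M \<inter> (if 0 \<le> x then {0<..x} else {x<..0}))"

text \<open>On either side of 0 the two counts differ by one. Intervals contain only their upper
  end, so the counts are 0 and 1 for \<open>x < 0 < y\<close>, and 1 and 0 for
  \<open>x < 0 = y\<close>.\<close>

lemma slab_alternates:
  assumes fin: "\<And>a b. finite (M \<inter> {a..b})" and "x \<in> M" "y \<in> M" "x < y"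
    and gap: "\<And>z. z \<in> M \<Longrightarrow> x < z \<Longrightarrow> y \<le> z"
  shows "slab M x mod 2 \<noteq> slab M y mod 2"
proof -
  have fin': "finite (M \<inter> {a<..b})" for a b
    using fin[of a b] by (rule rev_finite_subset) auto
  consider "0 \<le> x" | "y < 0" | "x < 0" "y = 0" | "x < 0" "0 < y" by linarith
  then show ?thesis
  proof cases
    case 1
    then have "M \<inter> {0<..y} = insert y (M \<inter> {0<..x})" using assms by force
    then have "slab M y = Suc (slab M x)"
      using 1 assms(4) fin'[of 0 x] by (simp add: slab_def)
    then show ?thesis by presburger
  next
    case 2
    then have "M \<inter> {x<..0} = insert y (M \<inter> {y<..0})" using assms by force
    then have "slab M x = Suc (slab M y)"
      using 2 assms(4) fin'[of y 0] by (simp add: slab_def)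
    then show ?thesis by presburger
  next
    case 3
    then have "M \<inter> {x<..0} = {0}" using assms by force
    then show ?thesis using 3 by (simp add: slab_def)
  next
    case 4
    then have "M \<inter> {x<..0} = {}" "M \<inter> {0<..y} = {y}" using assms by force+
    then show ?thesis using 4 by (simp add: slab_def)
  qed
qed

lemma directional_alternatingD:
  assumes "directional_alternating us G c"
  shows "0 \<notin> set us"
    and "e \<in> snd G \<Longrightarrow> \<exists>u\<in>set us. parallel_to e u"
    and "j < length us \<Longrightarrow> e \<in> edges_on G (line p (us ! j)) \<Longrightarrow> c e \<in> {2 * j, 2 * j + 1}"
    and "j < length us \<Longrightarrow> consecutive_on G (line p (us ! j)) (us ! j) d e \<Longrightarrow> c d \<noteq> c e"
proof -
  note D = assms[unfolded directional_alternating_def Let_def]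
  note lines = D[THEN conjunct2, THEN conjunct2, THEN conjunct2, THEN spec, THEN mp, THEN spec]
  show "0 \<notin> set us" by (rule D[THEN conjunct1])
  show "e \<in> snd G \<Longrightarrow> \<exists>u\<in>set us. parallel_to e u"
    by (rule D[THEN conjunct2, THEN conjunct2, THEN conjunct1, THEN bspec])
  show "j < length us \<Longrightarrow> e \<in> edges_on G (line p (us ! j)) \<Longrightarrow> c e \<in> {2 * j, 2 * j + 1}"
    by (rule lines[THEN conjunct1, THEN bspec])
  show "j < length us \<Longrightarrow> consecutive_on G (line p (us ! j)) (us ! j) d e \<Longrightarrow> c d \<noteq> c e"
    by (rule lines[THEN conjunct2, THEN spec, THEN spec, THEN mp])
qed

text \<open>The properties of the tiling graph on which the colouring argument rests: edges are
  nondegenerate, do not overlap and are locally finite.\<close>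

locale segments =
  fixes V :: "complex set" and E :: "complex set set"
  assumes ends: "e \<in> E \<Longrightarrow> \<exists>x y. e = {x, y} \<and> x \<noteq> y"
    and cross: "e \<in> E \<Longrightarrow> e' \<in> E \<Longrightarrow> e \<noteq> e' \<Longrightarrow> \<exists>v. convex hull e \<inter> convex hull e' \<subseteq> {v}"
    and locally_finite: "finite {e \<in> E. e \<inter> cball 0 R \<noteq> {}}"
begin

lemma ends_on_line:
  assumes "e \<in> E" "e \<subseteq> line p u" "u \<noteq> 0"
  obtains a b where "e = {a, b}" "a \<bullet> u < b \<bullet> u"
proof -
  obtain x y where xy: "e = {x, y}" "x \<noteq> y" using ends[OF assms(1)] by blast
  then have "x \<bullet> u \<noteq> y \<bullet> u" using line_inj[of x p u y] assms(2,3) by auto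
  then consider "x \<bullet> u < y \<bullet> u" | "y \<bullet> u < x \<bullet> u" by linarith
  then show thesis using that xy(1) by cases (auto simp: insert_commute)
qed

lemma line_order:
  assumes e: "e \<in> E" "e \<subseteq> line p u" and d: "d \<in> E" "d \<subseteq> line p u" and "e \<noteq> d" and u: "u \<noteq> 0"
  shows "precedes u e d \<or> precedes u d e"
proof -
  obtain a b where ab: "e = {a, b}" "a \<bullet> u < b \<bullet> u" using ends_on_line[OF e u] .
  obtain a' b' where ab': "d = {a', b'}" "a' \<bullet> u < b' \<bullet> u" using ends_on_line[OF d u] .
  have "b \<bullet> u \<le> a' \<bullet> u \<or> b' \<bullet> u \<le> a \<bullet> u"
  proof (rule ccontr)
    assume no: "\<not> (b \<bullet> u \<le> a' \<bullet> u \<or> b' \<bullet> u \<le> a \<bullet> u)"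
    \<comment> \<open>The larger of the lower ends and the smaller of the upper ends. If the
      segments overlapped, both points would be common to the two hulls, contradicting
      \<open>cross\<close>.\<close>
    define lo where "lo = (if a \<bullet> u \<le> a' \<bullet> u then a' else a)"
    define hi where "hi = (if b \<bullet> u \<le> b' \<bullet> u then b else b')"
    have l: "a \<in> line p u" "b \<in> line p u" "a' \<in> line p u" "b' \<in> line p u"
      using e d ab ab' by auto
    then have l': "lo \<in> line p u" "hi \<in> line p u" by (simp_all add: lo_def hi_def)
    have lt: "lo \<bullet> u < hi \<bullet> u" using no ab(2) ab'(2) by (simp add: lo_def hi_def)
    have "a \<bullet> u \<le> lo \<bullet> u" "a' \<bullet> u \<le> lo \<bullet> u" "hi \<bullet> u \<le> b \<bullet> u" "hi \<bullet> u \<le> b' \<bullet> u"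
      by (simp_all add: lo_def hi_def)
    then have "lo \<in> convex hull e \<inter> convex hull d" "hi \<in> convex hull e \<inter> convex hull d"
      using lt l l' u by (auto simp: ab(1) ab'(1) intro!: line_between[of _ p u])
    then have "lo = hi" using cross[OF e(1) d(1) \<open>e \<noteq> d\<close>] by blast
    then show False using lt by simp
  qed
  then show ?thesis using ab ab' \<open>e \<noteq> d\<close> by (auto simp: precedes_def)
qed

lemma precedes_lower_end:
  assumes e: "e \<in> E" "e \<subseteq> line p u" and d: "d \<in> E" "d \<subseteq> line p u" and u: "u \<noteq> 0"
  shows "precedes u e d \<longleftrightarrow> lower_end u e < lower_end u d"
proof -
  have imp: "lower_end u e < lower_end u d"
    if e: "e \<in> E" "e \<subseteq> line p u" and d: "d \<in> E" "d \<subseteq> line p u" and "precedes u e d" for e d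
  proof -
    obtain a b where ab: "e = {a, b}" "a \<bullet> u < b \<bullet> u" using ends_on_line[OF e u] .
    obtain a' b' where ab': "d = {a', b'}" "a' \<bullet> u < b' \<bullet> u" using ends_on_line[OF d u] .
    have "b \<bullet> u \<le> a' \<bullet> u" using \<open>precedes u e d\<close> ab(1) ab'(1) by (auto simp: precedes_def)
    then show ?thesis using ab ab' by (simp add: lower_end_def)
  qed
  show ?thesis
  proof
    assume "lower_end u e < lower_end u d"
    then show "precedes u e d"
      using line_order[OF e d _ u] imp[OF d e] by fastforce
  qed (rule imp[OF e d])
qed

text \<open>A part of the line with bounded coordinate lies in a ball, so local finiteness in the
  plane passes to the keys. It makes the counts of \<open>slab\<close> finite.\<close>

lemma lower_ends_finite:
  assumes "u \<noteq> 0"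
  shows "finite (lower_end u ` edges_on (V, E) (line p u) \<inter> {a..b})"
proof -
  obtain R where R: "{x \<in> line p u. a \<le> x \<bullet> u \<and> x \<bullet> u \<le> b} \<subseteq> cball 0 R"
    using line_slab_bounded[OF assms, of p a b] unfolding bounded_iff by (auto simp: subset_iff)
  have "lower_end u ` edges_on (V, E) (line p u) \<inter> {a..b}
     \<subseteq> lower_end u ` {e \<in> E. e \<inter> cball 0 R \<noteq> {}}"
  proof
    fix r assume "r \<in> lower_end u ` edges_on (V, E) (line p u) \<inter> {a..b}"
    then obtain e where e: "e \<in> E" "e \<subseteq> line p u" "r = lower_end u e" "a \<le> r" "r \<le> b"
      by (auto simp: edges_on_def)
    obtain x y where xy: "e = {x, y}" "x \<bullet> u < y \<bullet> u" using ends_on_line[OF e(1,2) assms] .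
    then have "r = x \<bullet> u" by (simp add: e(3) lower_end_def)
    then have "x \<in> cball 0 R" using R e xy by auto
    then show "r \<in> lower_end u ` {e \<in> E. e \<inter> cball 0 R \<noteq> {}}" using e xy by auto
  qed
  then show ?thesis by (rule finite_subset) (rule finite_imageI[OF locally_finite])
qed

lemma parallel_unique:
  assumes "e \<in> E" "parallel_to e u" "parallel_to e v" "u \<noteq> 0" "v \<noteq> 0"
  shows "collinear {0, u, v}"
proof -
  obtain x y where xy: "e = {x, y}" "x \<noteq> y" using ends[OF assms(1)] by blast
  obtain r where r: "y - x = r *\<^sub>R u" using parallel_toD assms(2) xy(1) by metis
  obtain s where s: "y - x = s *\<^sub>R v" using parallel_toD assms(3) xy(1) by metis
  have "s \<noteq> 0" using s xy(2) by auto
  then have "v = (r / s) *\<^sub>R u" using r s by (metis divideR_right mult.commute divide_inverse scaleR_scaleR)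
  then show ?thesis by (auto simp: collinear_lemma)
qed

text \<open>The colour is the parity of the rank of the lower end on the line, counted from
  coordinate 0, plus an offset for the direction. No first edge on the line is required.\<close>

lemma alternating_exists:
  assumes nz: "0 \<notin> set us"
    and indep: "\<forall>i<length us. \<forall>j<length us. i \<noteq> j \<longrightarrow> \<not> collinear {0, us ! i, us ! j}"
    and par: "\<forall>e\<in>E. \<exists>u\<in>set us. parallel_to e u"
  shows "\<exists>c. directional_alternating us (V, E) c"
proof -
  define dir where "dir e = (SOME j. j < length us \<and> parallel_to e (us ! j))" for e
  \<comment> \<open>This depends on \<open>x\<close> only through its line, so any point of an edge
    may represent the line in the definition of the colouring.\<close>
  define M where "M u x = lower_end u ` edges_on (V, E) (line x u)" for u x
  define c where "c e = 2 * dir e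
      + slab (M (us ! dir e) (SOME x. x \<in> e)) (lower_end (us ! dir e) e) mod 2" for e
  have nz': "us ! j \<noteq> 0" if "j < length us" for j using nz that nth_mem by metis
  have c: "c e = 2 * j + slab (M (us ! j) p) (lower_end (us ! j) e) mod 2"
    if "j < length us" "e \<in> edges_on (V, E) (line p (us ! j))" for e j p
  proof -
    have e: "e \<in> E" "e \<subseteq> line p (us ! j)" using that(2) by (auto simp: edges_on_def)
    then have pj: "parallel_to e (us ! j)" by (auto simp: parallel_to_def)
    have "dir e < length us \<and> parallel_to e (us ! dir e)"
      unfolding dir_def by (rule someI[of _ j]) (use that(1) pj in simp)
    then have d: "dir e = j"
      using parallel_unique[OF e(1)] pj indep nz' that(1) by blast
    have "e \<noteq> {}" using ends[OF e(1)] by auto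
    then have "(SOME x. x \<in> e) \<in> e" by (rule some_in_eq[THEN iffD2])
    then have "line (SOME x. x \<in> e) (us ! j) = line p (us ! j)" using e(2) line_shift by blast
    then show ?thesis by (simp add: c_def d M_def)
  qed
  have alt: "c e \<noteq> c e'"
    if j: "j < length us" and con: "consecutive_on (V, E) (line p (us ! j)) (us ! j) e e'" for j p e e'
  proof -
    let ?u = "us ! j"
    have e: "e \<in> edges_on (V, E) (line p ?u)" "e' \<in> edges_on (V, E) (line p ?u)"
      "precedes ?u e e'" using con by (auto simp: consecutive_on_def)
    note pl = precedes_lower_end[OF _ _ _ _ nz'[OF j], of _ p]
    have "slab (M ?u p) (lower_end ?u e) mod 2 \<noteq> slab (M ?u p) (lower_end ?u e') mod 2"
    proof (rule slab_alternates)
      show "lower_end ?u e < lower_end ?u e'" using e pl by (auto simp: edges_on_def)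
      show "finite (M ?u p \<inter> {a..b})" for a b
        unfolding M_def by (rule lower_ends_finite[OF nz'[OF j]])
      show "lower_end ?u e' \<le> z" if z: "z \<in> M ?u p" "lower_end ?u e < z" for z
      proof (rule ccontr)
        assume "\<not> lower_end ?u e' \<le> z"
        moreover obtain d where d: "d \<in> edges_on (V, E) (line p ?u)" "z = lower_end ?u d"
          using z(1) by (auto simp: M_def)
        ultimately have "precedes ?u e d" "precedes ?u d e'"
          using pl e d z(2) by (auto simp: edges_on_def)
        then show False using con d(1) by (auto simp: consecutive_on_def)
      qed
    qed (use e in \<open>auto simp: M_def\<close>)
    then show ?thesis using c[OF j e(1)] c[OF j e(2)] by simp
  qed
  have "directional_alternating us (V, E) c"
    unfolding directional_alternating_def Let_def
  proof (intro conjI nz indep)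
    show "\<forall>e\<in>snd (V, E). \<exists>u\<in>set us. parallel_to e u" using par by simp
    show "\<forall>j<length us. \<forall>p. (\<forall>e\<in>edges_on (V, E) (line p (us ! j)). c e \<in> {2 * j, 2 * j + 1}) \<and>
        (\<forall>e e'. consecutive_on (V, E) (line p (us ! j)) (us ! j) e e' \<longrightarrow> c e \<noteq> c e')"
    proof (intro allI impI conjI ballI)
      fix j p e assume "j < length us" "e \<in> edges_on (V, E) (line p (us ! j))"
      then show "c e \<in> {2 * j, 2 * j + 1}" using c[of j e p] by auto
    qed (rule alt)
  qed
  then show ?thesis by blast
qed

text \<open>Different directions have disjoint colour pairs, so only edges on one line through the
  common vertex \<open>v\<close> matter. An edge between them would have both ends at the coordinate
  of \<open>v\<close>, hence length 0.\<close>

lemma alternating_proper: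
  assumes c: "directional_alternating us (V, E) c"
  shows "proper_edge_colouring (V, E) (2 * length us) c"
proof -
  \<comment> \<open>The line of an edge is based at the given end \<open>v\<close>, so that for two
    edges at \<open>v\<close> equal directions already mean equal lines.\<close>
  have dir: "\<exists>j<length us. e \<in> edges_on (V, E) (line v (us ! j))" if e: "e \<in> E" and v: "v \<in> e" for e v
  proof -
    obtain u p where u: "u \<in> set us" "e \<subseteq> line p u"
      using directional_alternatingD(2)[OF c, of e] e unfolding parallel_to_def by auto
    then have "line v u = line p u" using v line_shift by blast
    then show ?thesis using u e by (auto simp: edges_on_def in_set_conv_nth)
  qed
  have col: "c e \<in> {2 * j, 2 * j + 1}" if "j < length us" "e \<in> edges_on (V, E) (line p (us ! j))" for e j p
    using directional_alternatingD(3)[OF c that] .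
  have "c e < 2 * length us" if e: "e \<in> E" for e
  proof -
    obtain v where "v \<in> e" using ends[OF e] by auto
    then obtain j where "j < length us" "e \<in> edges_on (V, E) (line v (us ! j))" using dir e by blast
    then show ?thesis using col[of j e v] by auto
  qed
  moreover have "c e \<noteq> c d" if ed: "e \<in> E" "d \<in> E" "e \<noteq> d" "e \<inter> d \<noteq> {}" for e d
  proof -
    obtain v where v: "v \<in> e" "v \<in> d" using ed(4) by blast
    obtain j where j: "j < length us" "e \<in> edges_on (V, E) (line v (us ! j))"
      using dir[OF ed(1) v(1)] by blast
    obtain k where k: "k < length us" "d \<in> edges_on (V, E) (line v (us ! k))"
      using dir[OF ed(2) v(2)] by blast
    show ?thesis
    proof (cases "j = k")
      case False
      then show ?thesis using col[OF j] col[OF k] by auto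
    next
      case True
      let ?u = "us ! j"
      have u: "?u \<noteq> 0" using directional_alternatingD(1)[OF c] j(1) nth_mem by metis
      have on: "e \<subseteq> line v ?u" "d \<subseteq> line v ?u" using j(2) k(2) True by (auto simp: edges_on_def)
      have con: "consecutive_on (V, E) (line v ?u) ?u e d"
        if "precedes ?u e d" "e \<in> edges_on (V, E) (line v ?u)" "d \<in> edges_on (V, E) (line v ?u)"
          "v \<in> e" "v \<in> d" for e d
        unfolding consecutive_on_def
      proof (intro conjI that(1-3) notI)
        assume "\<exists>m\<in>edges_on (V, E) (line v ?u). precedes ?u e m \<and> precedes ?u m d"
        then obtain m where m: "m \<in> E" "m \<subseteq> line v ?u" "precedes ?u e m" "precedes ?u m d"
          by (auto simp: edges_on_def)
        obtain x y where xy: "m = {x, y}" "x \<bullet> ?u < y \<bullet> ?u" using ends_on_line[OF m(1,2) u] .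
        have "v \<bullet> ?u \<le> x \<bullet> ?u" "y \<bullet> ?u \<le> v \<bullet> ?u"
          using m(3,4) that(4,5) xy(1) by (auto simp: precedes_def)
        then show False using xy(2) by simp
      qed
      have "c e \<noteq> c d" if "consecutive_on (V, E) (line v ?u) ?u e d" for e d
        using directional_alternatingD(4)[OF c j(1) that] .
      then show ?thesis
        using line_order[OF ed(1) on(1) ed(2) on(2) ed(3) u] con[of e d] con[of d e] j(2) k(2) True v
        by metis
    qed
  qed
  ultimately show ?thesis by (auto simp: proper_edge_colouring_def)
qed

end

section \<open>A corner of degree eight\<close>

abbreviation zeta :: complex where
  "zeta \<equiv> Complex hs hs"

text \<open>For a unit \<open>a\<close>, the factor \<open>cnj a\<close> rotates \<open>a\<close> to
  the positive real axis. The set is the closed cone at \<open>v\<close> that extends from direction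
  \<open>a\<close> through 45 degrees counterclockwise.\<close>

definition sector :: "complex \<Rightarrow> complex \<Rightarrow> complex set" where
  "sector v a = {z. 0 \<le> Im ((z - v) * cnj a) \<and> Im ((z - v) * cnj a) \<le> Re ((z - v) * cnj a)}"

text \<open>Both bounding rays carry a side, of length 1 or sqrt 2 depending on the tile, so
  \<open>r\<close> is left open.\<close>

definition wedge :: "tile \<Rightarrow> complex \<Rightarrow> complex \<Rightarrow> bool" where
  "wedge t v a \<longleftrightarrow> cmod a = 1 \<and> region t \<subseteq> sector v a \<and>
     (\<exists>r>0. {v, v + r *\<^sub>R a} \<in> sides t) \<and> (\<exists>r>0. {v, v + r *\<^sub>R (a * zeta)} \<in> sides t)"

lemma convex_sector: "convex (sector v a)"
proof (rule convexI)
  fix x y and p q :: real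
  assume x: "x \<in> sector v a" and y: "y \<in> sector v a" and pq: "0 \<le> p" "0 \<le> q" "p + q = 1"
  have "(p *\<^sub>R x + q *\<^sub>R y - v) * cnj a = p *\<^sub>R ((x - v) * cnj a) + q *\<^sub>R ((y - v) * cnj a)"
  proof -
    have "v = (p + q) *\<^sub>R v" using pq by simp
    then have "p *\<^sub>R x + q *\<^sub>R y - v = p *\<^sub>R (x - v) + q *\<^sub>R (y - v)"
      by (simp add: algebra_simps)
    then show ?thesis by (simp add: distrib_right)
  qed
  moreover have "0 \<le> Im (p *\<^sub>R X + q *\<^sub>R Y) \<and> Im (p *\<^sub>R X + q *\<^sub>R Y) \<le> Re (p *\<^sub>R X + q *\<^sub>R Y)"
    if "0 \<le> Im X \<and> Im X \<le> Re X" "0 \<le> Im Y \<and> Im Y \<le> Re Y" for X Y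
    using that pq by (simp add: add_mono mult_left_mono)
  ultimately show "p *\<^sub>R x + q *\<^sub>R y \<in> sector v a"
    using x y by (simp only: sector_def mem_Collect_eq)
qed

lemma wedgeI:
  assumes "cmod a = 1" "corners t \<subseteq> sector v a"
    and "0 < r" "{v, v + r *\<^sub>R a} \<in> sides t" "0 < s" "{v, v + s *\<^sub>R (a * zeta)} \<in> sides t"
  shows "wedge t v a"
  using assms hull_minimal[of "corners t" "sector v a" convex] convex_sector
  unfolding wedge_def region_def by blast

lemma sides_triangle: "sides (triangle a b c) = {{a, b}, {b, c}, {c, a}}"
  by (simp add: triangle_def)

lemma sides_rhombus: "sides (rhombus a b c d) = {{a, b}, {b, c}, {c, d}, {d, a}}"
  by (simp add: rhombus_def)

lemma proto_wedge:
  assumes "p \<in> {proto_triangle, proto_rhombus}" "v \<in> sharp p"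
  shows "\<exists>a. wedge p v a"
proof -
  note sector = sides_triangle sides_rhombus sector_def doubleton_eq_iff complex_norm
    plus_complex.code times_complex.code complex_scaleR power_divide algebra_simps
  have t1: "wedge proto_triangle (Complex 0 0) (Complex 1 0)"
    unfolding proto_triangle_def
    by (rule wedgeI[where r = "sqrt 2" and s = "1"]) (simp_all add: sector)
  have t2: "wedge proto_triangle (Complex (sqrt 2) 0) (Complex (- hs) hs)"
    unfolding proto_triangle_def
    by (rule wedgeI[where r = "1" and s = "sqrt 2"]) (simp_all add: sector)
  have r1: "wedge proto_rhombus (Complex 0 0) (Complex 1 0)"
    unfolding proto_rhombus_def
    by (rule wedgeI[where r = "1" and s = "1"]) (simp_all add: sector)
  have r2: "wedge proto_rhombus (Complex (1 + hs) hs) (Complex (- 1) 0)"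
    unfolding proto_rhombus_def
    by (rule wedgeI[where r = "1" and s = "1"]) (simp_all add: sector)
  show ?thesis using assms t1 t2 r1 r2 by (auto simp: proto_triangle_flow proto_rhombus_flow)
qed

lemma unit_mult_cnj: "cmod b = 1 \<Longrightarrow> b * cnj b = 1"
  using complex_norm_square[of b] by simp

lemma wedge_map:
  assumes f: "isometry f" and w: "wedge t v a"
  shows "\<exists>a'. wedge (map_tile f t) (f v) a'"
proof -
  obtain r s where rs: "0 < r" "{v, v + r *\<^sub>R a} \<in> sides t" "0 < s"
      "{v, v + s *\<^sub>R (a * zeta)} \<in> sides t"
    and a: "cmod a = 1" "region t \<subseteq> sector v a"
    using w by (auto simp: wedge_def)
  have sides: "{f v, f (v + r *\<^sub>R a)} \<in> sides (map_tile f t)"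
    "{f v, f (v + s *\<^sub>R (a * zeta))} \<in> sides (map_tile f t)"
    using imageI[OF rs(2), of "(`) f"] imageI[OF rs(4), of "(`) f"] by simp_all
  from f show ?thesis
  proof (cases rule: isometry_cases)
    case (1 b c)
    have bb: "b * cnj b = 1" by (rule unit_mult_cnj[OF 1(1)])
    have mul: "(f z - f v) * cnj (b * a) = (z - v) * cnj a" for z
    proof -
      have "(f z - f v) * cnj (b * a) = (b * cnj b) * ((z - v) * cnj a)"
        unfolding 1(2) by (simp add: algebra_simps)
      then show ?thesis by (simp add: bb)
    qed
    have "f z \<in> sector (f v) (b * a)" if "z \<in> region t" for z
    proof -
      have "z \<in> sector v a" using a(2) that by blast
      then show ?thesis by (simp only: sector_def mem_Collect_eq mul)
    qed
    moreover have "f (v + x *\<^sub>R d) = f v + x *\<^sub>R (b * d)" for x d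
      unfolding 1(2) by (simp add: algebra_simps)
    ultimately have "wedge (map_tile f t) (f v) (b * a)"
      using sides rs 1(1) a(1) by (auto simp: wedge_def region_map[OF f] norm_mult mult.assoc)
    then show ?thesis by blast
  next
    case (2 b c)
    have bb: "b * cnj b = 1" by (rule unit_mult_cnj[OF 2(1)])
    have zz: "cnj zeta * zeta = 1" by (simp add: complex_eq_iff)
    \<comment> \<open>An opposite isometry reverses the sense of rotation, so the first ray of the
      image is the image of the second ray \<open>a * zeta\<close>.\<close>
    define a' where "a' = b * cnj a * cnj zeta"
    have mul: "(f z - f v) * cnj a' = cnj ((z - v) * cnj a) * zeta" for z
    proof -
      have "(f z - f v) * cnj a' = (b * cnj b) * (cnj ((z - v) * cnj a) * zeta)"
        unfolding 2(2) a'_def by (simp add: algebra_simps)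
      then show ?thesis by (simp add: bb)
    qed
    have "f z \<in> sector (f v) a'" if "z \<in> region t" for z
    proof -
      define q where "q = (z - v) * cnj a"
      have "0 \<le> Im q" "Im q \<le> Re q" using a(2) that by (auto simp: sector_def q_def)
      moreover have "Im (cnj q * zeta) = hs * (Re q - Im q)" "Re (cnj q * zeta) = hs * (Re q + Im q)"
        by (simp_all add: algebra_simps)
      ultimately show ?thesis unfolding sector_def mem_Collect_eq mul q_def[symmetric]
        by (simp add: mult_left_mono)
    qed
    moreover have "f (v + x *\<^sub>R d) = f v + x *\<^sub>R (b * cnj d)" for x d
      unfolding 2(2) by (simp add: algebra_simps)
    moreover have "a' * zeta = b * cnj a" "b * cnj (a * zeta) = a'"
      using zz by (simp_all add: a'_def mult.assoc)
    moreover have "cmod a' = 1" using 2(1) a(1) by (simp add: a'_def norm_mult complex_norm power_divide)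
    ultimately have "wedge (map_tile f t) (f v) a'"
      using sides rs by (auto simp: wedge_def region_map[OF f])
    then show ?thesis by blast
  qed
qed

lemma sharp_wedge:
  assumes "tile_copy t" "v \<in> sharp t" shows "\<exists>a. wedge t v a"
proof -
  obtain f p where f: "isometry f" "p \<in> {proto_triangle, proto_rhombus}" "t = map_tile f p"
    using assms(1) by (rule tile_copyE)
  then obtain v' where "v' \<in> sharp p" "v = f v'" using assms(2) sharp_map by auto
  then show ?thesis using proto_wedge[OF f(2)] wedge_map[OF f(1)] f(3) by blast
qed

text \<open>The number \<open>2 + \<i>\<close> lies in the interior of the sector of directions between \<open>1\<close> and
  \<open>zeta\<close>.\<close>

lemma bisector_unique:
  assumes "cmod g = 1" "g ^ 4 \<in> \<real>"
    and "0 \<le> Im (g * Complex 2 1)" "Im (g * Complex 2 1) \<le> Re (g * Complex 2 1)"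
  shows "g = 1"
proof (cases g)
  case (Complex x y)
  have n: "x\<^sup>2 + y\<^sup>2 = 1" using assms(1) by (simp add: Complex complex_norm)
  have le: "0 \<le> x + 2 * y" "3 * y \<le> x" using assms(3,4) by (simp_all add: Complex)
  from assms(2) consider "x = 0" | "y = 0" | "x = y" | "x = - y"
    by (auto simp: Complex pow4_real)
  \<comment> \<open>The direction 2 + i, at about 26.6 degrees, is turned by \<open>g\<close> within
    the octant. So the angle of \<open>g\<close> lies strictly between -45 and 45 degrees, and 0 is
    the only multiple of 45 there.\<close>
  then have "y = 0 \<and> 0 \<le> x"
    using le n by cases (auto simp: power2_eq_square)
  then have "x = 1" "y = 0" using n by (auto simp: power2_eq_1_iff)
  then show ?thesis by (simp add: Complex one_complex.code)
qed

lemma tile_finite: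
  assumes "tile_copy t" shows "finite (sides t)" "finite (corners t)" "corners t \<noteq> {}"
proof -
  obtain f p where f: "isometry f" "p \<in> {proto_triangle, proto_rhombus}" "t = map_tile f p"
    using assms by (rule tile_copyE)
  have "finite (sides p)" "finite (corners p)" "corners p \<noteq> {}"
    using f(2) by (auto simp: proto_triangle_def proto_rhombus_def)
      (auto simp: triangle_def rhombus_def)
  then show "finite (sides t)" "finite (corners t)" "corners t \<noteq> {}" by (simp_all add: f(3))
qed

lemma cmod_root_unity: "b ^ n = 1 \<Longrightarrow> 0 < n \<Longrightarrow> cmod b = 1"
  using power_eq_imp_eq_base[of "cmod b" n 1] by (simp flip: norm_power)

text \<open>A point near \<open>v\<close> just inside the octant that starts at \<open>b\<close>
  belongs to a tile with an acute corner at \<open>v\<close>. Its cone starts at a multiple of 45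
  degrees and contains the point, hence starts at \<open>b\<close>, where the tile has a
  side.\<close>

lemma all_directions:
  assumes T: "tiling T" "patch T" and v: "\<And>t. t \<in> T \<Longrightarrow> v \<in> region t \<Longrightarrow> v \<in> sharp t"
    and b: "b ^ 8 = 1"
  shows "\<exists>t\<in>T. \<exists>r>0. {v, v + r *\<^sub>R b} \<in> sides t"
proof -
  have nb: "cmod b = 1" by (rule cmod_root_unity[OF b]) simp
  \<comment> \<open>The nearby tiles that miss \<open>v\<close> form a finite union of closed sets,
    so a whole disc around \<open>v\<close> avoids them.\<close>
  define F where "F = {t \<in> T. region t \<inter> cball 0 (norm v + 1) \<noteq> {} \<and> v \<notin> region t}"
  have "finite F" unfolding F_def
    by (rule rev_finite_subset[OF tiling_locally_finite[OF T(1), of "norm v + 1"]]) auto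
  moreover have "closed (region t)" if "t \<in> T" for t
    unfolding region_def using T(2) that tile_finite(2)
    by (intro compact_imp_closed finite_imp_compact_convex_hull) (auto simp: patch_def)
  ultimately have "closed (\<Union>t\<in>F. region t)" by (intro closed_UN) (auto simp: F_def)
  moreover have "v \<notin> (\<Union>t\<in>F. region t)" by (auto simp: F_def)
  ultimately obtain d where "0 < d" "ball v d \<subseteq> - (\<Union>t\<in>F. region t)"
    using open_contains_ball[of "- (\<Union>t\<in>F. region t)"] open_Compl by blast
  then have d: "0 < d" "ball v d \<inter> (\<Union>t\<in>F. region t) = {}" by blast+
  \<comment> \<open>The divisor 4 makes up for the modulus of 2 + i, which is at most 3:
    \<open>z\<close> stays inside the disc of radius \<open>d\<close> and within distance 1.\<close>
  define e where "e = min d 1 / 4"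
  define z where "z = v + e *\<^sub>R (b * Complex 2 1)"
  have e: "0 < e" "4 * e \<le> d" "4 * e \<le> 1" using d(1) by (auto simp: e_def)
  have "cmod (Complex 2 1) \<le> 3" using cmod_le[of "Complex 2 1"] by simp
  then have "norm (z - v) \<le> 3 * e" using e(1) nb by (simp add: z_def norm_mult)
  then have zv: "norm (z - v) < d" "norm (z - v) \<le> 1" using e by simp_all
  have "z \<in> (\<Union>t\<in>T. region t)" using T(1) by (simp add: tiling_def)
  then obtain t where t: "t \<in> T" "z \<in> region t" by blast
  have "norm z \<le> norm v + 1" using zv(2) norm_triangle_sub[of z v] by simp
  moreover have "z \<in> ball v d" using zv(1) by (simp add: dist_norm norm_minus_commute)
  ultimately have "v \<in> region t" using t d(2) unfolding F_def by force
  then have "v \<in> sharp t" by (rule v[OF t(1)])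
  moreover have t': "tile_copy t" "octal t" using T(2) t(1) by (auto simp: patch_def)
  ultimately obtain a where a: "wedge t v a" using sharp_wedge by blast
  then obtain r where r: "0 < r" "{v, v + r *\<^sub>R a} \<in> sides t" by (auto simp: wedge_def)
  have na: "cmod a = 1" using a by (simp add: wedge_def)
  have "(r *\<^sub>R a) ^ 4 \<in> \<real>" using t'(2) r(2) by (force simp: octal_def)
  then have "(of_real (r ^ 4) * a ^ 4) / of_real (r ^ 4) \<in> \<real>"
    by (intro Reals_divide Reals_of_real) (simp add: scaleR_conv_of_real power_mult_distrib)
  then have a4: "a ^ 4 \<in> \<real>" using r(1) by simp
  define g where "g = b * cnj a"
  have "(b ^ 4)\<^sup>2 = 1" using b by (simp flip: power_mult)
  then have "b ^ 4 = 1 \<or> b ^ 4 = - 1" by (simp only: power2_eq_1_iff)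
  then have "b ^ 4 \<in> \<real>" by auto
  moreover have "cnj a ^ 4 \<in> \<real>" using a4 by (simp add: complex_is_Real_iff flip: complex_cnj_power)
  ultimately have "g ^ 4 \<in> \<real>" by (simp add: g_def power_mult_distrib Reals_mult)
  moreover have "cmod g = 1" using na nb by (simp add: g_def norm_mult)
  moreover have dir: "(z - v) * cnj a = e *\<^sub>R (g * Complex 2 1)"
    by (simp add: z_def g_def mult_ac)
  have "z \<in> sector v a" using a t(2) unfolding wedge_def by blast
  then have "0 \<le> e * Im (g * Complex 2 1) \<and> e * Im (g * Complex 2 1) \<le> e * Re (g * Complex 2 1)"
    by (simp only: sector_def mem_Collect_eq dir scaleR_complex.sel)
  then have "0 \<le> Im (g * Complex 2 1)" "Im (g * Complex 2 1) \<le> Re (g * Complex 2 1)"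
    using e(1) by (simp_all add: zero_le_mult_iff)
  ultimately have "g = 1" using bisector_unique by blast
  then have "b * (cnj a * a) = a" by (simp add: g_def flip: mult.assoc)
  moreover have "cnj a * a = 1" using unit_mult_cnj[OF na] by (simp add: mult.commute)
  ultimately have "b = a" by simp
  then show ?thesis using r t(1) by blast
qed

text \<open>Every other corner is joined by a side to one end of \<open>{x, y}\<close>; if it lay on
  the segment, two sides would share two points.\<close>

lemma corner_off_side:
  assumes "tile_copy t" "{x, y} \<in> sides t" "w \<in> corners t" "w \<in> convex hull {x, y}"
  shows "w \<in> {x, y}"
proof (rule ccontr)
  assume w: "w \<notin> {x, y}"
  obtain f p where f: "isometry f" "p \<in> {proto_triangle, proto_rhombus}" "t = map_tile f p"
    using assms(1) by (rule tile_copyE)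
  have "(\<exists>a b c. t = triangle a b c) \<or> (\<exists>a b c d. t = rhombus a b c d)"
    using f(2,3) unfolding proto_triangle_def proto_rhombus_def
    by (elim insertE emptyE; simp only: map_tile_triangle map_tile_rhombus; blast)
  then have "\<exists>z\<in>{x, y}. {w, z} \<in> sides t"
    using assms(2,3) w
    by (elim disjE exE) (auto simp: triangle_def rhombus_def corners_def doubleton_eq_iff)
  then obtain z where z: "z \<in> {x, y}" "{w, z} \<in> sides t" by blast
  have "{w, z} \<noteq> {x, y}" using w by blast
  then obtain v where "convex hull {w, z} \<inter> convex hull {x, y} \<subseteq> {v}"
    using tile_sides_cross[OF assms(1) z(2) assms(2)] by blast
  moreover have "{w, z} \<subseteq> convex hull {w, z} \<inter> convex hull {x, y}"
    using z(1) assms(4) by (auto intro: hull_inc)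
  ultimately show False using w z(1) by auto
qed

text \<open>The corner lies in the hull of the common face. When that face is a side of
  \<open>s\<close>, a corner of \<open>s\<close> on it must be one of its ends, and these are
  corners of \<open>t\<close>.\<close>

lemma patch_corner:
  assumes "patch P" "s \<in> P" "t \<in> P" "w \<in> corners s" "w \<in> region t"
  shows "w \<in> corners t"
proof (cases "s = t")
  case False
  then obtain E where E: "joint s t E" "region s \<inter> region t \<subseteq> convex hull E"
    using assms(1-3) unfolding patch_def meets_def by metis
  have w: "w \<in> convex hull E" using E(2) assms(4,5) corners_region by blast
  have s: "tile_copy s" using assms(1,2) by (auto simp: patch_def)
  from E(1) consider "E = {}" | x where "E = {x}"
    | x y where "E = {x, y}" "{x, y} \<in> sides s"
    unfolding joint_def using flow_sides by blast
  then have "w \<in> E"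
    using w corner_off_side[OF s _ assms(4)] by cases auto
  then show ?thesis using E(1) by (auto simp: joint_def)
qed (use assms in simp)

lemma tile_diameter:
  assumes "tile_copy t" "x \<in> region t" "y \<in> region t" shows "dist x y \<le> 4"
proof -
  obtain z where "region t \<subseteq> cball z 2" using tile_disc[OF assms(1)] by blast
  then have "dist x z \<le> 2" "dist y z \<le> 2" using assms(2,3) by (auto simp: dist_commute)
  then show ?thesis using dist_triangle2[of x y z] by linarith
qed

text \<open>The vertex is an expanded corner \<open>lam *\<^sub>R w\<close> of the parent of a tile
  at the origin. Any tile that contains it comes from a parent that contains \<open>w\<close>, hence
  has \<open>w\<close> as a corner, and so has an acute corner there.\<close>

lemma sharp_corner_exists:
  assumes T: "ammann_beenker_tiling T"
  shows "\<exists>v. \<forall>t\<in>T. v \<in> region t \<longrightarrow> v \<in> sharp t"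
proof -
  \<comment> \<open>Radius 20 has two uses: a single tile of diameter at most 4 cannot contain both
    0 and 20, which excludes \<open>n = 0\<close>; and an expanded corner of the parent at 0 is at
    distance at most 4 * 5/2 = 10.\<close>
  define F where "F = {t \<in> T. region t \<inter> cball 0 20 \<noteq> {}}"
  have til: "tiling T" using T by (simp add: ammann_beenker_tiling_def)
  have "finite F" unfolding F_def by (rule tiling_locally_finite[OF til])
  moreover have "F \<subseteq> T" by (auto simp: F_def)
  ultimately obtain n p f where p: "p \<in> {proto_triangle, proto_rhombus}" and f: "isometry f"
    and F: "F \<subseteq> map_tile f ` (substitute ^^ n) {p}"
    using T unfolding ammann_beenker_tiling_def by meson
  have cover: "\<exists>t\<in>F. z \<in> region t" if z: "z \<in> cball 0 20" for z
  proof -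
    have "z \<in> (\<Union>t\<in>T. region t)" using til by (simp add: tiling_def)
    then show ?thesis using z unfolding F_def by blast
  qed
  have "n \<noteq> 0"
  proof
    assume "n = 0"
    then have sub: "F \<subseteq> {map_tile f p}" using F by auto
    have "0 \<in> region (map_tile f p)" "20 \<in> region (map_tile f p)"
      using cover[of 0] cover[of 20] sub by auto
    moreover have "tile_copy (map_tile f p)"
      using p f unfolding tile_copy_def congruent_copy_def by blast
    ultimately have "dist (0::complex) 20 \<le> 4" by (intro tile_diameter)
    then show False by simp
  qed
  then obtain m where m: "n = Suc m" by (cases n) auto
  define P where "P = (substitute ^^ m) {p}"
  have P: "patch P" unfolding P_def by (rule patch_iterate[OF p])
  have F': "F \<subseteq> map_tile f ` substitute P" using F by (simp add: m P_def)
  obtain t0 where t0: "t0 \<in> F" "0 \<in> region t0" using cover[of 0] by auto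
  obtain t0' s where s: "t0 = map_tile f t0'" "t0' \<in> substitute_tile s" "s \<in> P"
    using F' t0(1) by (auto simp: substitute_def)
  have cs: "tile_copy s" using P s(3) by (auto simp: patch_def)
  obtain w where w: "w \<in> corners s" using tile_finite(3)[OF cs] by blast
  have lam: "0 < lam" "lam \<le> 5 / 2" using sqrt2_bounds by simp_all
  have near: "f (lam *\<^sub>R w) \<in> cball 0 20"
  proof -
    obtain u where u: "u \<in> region s" "0 = f (lam *\<^sub>R u)"
      using t0(2) substitute_inside[OF s(2)] by (auto simp: s(1) region_map[OF f])
    have "dist u w \<le> 4" using tile_diameter[OF cs u(1)] w corners_region by blast
    have "dist 0 (f (lam *\<^sub>R w)) = dist (lam *\<^sub>R u) (lam *\<^sub>R w)"
      by (simp only: u(2) isometry_dist[OF f])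
    also have "\<dots> = lam * dist u w"
      using lam(1) by (simp add: dist_norm flip: scaleR_diff_right)
    also have "\<dots> \<le> 5 / 2 * 4" using lam \<open>dist u w \<le> 4\<close> by (intro mult_mono) auto
    finally show ?thesis by simp
  qed
  have "f (lam *\<^sub>R w) \<in> sharp t" if t: "t \<in> T" "f (lam *\<^sub>R w) \<in> region t" for t
  proof -
    have "t \<in> F" using t near by (auto simp: F_def)
    then obtain t' s' where s': "t = map_tile f t'" "t' \<in> substitute_tile s'" "s' \<in> P"
      using F' by (auto simp: substitute_def)
    have in_t': "lam *\<^sub>R w \<in> region t'"
      using t(2) isometry_inj[OF f] by (simp add: s'(1) region_map[OF f] inj_image_mem_iff)
    then have "w \<in> region s'" using substitute_inside[OF s'(2)] lam(1) by auto
    then have "w \<in> corners s'" by (rule patch_corner[OF P s(3) s'(3) w])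
    then have "lam *\<^sub>R w \<in> sharp t'" using substitute_at_corner[OF s'(2)] in_t' by blast
    then show ?thesis by (simp add: s'(1) sharp_map[OF f])
  qed
  then show ?thesis by blast
qed

text \<open>The edges at \<open>v\<close> are indexed by the eight eighth roots of unity. They are
  distinct because each ray determines its unit direction, and they pairwise share
  \<open>v\<close>.\<close>

lemma degree_bound:
  fixes v :: complex
  assumes c: "proper_edge_colouring (V, E) k c"
    and dirs: "\<And>b. b ^ 8 = 1 \<Longrightarrow> \<exists>r>0. {v, v + r *\<^sub>R b} \<in> E"
  shows "8 \<le> k"
proof -
  let ?B = "{b :: complex. b ^ 8 = 1}"
  have "\<forall>b\<in>?B. \<exists>r>0. {v, v + r *\<^sub>R b} \<in> E" using dirs by simp
  then obtain r where r: "\<forall>b\<in>?B. 0 < r b \<and> {v, v + r b *\<^sub>R b} \<in> E" by (rule bchoice[THEN exE])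
  define e where "e b = {v, v + r b *\<^sub>R b}" for b
  have norm1: "cmod b = 1" if "b \<in> ?B" for b using that cmod_root_unity[of b 8] by simp
  have "inj_on e ?B"
  proof (rule inj_onI)
    fix b d assume bd: "b \<in> ?B" "d \<in> ?B" "e b = e d"
    have "v + r b *\<^sub>R b = v + r d *\<^sub>R d"
      using bd(3) unfolding e_def doubleton_eq_iff by metis
    then have eq: "r b *\<^sub>R b = r d *\<^sub>R d" by (rule add_left_imp_eq)
    have pos: "0 < r b" "0 < r d" using r bd(1,2) by blast+
    from eq have "norm (r b *\<^sub>R b) = norm (r d *\<^sub>R d)" by (rule arg_cong)
    then have "r b = r d" using pos norm1[OF bd(1)] norm1[OF bd(2)] by simp
    then show "b = d" using eq pos(2) by simp
  qed
  moreover have "inj_on c (e ` ?B)"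
  proof (rule inj_onI)
    fix x y assume xy: "x \<in> e ` ?B" "y \<in> e ` ?B" "c x = c y"
    have "x \<in> E" "y \<in> E" using xy(1,2) r unfolding e_def by blast+
    moreover have "v \<in> x" "v \<in> y" using xy(1,2) unfolding e_def by blast+
    ultimately show "x = y"
      using c xy(3) unfolding proper_edge_colouring_def snd_conv by blast
  qed
  ultimately have "card ((c \<circ> e) ` ?B) = card ?B" by (intro card_image comp_inj_on)
  moreover have "(c \<circ> e) ` ?B \<subseteq> {..<k}"
  proof -
    have "c (e b) < k" if "b \<in> ?B" for b
      using c r that unfolding proper_edge_colouring_def snd_conv e_def by blast
    then show ?thesis by auto
  qed
  then have "card ((c \<circ> e) ` ?B) \<le> k" using card_mono[of "{..<k}"] by fastforce
  ultimately show ?thesis by (simp add: card_roots_unity_eq)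
qed

theorem proposition4p2:
  fixes T :: "tile set" and us :: "complex list"
  defines "us \<equiv> [Complex 1 0, Complex 1 1, Complex 0 1, Complex 1 (-1)]"
  assumes "ammann_beenker_tiling T"
    and "\<exists>t\<in>T. congruent_copy proto_rhombus t \<and> (\<exists>s\<in>sides t. parallel_to s (Complex 1 0))"
  shows "chromatic_index (tiling_graph T) = 8
    \<and> (\<exists>c. directional_alternating us (tiling_graph T) c)
    \<and> (\<forall>c. directional_alternating us (tiling_graph T) c
          \<longrightarrow> proper_edge_colouring (tiling_graph T) 8 c)"
proof -
  let ?V = "\<Union>t\<in>T. corners t" and ?E = "\<Union>t\<in>T. sides t"
  have til: "tiling T" using assms(2) by (simp add: ammann_beenker_tiling_def)
  \<comment> \<open>The horizontal side of a rhombus supplies the placement on which the directions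
    of all tiles depend.\<close>
  have P: "patch T" using assms(3) ammann_beenker_patch[OF assms(2)] by blast
  then have copy: "tile_copy t" if "t \<in> T" for t using that by (simp add: patch_def)
  interpret segments ?V ?E
  proof
    show "\<exists>x y. e = {x, y} \<and> x \<noteq> y" if "e \<in> ?E" for e
      using that tile_side_ends copy by blast
    show "\<exists>v. convex hull e \<inter> convex hull e' \<subseteq> {v}" if "e \<in> ?E" "e' \<in> ?E" "e \<noteq> e'" for e e'
      using that patch_sides_cross[OF P] by blast
    show "finite {e \<in> ?E. e \<inter> cball 0 R \<noteq> {}}" for R
    proof (rule finite_subset)
      show "{e \<in> ?E. e \<inter> cball 0 R \<noteq> {}} \<subseteq> (\<Union>t\<in>{t \<in> T. region t \<inter> cball 0 R \<noteq> {}}. sides t)"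
        using side_region hull_subset by fast
      show "finite (\<Union>t\<in>{t \<in> T. region t \<inter> cball 0 R \<noteq> {}}. sides t)"
        using tiling_locally_finite[OF til] tile_finite(1) copy by auto
    qed
  qed
  \<comment> \<open>Factoring the imaginary part of the fourth power leaves exactly four cases, one
    for each vector of \<open>us\<close>.\<close>
  have par: "\<exists>u\<in>set us. parallel_to e u" if e: "e \<in> ?E" for e
  proof -
    obtain x y where xy: "e = {x, y}" using ends[OF e] by blast
    have par: "parallel_to e u" if "y - x = r *\<^sub>R u" for u r
    proof -
      have "x = x + 0 *\<^sub>R u" "y = x + r *\<^sub>R u" using that by (simp_all add: algebra_simps)
      then show ?thesis unfolding parallel_to_def line_def xy by blast
    qed
    obtain a b where ab: "y - x = Complex a b" by (cases "y - x")
    have "(y - x) ^ 4 \<in> \<real>" using e P by (auto simp: xy patch_def octal_def)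
    then consider "a = 0" | "b = 0" | "a = b" | "a = - b" by (auto simp: ab pow4_real)
    then show ?thesis
    proof cases
      case 1
      then have "parallel_to e (Complex 0 1)"
        by (intro par[of b]) (simp add: ab complex_eq_iff)
      then show ?thesis by (simp add: us_def)
    next
      case 2
      then have "parallel_to e (Complex 1 0)"
        by (intro par[of a]) (simp add: ab complex_eq_iff)
      then show ?thesis by (simp add: us_def)
    next
      case 3
      then have "parallel_to e (Complex 1 1)"
        by (intro par[of a]) (simp add: ab complex_eq_iff)
      then show ?thesis by (simp add: us_def)
    next
      case 4
      then have "parallel_to e (Complex 1 (- 1))"
        by (intro par[of a]) (simp add: ab complex_eq_iff)
      then show ?thesis by (simp add: us_def)
    qed
  qed
  have "0 \<notin> set us" by (simp add: us_def complex_eq_iff)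
  moreover have "\<forall>i<length us. \<forall>j<length us. i \<noteq> j \<longrightarrow> \<not> collinear {0, us ! i, us ! j}"
    by (auto simp: us_def less_Suc_eq collinear_lemma complex_eq_iff numeral_eq_Suc)
  ultimately have ex: "\<exists>c. directional_alternating us (?V, ?E) c"
    using alternating_exists par by blast
  have proper: "proper_edge_colouring (?V, ?E) 8 c" if "directional_alternating us (?V, ?E) c" for c
    using alternating_proper[OF that] by (simp add: us_def)
  obtain v where v: "\<forall>t\<in>T. v \<in> region t \<longrightarrow> v \<in> sharp t"
    using sharp_corner_exists[OF assms(2)] by blast
  have "8 \<le> k" if "proper_edge_colouring (?V, ?E) k c" for k c
    using all_directions[OF til P, of v] v by (intro degree_bound[OF that, of v]) blast
  moreover obtain c where "proper_edge_colouring (?V, ?E) 8 c" using ex proper by blast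
  ultimately have "chromatic_index (?V, ?E) = enat 8"
    unfolding chromatic_index_def
    by (intro antisym Inf_lower Inf_greatest) auto
  then show ?thesis using ex proper by (auto simp: tiling_graph_def numeral_eq_enat)
qed

end
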